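(* Let $G$ be a finite group which is not exceptional, acting holomorphically and faithfully on each of the elliptic curves $E_1,\ldots,E_n$, such that the diagonal action of $G$ on $E_1\times\cdots\times E_n$ is rigid. Then the quotient $(E_1\times\cdots\times E_n)/G$ is isomorphic to $X_{n,d}:=E^n/\mathbb{Z}_d$, where $\mathbb{Z}_d$ acts on $E^n$ by multiplication with $\zeta_d\cdot\mathrm{Id}$, and where $d\in\{3,6\}$ and $E=\mathbb{C}/\mathbb{Z}[\zeta_3]$ is the Fermat elliptic curve, or $d=4$ and $E=\mathbb{C}/\mathbb{Z}[i]$ is the harmonic elliptic curve.
   Context: A holomorphic action of a finite group $G$ on a compact complex manifold $X$ is called rigid (meaning infinitesimally rigid) if $H^1(X,\Theta_X)^G=0$, where $\Theta_X$ is the sheaf of holomorphic vector fields. The diagonal action is $g(x_1,\ldots,x_n):=(gx_1,\ldots,gx_n)$. Notation: $\mathbb{Z}_m=\mathbb{Z}/m\mathbb{Z}$, $\zeta_d=\exp(2\pi i/d)$. A finite group is called exceptional if it is isomorphic to one of the four groups $$\mathbb{Z}_3^2,\quad \mathbb{Z}_3^2\rtimes_{\varphi_3}\mathbb{Z}_3,\quad \mathbb{Z}_2\times\mathbb{Z}_4,\quad \mathbb{Z}_2^2\rtimes_{\varphi_4}\mathbb{Z}_4,$$ where $\varphi_3(1)(a,b)=(-b,a-b)$ and $\varphi_4(1)(a,b)=(-b,a)$. *)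

theory Defs
  imports
    "HOL-Analysis.Analysis"
    "HOL-Algebra.Group_Action"
    "HOL-Algebra.Elementary_Groups"
begin

section \<open>Complex spaces as spaces with a sheaf of functions\<close>

text \<open>
  A reduced complex space is encoded by its topology and its structure sheaf, seen as a sheaf of
  complex-valued functions: \<open>f \<in> hol X U\<close> means that \<open>f\<close> is holomorphic on the open set \<open>U\<close>. As
  functions are total, values of \<open>f\<close> outside \<open>U\<close> are irrelevant, and \<open>hol X U\<close> is meaningful only
  for open \<open>U\<close>.
\<close>

record 'a cspace =
  ctop :: "'a topology"
  hol :: "'a set \<Rightarrow> ('a \<Rightarrow> complex) set"

definition pre :: "'a cspace \<Rightarrow> ('a \<Rightarrow> 'b) \<Rightarrow> 'b set \<Rightarrow> 'a set" where
  "pre X F U = {x \<in> topspace (ctop X). F x \<in> U}"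

definition holomorphic_map :: "'a cspace \<Rightarrow> 'b cspace \<Rightarrow> ('a \<Rightarrow> 'b) \<Rightarrow> bool" where
  "holomorphic_map X Y F \<longleftrightarrow>
     continuous_map (ctop X) (ctop Y) F \<and>
     (\<forall>U f. openin (ctop Y) U \<longrightarrow> f \<in> hol Y U \<longrightarrow> f \<circ> F \<in> hol X (pre X F U))"

definition biholomorphic :: "'a cspace \<Rightarrow> 'b cspace \<Rightarrow> bool" where
  "biholomorphic X Y \<longleftrightarrow>
     (\<exists>F F'. holomorphic_map X Y F \<and> holomorphic_map Y X F' \<and>
        (\<forall>x \<in> topspace (ctop X). F' (F x) = x) \<and> (\<forall>y \<in> topspace (ctop Y). F (F' y) = y))"

text \<open>
  The quotient along \<open>p\<close> has the quotient topology, and its holomorphic functions are those whose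
  pullback is holomorphic. For the quotient by a finite group (or by a lattice) this is the
  structure sheaf of invariant holomorphic functions.
\<close>

definition quotient_topology :: "'a topology \<Rightarrow> ('a \<Rightarrow> 'b) \<Rightarrow> 'b topology" where
  "quotient_topology T p =
     topology (\<lambda>U. U \<subseteq> p ` topspace T \<and> openin T {x \<in> topspace T. p x \<in> U})"

lemma openin_quotient_topology:
  "openin (quotient_topology T p) U \<longleftrightarrow>
     U \<subseteq> p ` topspace T \<and> openin T {x \<in> topspace T. p x \<in> U}"
proof -
  have "istopology (\<lambda>U. U \<subseteq> p ` topspace T \<and> openin T {x \<in> topspace T. p x \<in> U})"
    unfolding istopology_def
  proof (intro conjI allI impI)
    fix S S'
    assume "S \<subseteq> p ` topspace T \<and> openin T {x \<in> topspace T. p x \<in> S}"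
      and "S' \<subseteq> p ` topspace T \<and> openin T {x \<in> topspace T. p x \<in> S'}"
    moreover have "{x \<in> topspace T. p x \<in> S \<inter> S'} =
        {x \<in> topspace T. p x \<in> S} \<inter> {x \<in> topspace T. p x \<in> S'}" by auto
    ultimately show "S \<inter> S' \<subseteq> p ` topspace T" "openin T {x \<in> topspace T. p x \<in> S \<inter> S'}"
      by auto
  next
    fix \<K>
    assume K: "\<forall>S\<in>\<K>. S \<subseteq> p ` topspace T \<and> openin T {x \<in> topspace T. p x \<in> S}"
    then show "\<Union>\<K> \<subseteq> p ` topspace T" by auto
    have "{x \<in> topspace T. p x \<in> \<Union>\<K>} = \<Union>((\<lambda>S. {x \<in> topspace T. p x \<in> S}) ` \<K>)" by auto
    with K show "openin T {x \<in> topspace T. p x \<in> \<Union>\<K>}" by auto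
  qed
  then show ?thesis by (simp add: quotient_topology_def topology_inverse')
qed

definition quotient_cspace :: "'a cspace \<Rightarrow> ('a \<Rightarrow> 'b) \<Rightarrow> 'b cspace" where
  "quotient_cspace X p =
     \<lparr>ctop = quotient_topology (ctop X) p, hol = (\<lambda>U. {f. f \<circ> p \<in> hol X (pre X p U)})\<rparr>"

definition group_quotient ::
    "('g, 'c) monoid_scheme \<Rightarrow> 'a cspace \<Rightarrow> ('g \<Rightarrow> 'a \<Rightarrow> 'a) \<Rightarrow> 'a set cspace" where
  "group_quotient G X \<phi> = quotient_cspace X (orbit G \<phi>)"

definition holomorphic_action ::
    "('g, 'c) monoid_scheme \<Rightarrow> 'a cspace \<Rightarrow> ('g \<Rightarrow> 'a \<Rightarrow> 'a) \<Rightarrow> bool" where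
  "holomorphic_action G X \<phi> \<longleftrightarrow>
     group_action G (topspace (ctop X)) \<phi> \<and> (\<forall>g \<in> carrier G. holomorphic_map X X (\<phi> g))"

definition faithful_holomorphic_action ::
    "('g, 'c) monoid_scheme \<Rightarrow> 'a cspace \<Rightarrow> ('g \<Rightarrow> 'a \<Rightarrow> 'a) \<Rightarrow> bool" where
  "faithful_holomorphic_action G X \<phi> \<longleftrightarrow>
     holomorphic_action G X \<phi> \<and> faithful_action G (topspace (ctop X)) \<phi>"


section \<open>The sheaf of holomorphic vector fields\<close>

text \<open>
  \<open>germs X x\<close> consists of the functions defining a germ in the stalk of the structure sheaf at \<open>x\<close>.
  A (holomorphic) tangent vector at \<open>x\<close> is a complex-linear derivation of this stalk; a holomorphic
  vector field is a family of tangent vectors that maps holomorphic functions to holomorphic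
  functions. A tangent vector is represented by a function on \<open>'a \<Rightarrow> complex\<close> of which only
  the values on germs at \<open>x\<close> matter.
\<close>

definition germs :: "'a cspace \<Rightarrow> 'a \<Rightarrow> ('a \<Rightarrow> complex) set" where
  "germs X x = {f. \<exists>U. openin (ctop X) U \<and> x \<in> U \<and> f \<in> hol X U}"

definition tangent_vector :: "'a cspace \<Rightarrow> 'a \<Rightarrow> (('a \<Rightarrow> complex) \<Rightarrow> complex) \<Rightarrow> bool" where
  "tangent_vector X x v \<longleftrightarrow>
     (\<forall>f \<in> germs X x. \<forall>g \<in> germs X x.
        (\<forall>U. openin (ctop X) U \<and> x \<in> U \<and> (\<forall>y \<in> U. f y = g y) \<longrightarrow> v f = v g) \<and>
        v (\<lambda>y. f y + g y) = v f + v g \<and>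
        v (\<lambda>y. f y * g y) = f x * v g + v f * g x) \<and>
     (\<forall>f \<in> germs X x. \<forall>c. v (\<lambda>y. c * f y) = c * v f)"

type_synonym 'a vfield = "'a \<Rightarrow> ('a \<Rightarrow> complex) \<Rightarrow> complex"

definition vector_field :: "'a cspace \<Rightarrow> 'a set \<Rightarrow> 'a vfield \<Rightarrow> bool" where
  "vector_field X U v \<longleftrightarrow>
     (\<forall>x \<in> U. tangent_vector X x (v x)) \<and>
     (\<forall>V f. openin (ctop X) V \<and> V \<subseteq> U \<and> f \<in> hol X V \<longrightarrow> (\<lambda>x. v x f) \<in> hol X V)"

definition push_vfield :: "'a cspace \<Rightarrow> ('a \<Rightarrow> 'a) \<Rightarrow> 'a vfield \<Rightarrow> 'a vfield" where
  "push_vfield X g v = (\<lambda>y f. v (inv_into (topspace (ctop X)) g y) (f \<circ> g))"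


section \<open>The first cohomology of the sheaf of holomorphic vector fields\<close>

text \<open>
  \<open>H1\<close> is Cech cohomology, the direct limit over all open covers, of the sheaf of holomorphic vector
  fields; in degree one it is sheaf cohomology. A cocycle is an open cover \<open>\<U>\<close> together with
  vector fields \<open>\<theta> U V\<close> on \<open>U \<inter> V\<close>. Two cocycles are identified when they differ by a coboundary
  after passing to a common refinement \<open>\<W>\<close>, with refinement maps \<open>r\<close> and \<open>s\<close>.
\<close>

type_synonym 'a cech1 = "'a set set \<times> ('a set \<Rightarrow> 'a set \<Rightarrow> 'a vfield)"

definition open_cover :: "'a cspace \<Rightarrow> 'a set set \<Rightarrow> bool" where
  "open_cover X \<U> \<longleftrightarrow> (\<forall>U \<in> \<U>. openin (ctop X) U) \<and> \<Union>\<U> = topspace (ctop X)"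

definition cocycles :: "'a cspace \<Rightarrow> 'a cech1 set" where
  "cocycles X = {(\<U>, \<theta>). open_cover X \<U> \<and>
     (\<forall>U \<in> \<U>. \<forall>V \<in> \<U>. vector_field X (U \<inter> V) (\<theta> U V)) \<and>
     (\<forall>U \<in> \<U>. \<forall>V \<in> \<U>. \<forall>W \<in> \<U>. \<forall>x \<in> U \<inter> V \<inter> W. \<forall>f \<in> germs X x.
        \<theta> U V x f + \<theta> V W x f = \<theta> U W x f)}"

definition cohomologous :: "'a cspace \<Rightarrow> ('a cech1 \<times> 'a cech1) set" where
  "cohomologous X = {((\<U>, \<theta>), (\<V>, \<eta>)).
     (\<U>, \<theta>) \<in> cocycles X \<and> (\<V>, \<eta>) \<in> cocycles X \<and>
     (\<exists>\<W> r s \<tau>. open_cover X \<W> \<and>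
        (\<forall>W \<in> \<W>. r W \<in> \<U> \<and> W \<subseteq> r W \<and> s W \<in> \<V> \<and> W \<subseteq> s W \<and> vector_field X W (\<tau> W)) \<and>
        (\<forall>W \<in> \<W>. \<forall>W' \<in> \<W>. \<forall>x \<in> W \<inter> W'. \<forall>f \<in> germs X x.
           \<theta> (r W) (r W') x f - \<eta> (s W) (s W') x f = \<tau> W' x f - \<tau> W x f))}"

definition H1 :: "'a cspace \<Rightarrow> 'a cech1 set set" where
  "H1 X = cocycles X // cohomologous X"

definition H1_zero :: "'a cspace \<Rightarrow> 'a cech1 set" where
  "H1_zero X = cohomologous X `` {({topspace (ctop X)}, \<lambda>_ _ _ _. 0)}"

definition push_cocycle :: "'a cspace \<Rightarrow> ('a \<Rightarrow> 'a) \<Rightarrow> 'a cech1 \<Rightarrow> 'a cech1" where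
  "push_cocycle X g = (\<lambda>(\<U>, \<theta>).
     ((`) g ` \<U>, \<lambda>U V. push_vfield X g (\<theta> (pre X g U) (pre X g V))))"

definition push_H1 :: "'a cspace \<Rightarrow> ('a \<Rightarrow> 'a) \<Rightarrow> 'a cech1 set \<Rightarrow> 'a cech1 set" where
  "push_H1 X g c = cohomologous X `` (push_cocycle X g ` c)"

definition rigid_action ::
    "('g, 'c) monoid_scheme \<Rightarrow> 'a cspace \<Rightarrow> ('g \<Rightarrow> 'a \<Rightarrow> 'a) \<Rightarrow> bool" where
  "rigid_action G X \<phi> \<longleftrightarrow>
     {c \<in> H1 X. \<forall>g \<in> carrier G. push_H1 X (\<phi> g) c = c} = {H1_zero X}"


section \<open>Elliptic curves and their products\<close>

definition complex_line :: "complex cspace" where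
  "complex_line = \<lparr>ctop = euclidean, hol = (\<lambda>U. {f. f holomorphic_on U})\<rparr>"

text \<open>Holomorphic functions of several variables: the real derivative exists and is complex-linear.\<close>

definition complex_affine_space :: "(complex ^ 'n::finite) cspace" where
  "complex_affine_space = \<lparr>ctop = euclidean,
     hol = (\<lambda>U. {f. \<forall>z \<in> U. \<exists>D. (f has_derivative D) (at z) \<and> (\<forall>c w. D (c *s w) = c * D w)})\<rparr>"

definition complex_lattice :: "complex set \<Rightarrow> bool" where
  "complex_lattice \<Lambda> \<longleftrightarrow>
     (\<exists>a b. a \<noteq> b \<and> independent {a, b} \<and> \<Lambda> = {of_int m * a + of_int n * b | m n. True})"

definition coset :: "complex set \<Rightarrow> complex \<Rightarrow> complex set" where
  "coset \<Lambda> z = (+) z ` \<Lambda>"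

definition elliptic_curve :: "complex set \<Rightarrow> complex set cspace" where
  "elliptic_curve \<Lambda> = quotient_cspace complex_line (coset \<Lambda>)"

text \<open>
  The product of the curves \<open>\<complex>/\<Lambda> j\<close> has the product topology; its complex structure is the one for
  which the componentwise projection from \<open>\<complex>\<^sup>n\<close> is locally biholomorphic.
\<close>

definition coset_map :: "('n \<Rightarrow> complex set) \<Rightarrow> complex ^ 'n::finite \<Rightarrow> 'n \<Rightarrow> complex set" where
  "coset_map \<Lambda> z = (\<lambda>j. coset (\<Lambda> j) (z $ j))"

definition curve_product :: "('n::finite \<Rightarrow> complex set) \<Rightarrow> ('n \<Rightarrow> complex set) cspace" where
  "curve_product \<Lambda> =
     \<lparr>ctop = product_topology (\<lambda>j. ctop (elliptic_curve (\<Lambda> j))) UNIV,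
      hol = (\<lambda>U. {f. f \<circ> coset_map \<Lambda> \<in>
        hol complex_affine_space (pre complex_affine_space (coset_map \<Lambda>) U)})\<rparr>"

definition diagonal_action ::
    "('n::finite \<Rightarrow> complex set) \<Rightarrow> ('n \<Rightarrow> 'g \<Rightarrow> complex set \<Rightarrow> complex set) \<Rightarrow>
     'g \<Rightarrow> ('n \<Rightarrow> complex set) \<Rightarrow> ('n \<Rightarrow> complex set)" where
  "diagonal_action \<Lambda> \<phi> g = restrict (\<lambda>x j. \<phi> j g (x j)) (topspace (ctop (curve_product \<Lambda>)))"

definition zeta :: "nat \<Rightarrow> complex" where
  "zeta d = exp (2 * of_real pi * \<i> / of_nat d)"

text \<open>The ring generated by \<open>w\<close>, for \<open>w\<close> a quadratic integer such as \<open>zeta 3\<close> or \<open>\<i>\<close>.\<close>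

definition quadratic_ring :: "complex \<Rightarrow> complex set" where
  "quadratic_ring w = {of_int m + of_int n * w | m n. True}"

text \<open>
  Multiplication by \<open>zeta d\<close> on \<open>\<complex>/\<Lambda>\<close>, for \<open>zeta d * \<Lambda> = \<Lambda>\<close>, sends a coset to its image under
  multiplication.
\<close>

definition mult_action ::
    "nat \<Rightarrow> complex set \<Rightarrow> int \<Rightarrow> ('n::finite \<Rightarrow> complex set) \<Rightarrow> ('n \<Rightarrow> complex set)" where
  "mult_action d \<Lambda> k =
     restrict (\<lambda>x j. (*) (zeta d ^ nat k) ` x j) (topspace (ctop (curve_product (\<lambda>_. \<Lambda>))))"

definition X_quotient :: "nat \<Rightarrow> complex set \<Rightarrow> ('n::finite \<Rightarrow> complex set) set cspace" where
  "X_quotient d \<Lambda> =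
     group_quotient (integer_mod_group d) (curve_product (\<lambda>_. \<Lambda>)) (mult_action d \<Lambda>)"


section \<open>Exceptional groups\<close>

definition semidirect_product ::
    "('a, 'c) monoid_scheme \<Rightarrow> ('h, 'd) monoid_scheme \<Rightarrow> ('h \<Rightarrow> 'a \<Rightarrow> 'a) \<Rightarrow> ('a \<times> 'h) monoid" where
  "semidirect_product N H \<phi> =
     \<lparr>carrier = carrier N \<times> carrier H,
      monoid.mult = (\<lambda>(n, h) (n', h'). (n \<otimes>\<^bsub>N\<^esub> \<phi> h n', h \<otimes>\<^bsub>H\<^esub> h')),
      one = (\<one>\<^bsub>N\<^esub>, \<one>\<^bsub>H\<^esub>)\<rparr>"

definition phi3 :: "int \<Rightarrow> int \<times> int \<Rightarrow> int \<times> int" where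
  "phi3 k = (\<lambda>(a, b). ((- b) mod 3, (a - b) mod 3)) ^^ nat k"

definition phi4 :: "int \<Rightarrow> int \<times> int \<Rightarrow> int \<times> int" where
  "phi4 k = (\<lambda>(a, b). ((- b) mod 2, a mod 2)) ^^ nat k"

definition exceptional :: "('g, 'c) monoid_scheme \<Rightarrow> bool" where
  "exceptional G \<longleftrightarrow>
     (let Z = integer_mod_group in
      G \<cong> Z 3 \<times>\<times> Z 3 \<or>
      G \<cong> semidirect_product (Z 3 \<times>\<times> Z 3) (Z 3) phi3 \<or>
      G \<cong> Z 2 \<times>\<times> Z 4 \<or>
      G \<cong> semidirect_product (Z 2 \<times>\<times> Z 2) (Z 4) phi4)"

end

(*
  Every automorphism of an elliptic curve lifts to an affine map, so G acts on E_j by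
  z -> rho_j(g) z + beta_j(g), and the image of the character rho_j is a group of roots of unity.
  If rho_i rho_j were trivial, the class of d(cnj z_i) (x) d/dz_j would be a nonzero invariant in H^1;
  hence the image of rho_j has order d_j in {3,4,6}. Two translation subgroups ker rho_i and ker rho_j
  can only differ for the exceptional groups, because an element of one of them outside the other
  has order 2 or 3 and commutes with the intersection, which makes both 2-torsion or 3-torsion
  subgroups of the curves. Otherwise all kernels agree, and rigidity makes all rho_j equal to one
  character rho. Then G lifts to the group generated by a lattice L in C^n that is stable under zeta_d
  and by zeta_d acting as a scalar around a fixed point. Since Z[zeta_d] is Euclidean, L is free, and a
  linear change of coordinates turns L into Z[zeta_d]^n.
*)
theory Submission
  imports Defs "HOL-Complex_Analysis.Cauchy_Integral_Formula" "HOL-Algebra.Multiplicative_Group"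
begin

section \<open>Lattices and elliptic curves\<close>

text \<open>The cohomology group is never computed. Rigidity enters only through one explicit Cech
  class, whose nontriviality is checked by hand. Sections of the structure sheaf are merely complex
  differentiable functions, so turning a coordinate direction into a vector field requires that
  partial derivatives are again holomorphic; this is obtained from Cauchy estimates on complex
  lines. The case i = j of the product condition says that the square of rho_j is nontrivial, which
  leaves only the orders 3, 4, 6 among the multipliers of a lattice. With a common kernel, rho_i and
  rho_j are faithful characters of the same cyclic group of order d; since d in {3,4,6} has exactly
  two primitive residue classes, they are equal or inverse to each other, and the inverse case is
  the one that rigidity forbids. The exceptional groups are found by playing one curve against the
  other: an element that translates one curve but not the other has a fixed point on the other,
  which determines its order, while a curve has only m^2 translations of order dividing m.\<close>

locale curve_lattice =
  fixes \<Lambda> :: "complex set"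
  assumes lattice: "complex_lattice \<Lambda>"
begin

text \<open>Membership in the lattice becomes integrality of two bounded real-linear functionals,
  the form from which discreteness, bounded representatives and lifting all follow.\<close>

lemma coordinates:
  obtains a b :: complex and x y :: "complex \<Rightarrow> real"
  where "bounded_linear x" "bounded_linear y"
    "\<And>z. z = of_real (x z) * a + of_real (y z) * b"
    "\<And>s t. x (of_real s * a + of_real t * b) = s"
    "\<And>s t. y (of_real s * a + of_real t * b) = t"
    "\<Lambda> = {z. x z \<in> \<int> \<and> y z \<in> \<int>}"
proof -
  obtain a b where ab: "a \<noteq> b" "independent {a, b}"
    and L: "\<Lambda> = {of_int m * a + of_int n * b | m n. True}"
    using lattice unfolding complex_lattice_def by blast
  have a0: "a \<noteq> 0" using ab(2) dependent_zero by blast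
  have bspan: "b \<notin> span {a}"
    using ab by (metis independent_insert insert_commute insert_iff empty_iff)
  \<comment> \<open>The signed area of the period parallelogram; \<open>x\<close> and
    \<open>y\<close> below are Cramer's rule with determinant \<open>D\<close>.\<close>
  define D where "D = Im (cnj a * b)"
  have D0: "D \<noteq> 0"
  proof
    assume "D = 0"
    then have eq: "cnj a * b = of_real (Re (cnj a * b))"
      by (simp add: D_def complex_eq_iff)
    have "cnj a * (a * b) = a * of_real (Re (cnj a * b))"
      using eq by (metis mult.assoc mult.commute)
    then have "b * (a * cnj a) = a * of_real (Re (cnj a * b))"
      by (simp add: algebra_simps)
    then have "b * of_real ((norm a)\<^sup>2) = a * of_real (Re (cnj a * b))"
      by (simp only: complex_norm_square)
    then have "b = (Re (cnj a * b) / (norm a)\<^sup>2) *\<^sub>R a"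
      using a0 by (simp add: scaleR_conv_of_real field_simps)
    then have "b \<in> span {a}" by (metis span_base span_scale insertI1)
    then show False using bspan by blast
  qed
  define x where "x z = - Im (cnj b * z) / D" for z
  define y where "y z = Im (cnj a * z) / D" for z
  have xy: "x (of_real s * a + of_real t * b) = s" "y (of_real s * a + of_real t * b) = t" for s t
    using D0 by (simp_all add: x_def y_def D_def divide_simps) (simp_all add: algebra_simps)
  have dec: "z = of_real (x z) * a + of_real (y z) * b" for z
    using D0 by (simp add: x_def y_def complex_eq_iff divide_simps) (simp add: D_def algebra_simps)
  have blx: "bounded_linear x" unfolding x_def
    by (intro bounded_linear_divide bounded_linear_minus
        bounded_linear_compose [OF bounded_linear_Im] bounded_linear_mult_right bounded_linear_compose [OF bounded_linear_divide])
  have bly: "bounded_linear y" unfolding y_def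
    by (intro bounded_linear_compose [OF bounded_linear_Im] bounded_linear_mult_right bounded_linear_compose [OF bounded_linear_divide])
  have "\<Lambda> = {z. x z \<in> \<int> \<and> y z \<in> \<int>}"
  proof safe
    fix z assume "z \<in> \<Lambda>"
    then obtain m n where "z = of_int m * a + of_int n * b" using L by blast
    then show "x z \<in> \<int>" "y z \<in> \<int>" using xy[of "of_int m" "of_int n"] by simp_all
  next
    fix z assume "x z \<in> \<int>" "y z \<in> \<int>"
    then obtain m n where mn: "x z = of_int m" "y z = of_int n" by (auto elim!: Ints_cases)
    have "z = of_int m * a + of_int n * b" using dec[of z] unfolding mn by simp
    then show "z \<in> \<Lambda>" using L by blast
  qed
  then show ?thesis using that blx bly dec xy by blast
qed

lemma zero_mem [simp]: "0 \<in> \<Lambda>"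
  and add_mem: "\<And>u v. u \<in> \<Lambda> \<Longrightarrow> v \<in> \<Lambda> \<Longrightarrow> u + v \<in> \<Lambda>"
  and minus_mem: "\<And>u. u \<in> \<Lambda> \<Longrightarrow> - u \<in> \<Lambda>"
  and of_int_mult_mem: "\<And>k u. u \<in> \<Lambda> \<Longrightarrow> of_int k * u \<in> \<Lambda>"
proof -
  obtain a b x y where bl: "bounded_linear x" "bounded_linear y"
    and dec: "\<And>z. z = of_real (x z) * a + of_real (y z) * b"
    and xy: "\<And>s t. x (of_real s * a + of_real t * b) = s"
      "\<And>s t. y (of_real s * a + of_real t * b) = t"
    and c: "\<Lambda> = {z. x z \<in> \<int> \<and> y z \<in> \<int>}"
    by (rule coordinates, rule that)
  interpret x: bounded_linear x by (rule bl)
  interpret y: bounded_linear y by (rule bl)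
  show "0 \<in> \<Lambda>" "\<And>u v. u \<in> \<Lambda> \<Longrightarrow> v \<in> \<Lambda> \<Longrightarrow> u + v \<in> \<Lambda>" "\<And>u. u \<in> \<Lambda> \<Longrightarrow> - u \<in> \<Lambda>"
    by (auto simp: c x.zero y.zero x.add y.add x.neg y.neg)
  fix k u assume u: "u \<in> \<Lambda>"
  have "of_int k * u = (of_int k :: real) *\<^sub>R u" by (simp add: scaleR_conv_of_real)
  then show "of_int k * u \<in> \<Lambda>" using u by (simp add: c x.scaleR y.scaleR)
qed

lemma diff_mem: "u \<in> \<Lambda> \<Longrightarrow> v \<in> \<Lambda> \<Longrightarrow> u - v \<in> \<Lambda>"
  using add_mem[of u "- v"] minus_mem[of v] by simp

lemma add_mem_iff: "v \<in> \<Lambda> \<Longrightarrow> u + v \<in> \<Lambda> \<longleftrightarrow> u \<in> \<Lambda>"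
  using add_mem[of u v] diff_mem[of "u + v" v] by auto

lemma minus_mem_iff: "- u \<in> \<Lambda> \<longleftrightarrow> u \<in> \<Lambda>"
  using minus_mem by force

lemma discrete:
  obtains e where "e > 0" "\<And>l. l \<in> \<Lambda> \<Longrightarrow> norm l < e \<Longrightarrow> l = 0"
proof -
  obtain a b x y where bl: "bounded_linear x" "bounded_linear y"
    and dec: "\<And>z. z = of_real (x z) * a + of_real (y z) * b"
    and xy: "\<And>s t. x (of_real s * a + of_real t * b) = s"
      "\<And>s t. y (of_real s * a + of_real t * b) = t"
    and c: "\<Lambda> = {z. x z \<in> \<int> \<and> y z \<in> \<int>}"
    by (rule coordinates, rule that)
  obtain B where B: "B > 0" "\<And>z. norm (x z) \<le> norm z * B"
    using bounded_linear.pos_bounded[OF bl(1)] by blast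
  obtain C where C: "C > 0" "\<And>z. norm (y z) \<le> norm z * C"
    using bounded_linear.pos_bounded[OF bl(2)] by blast
  show ?thesis
  proof
    \<comment> \<open>Below this norm both integer coordinates have modulus less than 1.\<close>
    show "1 / (B + C) > 0" using B C by simp
    fix l assume l: "l \<in> \<Lambda>" "norm l < 1 / (B + C)"
    have "norm l * (B + C) < 1" using l(2) B C by (simp add: field_simps)
    moreover have "norm l * B \<ge> 0" "norm l * C \<ge> 0" using B C by auto
    ultimately have "\<bar>x l\<bar> < 1" "\<bar>y l\<bar> < 1"
      using B(2)[of l] C(2)[of l] by (auto simp: algebra_simps)
    then have l0: "x l = 0" "y l = 0" using l(1) c by (auto simp: Ints_nonzero_abs_less1)
    show "l = 0" using dec[of l] unfolding l0 by simp
  qed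
qed

lemma bounded_representatives:
  obtains M where "\<And>z. \<exists>l\<in>\<Lambda>. norm (z - l) \<le> M"
proof -
  obtain a b x y where bl: "bounded_linear x" "bounded_linear y"
    and dec: "\<And>z. z = of_real (x z) * a + of_real (y z) * b"
    and xy: "\<And>s t. x (of_real s * a + of_real t * b) = s"
      "\<And>s t. y (of_real s * a + of_real t * b) = t"
    and c: "\<Lambda> = {z. x z \<in> \<int> \<and> y z \<in> \<int>}"
    by (rule coordinates, rule that)
  show ?thesis
  proof
    fix z
    define l where "l = of_real (of_int \<lfloor>x z\<rfloor>) * a + of_real (of_int \<lfloor>y z\<rfloor>) * b"
    have "x l \<in> \<int>" "y l \<in> \<int>" unfolding l_def xy by auto
    then have "l \<in> \<Lambda>" using c by blast
    have "z - l = of_real (frac (x z)) * a + of_real (frac (y z)) * b"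
      by (subst dec) (simp add: l_def frac_def algebra_simps)
    then have "norm (z - l) \<le> frac (x z) * norm a + frac (y z) * norm b"
      by (metis norm_triangle_ineq norm_mult norm_of_real abs_of_nonneg frac_ge_0)
    also have "\<dots> \<le> 1 * norm a + 1 * norm b"
      by (intro add_mono mult_right_mono) (auto simp: less_imp_le frac_lt_1)
    finally show "\<exists>l\<in>\<Lambda>. norm (z - l) \<le> 1 * norm a + 1 * norm b"
      using \<open>l \<in> \<Lambda>\<close> by blast
  qed
qed

text \<open>The lattice spans the plane over the reals, so conjugation would be complex linear
  everywhere, which \<open>1\<close> and \<open>\<i>\<close> refute. It is the final contradiction
  for the Cech class; with \<open>c = 0\<close> it also yields a nonzero lattice point.\<close>

lemma not_conjugate_scaling: "\<not> (\<forall>l\<in>\<Lambda>. cnj l = c * l)"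
proof
  assume cnj: "\<forall>l\<in>\<Lambda>. cnj l = c * l"
  obtain a b x y where bl: "bounded_linear x" "bounded_linear y"
    and dec: "\<And>z. z = of_real (x z) * a + of_real (y z) * b"
    and xy: "\<And>s t. x (of_real s * a + of_real t * b) = s"
      "\<And>s t. y (of_real s * a + of_real t * b) = t"
    and c: "\<Lambda> = {z. x z \<in> \<int> \<and> y z \<in> \<int>}"
    by (rule coordinates, rule that)
  have "a \<in> \<Lambda>" "b \<in> \<Lambda>" using xy[of 1 0] xy[of 0 1] by (auto simp: c)
  then have "cnj a = c * a" "cnj b = c * b" using cnj by auto
  then have "cnj z = c * z" for z by (subst (1 2) dec) (simp add: algebra_simps)
  from this[of 1] this[of \<i>] show False by (simp add: complex_eq_iff)
qed

lemma nonzero_member: obtains l where "l \<in> \<Lambda>" "l \<noteq> 0"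
  using not_conjugate_scaling[of 0] by (metis complex_cnj_zero mult_zero_left)

lemma continuous_into_lattice_constant:
  fixes f :: "complex \<Rightarrow> complex"
  assumes "continuous_on UNIV f" "\<And>z. f z \<in> \<Lambda>"
  shows "f z = f w"
proof -
  obtain e where e: "e > 0" "\<And>l. l \<in> \<Lambda> \<Longrightarrow> norm l < e \<Longrightarrow> l = 0" using discrete by blast
  have "f constant_on UNIV"
  proof (rule continuous_discrete_range_constant[OF connected_UNIV assms(1)])
    fix x show "\<exists>e>0. \<forall>y. y \<in> UNIV \<and> f y \<noteq> f x \<longrightarrow> e \<le> norm (f y - f x)"
      using e assms(2) by (intro exI[of _ e]) (metis diff_mem eq_iff_diff_eq_0 not_le)
  qed
  then show ?thesis by (auto simp: constant_on_def)
qed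

lemma coset_eq_iff: "coset \<Lambda> z = coset \<Lambda> w \<longleftrightarrow> z - w \<in> \<Lambda>"
proof
  assume "coset \<Lambda> z = coset \<Lambda> w"
  moreover have "z \<in> coset \<Lambda> z" by (auto simp: coset_def intro!: image_eqI[of _ _ 0])
  ultimately show "z - w \<in> \<Lambda>" by (auto simp: coset_def)
next
  assume d: "z - w \<in> \<Lambda>"
  have "u \<in> coset \<Lambda> v" if "u \<in> coset \<Lambda> v'" "v' - v \<in> \<Lambda>" for u v v'
  proof -
    from that obtain l where "l \<in> \<Lambda>" "u = v' + l" by (auto simp: coset_def)
    then show ?thesis using add_mem[OF that(2), of l]
      by (auto simp: coset_def intro!: image_eqI[of _ _ "v' - v + l"])
  qed
  then show "coset \<Lambda> z = coset \<Lambda> w" using d minus_mem[OF d] by auto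
qed

lemma coset_add [simp]: "l \<in> \<Lambda> \<Longrightarrow> coset \<Lambda> (z + l) = coset \<Lambda> z"
  by (simp add: coset_eq_iff)

lemma topspace_elliptic_curve [simp]: "topspace (ctop (elliptic_curve \<Lambda>)) = range (coset \<Lambda>)"
proof
  show "topspace (ctop (elliptic_curve \<Lambda>)) \<subseteq> range (coset \<Lambda>)"
    using openin_topspace[of "ctop (elliptic_curve \<Lambda>)"]
    by (simp add: elliptic_curve_def quotient_cspace_def openin_quotient_topology complex_line_def
        del: openin_topspace)
  have "openin (ctop (elliptic_curve \<Lambda>)) (range (coset \<Lambda>))"
    by (simp add: elliptic_curve_def quotient_cspace_def openin_quotient_topology complex_line_def)
  then show "range (coset \<Lambda>) \<subseteq> topspace (ctop (elliptic_curve \<Lambda>))" by (rule openin_subset)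
qed

lemma openin_elliptic_curve:
  "openin (ctop (elliptic_curve \<Lambda>)) U \<longleftrightarrow> U \<subseteq> range (coset \<Lambda>) \<and> open {z. coset \<Lambda> z \<in> U}"
  by (simp add: elliptic_curve_def quotient_cspace_def openin_quotient_topology complex_line_def)

lemma hol_elliptic_curve:
  "f \<in> hol (elliptic_curve \<Lambda>) U \<longleftrightarrow> (f \<circ> coset \<Lambda>) holomorphic_on {z. coset \<Lambda> z \<in> U}"
  by (simp add: elliptic_curve_def quotient_cspace_def complex_line_def pre_def)

lemma preimage_coset_image: "{z. coset \<Lambda> z \<in> coset \<Lambda> ` S} = (\<Union>l\<in>\<Lambda>. (\<lambda>z. z + l) ` S)"
proof safe
  fix z s assume "coset \<Lambda> z = coset \<Lambda> s" "s \<in> S"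
  then show "z \<in> (\<Union>l\<in>\<Lambda>. (\<lambda>z. z + l) ` S)"
    by (intro UN_I[of "z - s"] image_eqI[of _ _ s]) (auto simp: coset_eq_iff)
qed auto

lemma openin_coset_image: "open S \<Longrightarrow> openin (ctop (elliptic_curve \<Lambda>)) (coset \<Lambda> ` S)"
  unfolding openin_elliptic_curve preimage_coset_image
  by (auto intro!: open_UN open_translation_subtract simp: open_translation add.commute[of _ "_ :: complex"])

text \<open>On a ball of radius at most half the minimal lattice distance the projection is
  injective and \<open>s\<close> inverts it. All lattice translates of the ball are covered because
  they make up the preimage of its image.\<close>

lemma local_section:
  obtains e s where "e > 0" "\<And>z l. z \<in> ball w e \<Longrightarrow> l \<in> \<Lambda> \<Longrightarrow> s (coset \<Lambda> (z + l)) = z"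
proof -
  obtain e where e: "e > 0" "\<And>l. l \<in> \<Lambda> \<Longrightarrow> norm l < e \<Longrightarrow> l = 0" using discrete by blast
  define s where "s c = (SOME z. z \<in> ball w (e/2) \<and> coset \<Lambda> z = c)" for c
  show ?thesis
  proof
    show "e / 2 > 0" using e by simp
    fix z l assume z: "z \<in> ball w (e/2)" and l: "l \<in> \<Lambda>"
    have "s (coset \<Lambda> z) \<in> ball w (e/2) \<and> coset \<Lambda> (s (coset \<Lambda> z)) = coset \<Lambda> z"
      unfolding s_def by (rule someI[of _ z]) (use z in simp)
    then have s: "dist w (s (coset \<Lambda> z)) < e/2" "s (coset \<Lambda> z) - z \<in> \<Lambda>"
      by (auto simp: coset_eq_iff)
    have "dist (s (coset \<Lambda> z)) z < e"
      using s(1) z dist_triangle_half_r[of w "s (coset \<Lambda> z)" e z] by (simp add: dist_commute)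
    then have "s (coset \<Lambda> z) - z = 0" using e(2)[OF s(2)] by (simp add: dist_norm)
    then show "s (coset \<Lambda> (z + l)) = z" using l by simp
  qed
qed

section \<open>Lifting holomorphic self-maps of the curve to the plane\<close>

lemma continuous_map_coset: "continuous_map euclidean (ctop (elliptic_curve \<Lambda>)) (coset \<Lambda>)"
  by (auto simp: continuous_map_def openin_elliptic_curve)

lemma continuous_map_from_elliptic_curve:
  fixes h :: "complex set \<Rightarrow> 'a::topological_space"
  assumes "continuous_on UNIV (\<lambda>z. h (coset \<Lambda> z))"
  shows "continuous_map (ctop (elliptic_curve \<Lambda>)) euclidean h"
  unfolding continuous_map_def
proof (intro conjI allI impI)
  fix U :: "'a set" assume "openin euclidean U"
  then have "open ((\<lambda>z. h (coset \<Lambda> z)) -` U)"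
    using assms by (intro open_vimage) auto
  moreover have "{z. coset \<Lambda> z \<in> {c \<in> range (coset \<Lambda>). h c \<in> U}} = (\<lambda>z. h (coset \<Lambda> z)) -` U"
    by auto
  ultimately show "openin (ctop (elliptic_curve \<Lambda>))
      {c \<in> topspace (ctop (elliptic_curve \<Lambda>)). h c \<in> U}"
    by (auto simp: openin_elliptic_curve)
qed auto

text \<open>A coordinate modulo 1 is the same as the circle-valued function \<open>h\<close> on the
  curve. Pulled back along \<open>F\<close> to the contractible plane, \<open>h\<close> has a
  continuous logarithm, whose imaginary part lifts the coordinate of \<open>F\<close>.\<close>

lemma continuous_real_lift:
  fixes x :: "complex \<Rightarrow> real"
  assumes F: "continuous_map (ctop (elliptic_curve \<Lambda>)) (ctop (elliptic_curve \<Lambda>)) F"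
    and x: "bounded_linear x" "\<And>l. l \<in> \<Lambda> \<Longrightarrow> x l \<in> \<int>"
  obtains X where "continuous_on UNIV X"
    "\<And>z w. F (coset \<Lambda> z) = coset \<Lambda> w \<Longrightarrow> X z - x w \<in> \<int>"
proof -
  interpret x: bounded_linear x by fact
  define r where "r = inv_into UNIV (coset \<Lambda>)"
  define h where "h c = cis (2 * pi * x (r c))" for c
  have h: "h (coset \<Lambda> w) = cis (2 * pi * x w)" for w
  proof -
    have "coset \<Lambda> (r (coset \<Lambda> w)) = coset \<Lambda> w" unfolding r_def by (meson f_inv_into_f rangeI)
    then have "x (r (coset \<Lambda> w)) - x w \<in> \<int>" using x(2) by (simp add: coset_eq_iff flip: x.diff)
    then obtain n where "x (r (coset \<Lambda> w)) = x w + of_int n"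
      by (metis Ints_cases add.commute diff_eq_eq)
    then have "h (coset \<Lambda> w) = cis (2 * pi * x w) * cis (2 * pi * of_int n)"
      unfolding cis_mult by (simp add: h_def distrib_left)
    then show ?thesis by (simp add: cis_multiple_2pi)
  qed
  have "continuous_map (ctop (elliptic_curve \<Lambda>)) euclidean h"
  proof (rule continuous_map_from_elliptic_curve)
    show "continuous_on UNIV (\<lambda>z. h (coset \<Lambda> z))"
      unfolding h by (intro continuous_intros x.continuous_on)
  qed
  then have "continuous_map euclidean euclidean (h \<circ> (F \<circ> coset \<Lambda>))"
    by (intro continuous_map_compose[OF continuous_map_compose[OF continuous_map_coset F]])
  then have cont: "continuous_on UNIV (\<lambda>z. h (F (coset \<Lambda> z)))" by (simp add: o_def)
  obtain g where g: "continuous_on UNIV g" "\<And>z. h (F (coset \<Lambda> z)) = exp (g z)"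
    by (rule continuous_logarithm_on_contractible[OF cont contractible_UNIV]) (auto simp: h_def)
  show ?thesis
  proof
    show "continuous_on UNIV (\<lambda>z. Im (g z) / (2 * pi))"
      by (intro continuous_intros g) auto
    fix z w assume "F (coset \<Lambda> z) = coset \<Lambda> w"
    then have eq: "cis (2 * pi * x w) = exp (g z)" using g(2)[of z] h[of w] by simp
    then have "exp (\<i> * of_real (2 * pi * x w)) = exp (g z)" by (simp add: cis_conv_exp)
    then obtain n :: int where "\<i> * of_real (2 * pi * x w) = g z + (of_int (2 * n) * pi) * \<i>"
      unfolding exp_eq by blast
    then have "2 * pi * x w = Im (g z) + 2 * of_int n * pi" by (simp add: complex_eq_iff)
    then have "Im (g z) / (2 * pi) - x w = - of_int n" by (simp add: field_simps)
    then show "Im (g z) / (2 * pi) - x w \<in> \<int>" by simp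
  qed
qed

lemma continuous_lift:
  assumes F: "continuous_map (ctop (elliptic_curve \<Lambda>)) (ctop (elliptic_curve \<Lambda>)) F"
  obtains f where "continuous_on UNIV f" "\<And>z. F (coset \<Lambda> z) = coset \<Lambda> (f z)"
proof -
  obtain a b x y where bl: "bounded_linear x" "bounded_linear y"
    and dec: "\<And>z. z = of_real (x z) * a + of_real (y z) * b"
    and xy: "\<And>s t. x (of_real s * a + of_real t * b) = s"
      "\<And>s t. y (of_real s * a + of_real t * b) = t"
    and c: "\<Lambda> = {z. x z \<in> \<int> \<and> y z \<in> \<int>}"
    by (rule coordinates, rule that)
  interpret x: bounded_linear x by (rule bl)
  interpret y: bounded_linear y by (rule bl)
  obtain X where X: "continuous_on UNIV X"
    "\<And>z w. F (coset \<Lambda> z) = coset \<Lambda> w \<Longrightarrow> X z - x w \<in> \<int>"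
    by (rule continuous_real_lift[OF F bl(1)]) (use c in auto)
  obtain Y where Y: "continuous_on UNIV Y"
    "\<And>z w. F (coset \<Lambda> z) = coset \<Lambda> w \<Longrightarrow> Y z - y w \<in> \<int>"
    by (rule continuous_real_lift[OF F bl(2)]) (use c in auto)
  show ?thesis
  proof
    show "continuous_on UNIV (\<lambda>z. of_real (X z) * a + of_real (Y z) * b)"
      by (intro continuous_intros X Y)
    fix z
    have "F (coset \<Lambda> z) \<in> range (coset \<Lambda>)"
      using continuous_map_image_subset_topspace[OF F] by auto
    then obtain w where w: "F (coset \<Lambda> z) = coset \<Lambda> w" by auto
    have "w - (of_real (X z) * a + of_real (Y z) * b) \<in> \<Lambda>"
      unfolding c mem_Collect_eq x.diff y.diff xy
      using X(2)[OF w] Y(2)[OF w] by (metis Ints_minus minus_diff_eq)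
    then show "F (coset \<Lambda> z) = coset \<Lambda> (of_real (X z) * a + of_real (Y z) * b)"
      using w by (simp add: coset_eq_iff)
  qed
qed

text \<open>A local section \<open>s\<close> of the projection is a holomorphic function on an open
  set of the curve. The map \<open>F\<close> pulls it back to a holomorphic function, and near any
  point this pullback is the lift \<open>f\<close>.\<close>

lemma holomorphic_map_lift:
  assumes F: "holomorphic_map (elliptic_curve \<Lambda>) (elliptic_curve \<Lambda>) F"
    and f: "continuous_on UNIV f" "\<And>z. F (coset \<Lambda> z) = coset \<Lambda> (f z)"
  shows "f holomorphic_on UNIV"
proof -
  have "f field_differentiable (at z0)" for z0
  proof -
    obtain e s where e: "e > 0" and s: "\<And>z l. z \<in> ball (f z0) e \<Longrightarrow> l \<in> \<Lambda> \<Longrightarrow> s (coset \<Lambda> (z + l)) = z"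
      using local_section by blast
    let ?B = "ball (f z0) e"
    have "(s \<circ> coset \<Lambda>) field_differentiable (at z)" if z: "z \<in> {z. coset \<Lambda> z \<in> coset \<Lambda> ` ?B}" for z
    proof -
      obtain l where l: "l \<in> \<Lambda>" "z \<in> (\<lambda>z. z + l) ` ?B"
        using z unfolding preimage_coset_image by blast
      have "((\<lambda>u. u - l) has_field_derivative 1) (at z)"
        by (auto intro!: derivative_eq_intros)
      then have "((s \<circ> coset \<Lambda>) has_field_derivative 1) (at z)"
      proof (rule has_field_derivative_transform_within_open)
        show "open ((\<lambda>z. z + l) ` ?B)" by (simp add: open_translation_subtract open_translation add.commute[of _ l])
        show "z \<in> (\<lambda>z. z + l) ` ?B" by fact
      qed (use s l in auto)
      then show ?thesis by (auto simp: field_differentiable_def)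
    qed
    then have "s \<in> hol (elliptic_curve \<Lambda>) (coset \<Lambda> ` ?B)"
      by (auto simp: hol_elliptic_curve holomorphic_on_def intro: field_differentiable_at_within)
    then have "s \<circ> F \<in> hol (elliptic_curve \<Lambda>) (pre (elliptic_curve \<Lambda>) F (coset \<Lambda> ` ?B))"
      using F openin_coset_image[OF open_ball] unfolding holomorphic_map_def by blast
    then have hol: "(\<lambda>z. s (F (coset \<Lambda> z))) holomorphic_on {z. F (coset \<Lambda> z) \<in> coset \<Lambda> ` ?B}"
      by (simp add: hol_elliptic_curve pre_def o_def)
    have "(\<lambda>z. s (F (coset \<Lambda> z))) holomorphic_on f -` ?B"
      by (rule holomorphic_on_subset[OF hol]) (use f in auto)
    moreover have "s (F (coset \<Lambda> z)) = f z" if "z \<in> f -` ?B" for z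
      using s[of "f z" 0] that f(2) by simp
    ultimately have "f holomorphic_on f -` ?B"
      using holomorphic_cong by (metis (no_types, lifting))
    moreover have "open (f -` ?B)" using f(1) by (intro open_vimage) auto
    ultimately show ?thesis using e
      by (simp add: holomorphic_on_imp_differentiable_at)
  qed
  then show ?thesis by (simp add: holomorphic_on_def)
qed

text \<open>For a period \<open>l\<close> the difference \<open>f (z + l) - f z\<close> is
  continuous with values in the lattice, hence constant. So the derivative of the lift is doubly
  periodic, therefore bounded, and constant by Liouville.\<close>

lemma affine_lift:
  assumes F: "holomorphic_map (elliptic_curve \<Lambda>) (elliptic_curve \<Lambda>) F"
  obtains \<alpha> \<beta> where "\<And>z. F (coset \<Lambda> z) = coset \<Lambda> (\<alpha> * z + \<beta>)"
proof -
  obtain f where f: "continuous_on UNIV f" "\<And>z. F (coset \<Lambda> z) = coset \<Lambda> (f z)"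
    using continuous_lift F unfolding holomorphic_map_def by blast
  have hol: "f holomorphic_on UNIV" by (rule holomorphic_map_lift[OF F f])
  have shift: "f (z + l) = f z + (f l - f 0)" if l: "l \<in> \<Lambda>" for z l
  proof -
    have "f (z + l) - f z = f (0 + l) - f 0"
    proof (rule continuous_into_lattice_constant[where f = "\<lambda>z. f (z + l) - f z"])
      show "continuous_on UNIV (\<lambda>z. f (z + l) - f z)"
        by (intro continuous_intros f continuous_on_compose2[OF f(1)]) auto
      fix z
      have "coset \<Lambda> (f (z + l)) = coset \<Lambda> (f z)"
        using l f(2)[of z] f(2)[of "z + l"] by simp
      then show "f (z + l) - f z \<in> \<Lambda>" by (simp add: coset_eq_iff)
    qed
    then show ?thesis by (simp add: algebra_simps)
  qed
  have der: "(f has_field_derivative deriv f z) (at z)" for z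
    using hol by (meson holomorphic_derivI iso_tuple_UNIV_I open_UNIV)
  have per: "deriv f (z + l) = deriv f z" if l: "l \<in> \<Lambda>" for z l
  proof -
    have "((\<lambda>z. f (z + l)) has_field_derivative deriv f (z + l)) (at z)"
      using der[of "z + l"] by (simp only: DERIV_shift)
    moreover have "((\<lambda>z. f (z + l)) has_field_derivative deriv f z) (at z)"
      unfolding shift[OF l] by (auto intro!: derivative_eq_intros der)
    ultimately show ?thesis by (rule DERIV_unique)
  qed
  have hold: "deriv f holomorphic_on UNIV" by (simp add: hol holomorphic_deriv)
  obtain M where M: "\<And>z. \<exists>l\<in>\<Lambda>. norm (z - l) \<le> M" using bounded_representatives by blast
  have "compact (deriv f ` cball 0 M)"
    by (intro compact_continuous_image holomorphic_on_imp_continuous_on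
        holomorphic_on_subset[OF hold]) auto
  moreover have "range (deriv f) \<subseteq> deriv f ` cball 0 M"
  proof safe
    fix z
    obtain l where l: "l \<in> \<Lambda>" "norm (z - l) \<le> M" using M by blast
    have "deriv f z = deriv f (z - l)" using per[OF l(1), of "z - l"] by simp
    then show "deriv f z \<in> deriv f ` cball 0 M" using l by auto
  qed
  ultimately have "bounded (range (deriv f))"
    using bounded_subset compact_imp_bounded by blast
  then obtain \<alpha> where \<alpha>: "\<And>z. deriv f z = \<alpha>"
    using Liouville_theorem[OF hold] by (auto simp: constant_on_def)
  have "\<exists>c. \<forall>z\<in>UNIV. f z - \<alpha> * z = c"
    using der by (intro has_field_derivative_zero_constant) (auto intro!: derivative_eq_intros simp: \<alpha>)
  then obtain c where "\<And>z. f z = \<alpha> * z + c" by (auto simp: algebra_simps)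
  then show ?thesis using that f(2) by simp
qed

text \<open>The difference of the two affine maps is continuous and lattice-valued, hence constant.
  This is why the linear parts of a group action multiply exactly, but the translation parts only
  modulo the lattice.\<close>

lemma affine_lift_unique:
  assumes "\<And>z. coset \<Lambda> (\<alpha> * z + \<beta>) = coset \<Lambda> (\<alpha>' * z + \<beta>')"
  shows "\<alpha> = \<alpha>'" "\<beta> - \<beta>' \<in> \<Lambda>"
proof -
  have mem: "(\<alpha> - \<alpha>') * z + (\<beta> - \<beta>') \<in> \<Lambda>" for z
    using assms[of z] by (simp add: coset_eq_iff algebra_simps)
  show "\<beta> - \<beta>' \<in> \<Lambda>" using mem[of 0] by simp
  have "(\<alpha> - \<alpha>') * 1 + (\<beta> - \<beta>') = (\<alpha> - \<alpha>') * 0 + (\<beta> - \<beta>')"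
    by (rule continuous_into_lattice_constant[where f = "\<lambda>z. (\<alpha> - \<alpha>') * z + (\<beta> - \<beta>')"])
      (intro continuous_intros, rule mem)
  then show "\<alpha> = \<alpha>'" by simp
qed

end

section \<open>Finite groups\<close>

text \<open>Left translation by an element over \<open>y\<close> carries the kernel of
  \<open>f\<close> on \<open>H\<close> onto the fiber over \<open>y\<close>, so all fibers have the
  same size.\<close>

lemma (in group) card_eq_card_image_mult_card_kernel:
  fixes f :: "'a \<Rightarrow> complex"
  assumes H: "subgroup H G" "finite H"
    and f: "\<And>g h. g \<in> H \<Longrightarrow> h \<in> H \<Longrightarrow> f (g \<otimes> h) = f g * f h" "f \<one> = 1"
  shows "card H = card (f ` H) * card {h \<in> H. f h = 1}"
proof -
  interpret H: subgroup H G by fact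
  have fiber: "card {h \<in> H. f h = y} = card {h \<in> H. f h = 1}" if "y \<in> f ` H" for y
  proof -
    from that obtain h0 where h0: "h0 \<in> H" "f h0 = y" by auto
    have inv: "f (inv h0) * y = 1"
      using f(1)[of "inv h0" h0] f(2) h0 H.mem_carrier by auto
    have "bij_betw (\<lambda>h. h0 \<otimes> h) {h \<in> H. f h = 1} {h \<in> H. f h = y}"
    proof (rule bij_betwI[where g = "\<lambda>h. inv h0 \<otimes> h"])
      show "(\<lambda>h. h0 \<otimes> h) \<in> {h \<in> H. f h = 1} \<rightarrow> {h \<in> H. f h = y}" using f h0 by auto
      show "(\<lambda>h. inv h0 \<otimes> h) \<in> {h \<in> H. f h = y} \<rightarrow> {h \<in> H. f h = 1}" using f(1) inv h0 by auto
    qed (use h0 H.mem_carrier in \<open>auto simp: m_assoc[symmetric]\<close>)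
    then show ?thesis using bij_betw_same_card by force
  qed
  have "card H = (\<Sum>y\<in>f ` H. card {h \<in> H. f h = y})"
    using sum.image_gen[OF H(2), of "\<lambda>_. 1::nat" f] by simp
  also have "\<dots> = (\<Sum>y\<in>f ` H. card {h \<in> H. f h = 1})" by (rule sum.cong) (auto simp: fiber)
  finally show ?thesis by simp
qed

lemma carrier_semidirect_product [simp]:
  "carrier (semidirect_product N H \<phi>) = carrier N \<times> carrier H"
  by (simp add: semidirect_product_def)

text \<open>Lets the two direct products among the exceptional groups be recognized by the same
  criterion as the two semidirect ones.\<close>

lemma semidirect_product_trivial: "semidirect_product N H (\<lambda>k. id ^^ nat k) = N \<times>\<times> H"
  by (simp add: semidirect_product_def DirProd_def)

lemma (in group) nat_pow_mod:
  assumes "g \<in> carrier G" "g [^] (n::nat) = \<one>"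
  shows "g [^] (k mod n) = g [^] k"
proof -
  have "g [^] k = g [^] (n * (k div n) + k mod n)" by simp
  also have "\<dots> = g [^] (k mod n)"
    unfolding nat_pow_mult[OF assms(1), symmetric] nat_pow_pow[OF assms(1), symmetric] assms(2)
    using assms(1) by simp
  finally show ?thesis by simp
qed

text \<open>The relation \<open>g \<otimes> A x = A (s x) \<otimes> g\<close> makes
  \<open>(x, k) \<mapsto> A x \<otimes> g^k\<close> multiplicative. The character \<open>f\<close>
  is trivial on the image of \<open>A\<close> and separates the powers of \<open>g\<close>, which
  gives injectivity; counting gives surjectivity.\<close>

lemma (in group) iso_semidirect_product:
  fixes f :: "'a \<Rightarrow> complex" and N :: "('n, 'e) monoid_scheme"
  assumes N: "group N" "finite (carrier N)" and n: "n > 0"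
    and A: "A \<in> hom N G" "inj_on A (carrier N)"
    and s: "\<And>x. x \<in> carrier N \<Longrightarrow> s x \<in> carrier N"
    and g: "g \<in> carrier G" "g [^] n = \<one>" "\<And>x. x \<in> carrier N \<Longrightarrow> g \<otimes> A x = A (s x) \<otimes> g"
    and f: "\<And>x y. x \<in> carrier G \<Longrightarrow> y \<in> carrier G \<Longrightarrow> f (x \<otimes> y) = f x * f y" "f \<one> = 1"
      "\<And>x. x \<in> carrier N \<Longrightarrow> f (A x) = 1" "inj_on (\<lambda>k. f g ^ k) {0..<n}"
    and card: "finite (carrier G)" "card (carrier G) = card (carrier N) * n"
  shows "G \<cong> semidirect_product N (integer_mod_group n) (\<lambda>k. s ^^ nat k)"
proof -
  interpret N: group N by fact
  interpret Zn: group "integer_mod_group n" by simp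
  let ?S = "semidirect_product N (integer_mod_group n) (\<lambda>k. s ^^ nat k)"
  have cS: "carrier (integer_mod_group n) = {0..<int n}"
    using n by (simp add: carrier_integer_mod_group)
  have Ac: "A x \<in> carrier G" if "x \<in> carrier N" for x using A(1) that by (auto simp: hom_def)
  have sk: "(s ^^ k) x \<in> carrier N" if "x \<in> carrier N" for k x using that s by (induction k) auto
  have conj: "g [^] k \<otimes> A x = A ((s ^^ k) x) \<otimes> g [^] k" if x: "x \<in> carrier N" for k x
  proof (induction k)
    case 0 then show ?case using Ac x by simp
  next
    case (Suc k)
    have "g [^] Suc k \<otimes> A x = g \<otimes> (g [^] k \<otimes> A x)"
      using nat_pow_Suc2[OF g(1)] g(1) Ac[OF x] by (simp add: m_assoc)
    also have "\<dots> = (g \<otimes> A ((s ^^ k) x)) \<otimes> g [^] k"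
      unfolding Suc.IH using g(1) Ac[OF sk[OF x]] by (simp add: m_assoc)
    also have "\<dots> = A ((s ^^ Suc k) x) \<otimes> (g \<otimes> g [^] k)"
      using g Ac sk x s by (simp add: m_assoc)
    finally show ?case using nat_pow_Suc2[OF g(1)] by simp
  qed
  define h where "h = (\<lambda>(x, k). A x \<otimes> g [^] nat k)"
  have hc: "h u \<in> carrier G" if "u \<in> carrier ?S" for u
    using that Ac g(1) by (auto simp: h_def)
  have hom: "h (u \<otimes>\<^bsub>?S\<^esub> v) = h u \<otimes> h v" if uv: "u \<in> carrier ?S" "v \<in> carrier ?S" for u v
  proof -
    obtain x k x' k' where u: "u = (x, k)" "v = (x', k')" by (metis surj_pair)
    have x: "x \<in> carrier N" "x' \<in> carrier N" "0 \<le> k" "0 \<le> k'" using uv u cS by auto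
    have "nat ((k + k') mod int n) = (nat k + nat k') mod n"
      using x by (simp add: nat_mod_distrib nat_add_distrib)
    then have gk: "g [^] nat ((k + k') mod int n) = g [^] nat k \<otimes> g [^] nat k'"
      using g by (simp add: nat_pow_mod nat_pow_mult)
    have "h (u \<otimes>\<^bsub>?S\<^esub> v) = A (x \<otimes>\<^bsub>N\<^esub> (s ^^ nat k) x') \<otimes> (g [^] nat k \<otimes> g [^] nat k')"
      by (simp add: h_def u semidirect_product_def gk)
    also have "A (x \<otimes>\<^bsub>N\<^esub> (s ^^ nat k) x') = A x \<otimes> A ((s ^^ nat k) x')"
      using A(1) x sk by (simp add: hom_def)
    also have "A x \<otimes> A ((s ^^ nat k) x') \<otimes> (g [^] nat k \<otimes> g [^] nat k')
        = A x \<otimes> (A ((s ^^ nat k) x') \<otimes> g [^] nat k) \<otimes> g [^] nat k'"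
      using Ac x sk g(1) by (simp add: m_assoc)
    also have "\<dots> = h u \<otimes> h v"
      unfolding conj[OF x(2), symmetric] using Ac x sk g(1)
      by (simp add: h_def u m_assoc del: pow_nat)
    finally show ?thesis .
  qed
  have fpow: "f (g [^] k) = f g ^ k" for k :: nat
    by (induction k) (use f g(1) in auto)
  have fh: "f (h (x, k)) = f g ^ nat k" if "x \<in> carrier N" for x k
    using that f Ac g(1) by (simp add: h_def fpow)
  have inj: "inj_on h (carrier ?S)"
  proof (rule inj_onI)
    fix u v assume uv: "u \<in> carrier ?S" "v \<in> carrier ?S" "h u = h v"
    obtain x k x' k' where u: "u = (x, k)" "v = (x', k')" by (metis surj_pair)
    have x: "x \<in> carrier N" "x' \<in> carrier N" "0 \<le> k" "0 \<le> k'" "k < int n" "k' < int n" using uv u cS by auto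
    have "f g ^ nat k = f g ^ nat k'" using fh x uv u by metis
    then have "nat k = nat k'"
      using x by (intro inj_onD[OF f(4)]) auto
    then have k: "k = k'" using x by simp
    then have "A x = A x'" using uv(3) u Ac x g(1) by (simp add: h_def)
    then show "u = v" using u k inj_onD[OF A(2)] x by simp
  qed
  have "card (carrier ?S) = card (carrier G)" by (simp add: cS card_cartesian_product card)
  then have "h ` carrier ?S = carrier G"
    using card(1) inj hc by (intro card_subset_eq) (auto simp: card_image)
  then have bij: "bij_betw h (carrier ?S) (carrier G)" using inj by (simp add: bij_betw_def)
  \<comment> \<open>The isomorphism is wanted from \<open>G\<close>; as \<open>?S\<close> has not
    been shown to be a group, the inverse map is checked directly to be a homomorphism.\<close>
  let ?h = "inv_into (carrier ?S) h"
  have "?h \<in> hom G ?S"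
  proof (rule homI)
    fix x y assume xy: "x \<in> carrier G" "y \<in> carrier G"
    have c: "?h x \<in> carrier ?S" "?h y \<in> carrier ?S" using bij xy by (meson bij_betwE bij_betw_inv_into)+
    have closed: "?h x \<otimes>\<^bsub>?S\<^esub> ?h y \<in> carrier ?S"
    proof -
      obtain v k v' k' where u: "?h x = (v, k)" "?h y = (v', k')" by (metis surj_pair)
      have "(v, k) \<in> carrier ?S" "(v', k') \<in> carrier ?S" using c u by auto
      then show ?thesis unfolding u by (auto simp: semidirect_product_def sk
          simp del: mult_integer_mod_group intro!: Zn.m_closed)
    qed
    have "h (?h x \<otimes>\<^bsub>?S\<^esub> ?h y) = x \<otimes> y"
      using hom[OF c] bij xy by (simp add: bij_betw_inv_into_right)
    then show "?h (x \<otimes> y) = ?h x \<otimes>\<^bsub>?S\<^esub> ?h y" using inv_into_f_f[OF inj closed] by simp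
  next
    fix x assume "x \<in> carrier G"
    then show "?h x \<in> carrier ?S" using bij by (meson bij_betwE bij_betw_inv_into)
  qed
  then have "?h \<in> iso G ?S" using bij by (simp add: iso_def bij_betw_inv_into)
  then show ?thesis unfolding is_iso_def by blast
qed

lemma (in group) hom_integer_mod_group:
  assumes "e \<in> carrier G" "e [^] m = \<one>" "m > 0"
  shows "(\<lambda>a. e [^] nat a) \<in> hom (integer_mod_group m) G"
proof (rule homI)
  fix x y assume "x \<in> carrier (integer_mod_group m)" "y \<in> carrier (integer_mod_group m)"
  then have "0 \<le> x" "0 \<le> y" using assms(3) by (auto simp: carrier_integer_mod_group)
  then have "nat ((x + y) mod int m) = (nat x + nat y) mod m"
    by (simp add: nat_mod_distrib nat_add_distrib)
  then show "e [^] nat (x \<otimes>\<^bsub>integer_mod_group m\<^esub> y) = e [^] nat x \<otimes> e [^] nat y"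
    using assms by (simp add: nat_pow_mod nat_pow_mult)
qed (use assms in auto)

lemma (in group) hom_integer_mod_group_pair:
  assumes e: "e \<in> carrier G" "e [^] m = \<one>" and f: "f \<in> carrier G" "f [^] m = \<one>"
    and m: "m > 0" and comm: "e \<otimes> f = f \<otimes> e"
  shows "(\<lambda>(a, b). e [^] nat a \<otimes> f [^] nat b) \<in> hom (integer_mod_group m \<times>\<times> integer_mod_group m) G"
proof (rule homI)
  let ?Z = "integer_mod_group m"
  have swap: "e [^] (i::nat) \<otimes> f [^] (j::nat) = f [^] j \<otimes> e [^] i" for i j
  proof -
    have "f [^] j \<otimes> e = e \<otimes> f [^] j"
      by (rule group_commutes_pow) (use e f comm in auto)
    then show ?thesis by (intro group_commutes_pow) (use e f in auto)
  qed
  have rearrange: "(p \<otimes> u) \<otimes> (v \<otimes> q) = (p \<otimes> v) \<otimes> (u \<otimes> q)"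
    if "u \<otimes> v = v \<otimes> u" "p \<in> carrier G" "q \<in> carrier G" "u \<in> carrier G" "v \<in> carrier G" for p q u v
  proof -
    have "(p \<otimes> u) \<otimes> (v \<otimes> q) = p \<otimes> (u \<otimes> v) \<otimes> q" using that(2-5) by (simp add: m_assoc)
    then show ?thesis using that by (simp add: m_assoc)
  qed
  fix x y assume xy: "x \<in> carrier (?Z \<times>\<times> ?Z)" "y \<in> carrier (?Z \<times>\<times> ?Z)"
  obtain a b a' b' where x: "x = (a, b)" "y = (a', b')" by (metis surj_pair)
  have "e [^] nat (a \<otimes>\<^bsub>?Z\<^esub> a') = e [^] nat a \<otimes> e [^] nat a'"
    "f [^] nat (b \<otimes>\<^bsub>?Z\<^esub> b') = f [^] nat b \<otimes> f [^] nat b'"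
    using hom_mult[OF hom_integer_mod_group[OF e m]] hom_mult[OF hom_integer_mod_group[OF f m]] xy x by auto
  then show "(case x \<otimes>\<^bsub>?Z \<times>\<times> ?Z\<^esub> y of (a, b) \<Rightarrow> e [^] nat a \<otimes> f [^] nat b) =
      (case x of (a, b) \<Rightarrow> e [^] nat a \<otimes> f [^] nat b) \<otimes> (case y of (a, b) \<Rightarrow> e [^] nat a \<otimes> f [^] nat b)"
    using rearrange[OF swap[of "nat a'" "nat b"], of "e [^] nat a" "f [^] nat b'"] e f
    unfolding x by (simp del: mult_integer_mod_group)
qed (use e f in auto)

section \<open>Groups acting on an elliptic curve by affine maps\<close>

context curve_lattice
begin

text \<open>The points \<open>c ^ n * l\<close> stay in the lattice and tend to 0, so by
  discreteness one of them is 0.\<close>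

lemma small_multiplier_eq_zero:
  assumes c: "\<And>l. l \<in> \<Lambda> \<Longrightarrow> c * l \<in> \<Lambda>" and small: "norm c < 1"
  shows "c = 0"
proof (rule ccontr)
  assume "c \<noteq> 0"
  obtain l where l: "l \<in> \<Lambda>" "l \<noteq> 0" by (rule nonzero_member)
  obtain e where e: "e > 0" "\<And>l. l \<in> \<Lambda> \<Longrightarrow> norm l < e \<Longrightarrow> l = 0"
    using discrete by blast
  have mem: "c ^ n * l \<in> \<Lambda>" for n
    by (induction n) (use l(1) c in \<open>auto simp: mult.assoc\<close>)
  have "(\<lambda>n. norm c ^ n * norm l) \<longlonglongrightarrow> 0 * norm l"
    using small by (intro tendsto_intros LIMSEQ_power_zero) auto
  then have "\<forall>\<^sub>F n in sequentially. norm c ^ n * norm l < e"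
    using e(1) by (intro order_tendstoD(2)) auto
  then obtain n where "norm c ^ n * norm l < e" by (auto simp: eventually_sequentially)
  then have "c ^ n * l = 0" using e(2)[OF mem[of n]] by (simp add: norm_mult norm_power)
  then show False using \<open>c \<noteq> 0\<close> l(2) by simp
qed

text \<open>The crystallographic restriction: \<open>c\<close> is an eigenvalue of an integer matrix
  of determinant 1 whose trace \<open>2 * Re c\<close> has modulus below 2 unless \<open>c\<close>
  is real, which leaves the traces -1, 0 and 1.\<close>

lemma unit_multiplier:
  assumes c: "\<And>l. l \<in> \<Lambda> \<Longrightarrow> c * l \<in> \<Lambda>" and norm: "norm c = 1"
  shows "c ^ 4 = 1 \<or> c ^ 6 = 1"
proof (cases "Im c = 0")
  case True
  then have "c = 1 \<or> c = -1" using norm by (auto simp: complex_eq_iff cmod_def)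
  then show ?thesis by auto
next
  case False
  obtain a b where L: "\<Lambda> = {of_int m * a + of_int n * b | m n. True}" and ab: "a \<noteq> b" "independent {a, b}"
    using lattice unfolding complex_lattice_def by blast
  have "a = of_int 1 * a + of_int 0 * b" "b = of_int 0 * a + of_int 1 * b" by simp_all
  then have abL: "a \<in> \<Lambda>" "b \<in> \<Lambda>" unfolding L by blast+
  from c[OF abL(1)] obtain m n where 1: "c * a = of_int m * a + of_int n * b" unfolding L by blast
  from c[OF abL(2)] obtain p q where 2: "c * b = of_int p * a + of_int q * b" unfolding L by blast
  have a0: "a \<noteq> 0" "b \<noteq> 0" using ab(2) dependent_zero by blast+
  \<comment> \<open>The characteristic equation of multiplication by \<open>c\<close> in the basis
    \<open>a\<close>, \<open>b\<close>.\<close>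
  have "(c - of_int m) * (c - of_int q) * (a * b) = (c * a - of_int m * a) * (c * b - of_int q * b)"
    by (simp add: algebra_simps)
  also have "\<dots> = of_int n * of_int p * (a * b)" unfolding 1 2 by (simp add: algebra_simps)
  finally have "(c - of_int m) * (c - of_int q) = of_int n * of_int p" using a0 by simp
  then have quad: "c\<^sup>2 = of_int (m + q) * c - of_int (m * q - n * p)"
    by (simp add: algebra_simps power2_eq_square)
  define t where "t = m + q"
  define d where "d = m * q - n * p"
  have "Re (c\<^sup>2) = t * Re c - d" "Im (c\<^sup>2) = t * Im c"
    unfolding quad t_def[symmetric] d_def[symmetric] by simp_all
  \<comment> \<open>Because \<open>Im c \<noteq> 0\<close>, the imaginary part identifies the trace
    with \<open>2 * Re c\<close>; the real part then identifies the determinant with the squared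
    modulus of \<open>c\<close>.\<close>
  then have re: "(Re c)\<^sup>2 - (Im c)\<^sup>2 = t * Re c - d" and im: "2 * Re c = t"
    using False by (auto simp: power2_eq_square)
  have n1: "(Re c)\<^sup>2 + (Im c)\<^sup>2 = 1" using norm by (simp add: cmod_def)
  have "of_int d = (1::real)"
    using re n1 im[symmetric] by (simp add: power2_eq_square algebra_simps)
  then have d1: "d = 1" by linarith
  have c2: "c\<^sup>2 = of_int t * c - 1" using quad unfolding t_def[symmetric] d_def[symmetric] d1 by simp
  have "\<bar>Re c\<bar> < 1"
  proof -
    have "(Im c)\<^sup>2 > 0" using False by simp
    then have "(Re c)\<^sup>2 < 1\<^sup>2" using n1 unfolding one_power2 by linarith
    then show ?thesis using abs_square_less_1 by fastforce
  qed
  then have "\<bar>t\<bar> < 2" using im by linarith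
  then consider "t = 0" | "t = 1" | "t = -1" by linarith
  then show ?thesis
  proof cases
    case 1
    have "c ^ 4 = (c\<^sup>2)\<^sup>2" by (simp flip: power_mult)
    then show ?thesis using c2 1 by simp
  next
    case 2
    have c3: "c ^ 3 = -1"
    proof -
      have e: "c\<^sup>2 = c - 1" using c2 2 by simp
      have "c ^ 3 = c * c\<^sup>2" by (simp add: power2_eq_square power3_eq_cube)
      also have "\<dots> = c * (c - 1)" by (simp only: e)
      also have "\<dots> = c\<^sup>2 - c" by (simp add: power2_eq_square algebra_simps)
      finally show ?thesis unfolding e by simp
    qed
    have "c ^ 6 = (c ^ 3)\<^sup>2" by (simp flip: power_mult)
    then show ?thesis using c3 by simp
  next
    case 3
    have c3: "c ^ 3 = 1"
    proof -
      have e: "c\<^sup>2 = - c - 1" using c2 3 by simp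
      have "c ^ 3 = c * c\<^sup>2" by (simp add: power2_eq_square power3_eq_cube)
      also have "\<dots> = c * (- c - 1)" by (simp only: e)
      also have "\<dots> = - c\<^sup>2 - c" by (simp add: power2_eq_square algebra_simps)
      finally show ?thesis unfolding e by simp
    qed
    have "c ^ 6 = (c ^ 3)\<^sup>2" by (simp flip: power_mult)
    then show ?thesis using c3 by simp
  qed
qed

end

text \<open>The group element \<open>g\<close> acts on \<open>\<complex>/\<Lambda>\<close> by \<open>z \<mapsto> \<rho> g * z + \<beta> g\<close>, with \<open>\<beta> g\<close> well defined modulo \<open>\<Lambda>\<close>.\<close>

locale affine_group = group G + curve_lattice \<Lambda>
  for G :: "('g, 'c) monoid_scheme" (structure) and \<Lambda> +
  fixes \<rho> \<beta> :: "'g \<Rightarrow> complex"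
  assumes finite_carrier: "finite (carrier G)"
    and chi_mult: "\<And>g h. g \<in> carrier G \<Longrightarrow> h \<in> carrier G \<Longrightarrow> \<rho> (g \<otimes> h) = \<rho> g * \<rho> h"
    and chi_one: "\<rho> \<one> = 1"
    and chi_lattice: "\<And>g l. g \<in> carrier G \<Longrightarrow> l \<in> \<Lambda> \<Longrightarrow> \<rho> g * l \<in> \<Lambda>"
    and beta_mult: "\<And>g h. g \<in> carrier G \<Longrightarrow> h \<in> carrier G \<Longrightarrow>
      \<beta> (g \<otimes> h) - (\<rho> g * \<beta> h + \<beta> g) \<in> \<Lambda>"
    and faithful: "\<And>g. g \<in> carrier G \<Longrightarrow> \<rho> g = 1 \<Longrightarrow> \<beta> g \<in> \<Lambda> \<Longrightarrow> g = \<one>"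
begin

abbreviation translation_set :: "'g set" where
  "translation_set \<equiv> {g \<in> carrier G. \<rho> g = 1}"

lemma chi_pow: "g \<in> carrier G \<Longrightarrow> \<rho> (g [^] (n::nat)) = \<rho> g ^ n"
  by (induction n) (auto simp: chi_one chi_mult)

lemma chi_inv: "g \<in> carrier G \<Longrightarrow> \<rho> (inv g) = inverse (\<rho> g)"
  using chi_mult[of g "inv g"] by (simp add: chi_one inverse_unique)

lemma chi_nonzero: "g \<in> carrier G \<Longrightarrow> \<rho> g \<noteq> 0"
  using chi_mult[of g "inv g"] chi_one by auto

lemma chi_finite_order: "g \<in> carrier G \<Longrightarrow> \<rho> g ^ order G = 1"
  by (metis chi_one chi_pow pow_order_eq_1)

lemma order_pos: "order G > 0"
  using finite_carrier order_gt_0_iff_finite by blast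

lemma norm_chi: "g \<in> carrier G \<Longrightarrow> norm (\<rho> g) = 1"
  using power_eq_1_iff[OF chi_finite_order[of g]] order_pos by auto

lemma chi_conj: "g \<in> carrier G \<Longrightarrow> h \<in> carrier G \<Longrightarrow> \<rho> (g \<otimes> h \<otimes> inv g) = \<rho> h"
  by (simp add: chi_mult chi_inv chi_nonzero)

lemma beta_one: "\<beta> \<one> \<in> \<Lambda>"
  using beta_mult[of \<one> \<one>] minus_mem_iff[of "\<beta> \<one>"] by (simp add: chi_one)

lemma affine_eqI:
  assumes gh: "g \<in> carrier G" "h \<in> carrier G" and eq: "\<rho> g = \<rho> h" "\<beta> g - \<beta> h \<in> \<Lambda>"
  shows "g = h"
proof -
  have k: "g \<otimes> inv h \<in> carrier G" "\<rho> (g \<otimes> inv h) = 1" "(g \<otimes> inv h) \<otimes> h = g"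
    using gh eq chi_nonzero[of h] by (auto simp: chi_mult chi_inv m_assoc)
  have "\<beta> g - (\<beta> h + \<beta> (g \<otimes> inv h)) \<in> \<Lambda>"
    using beta_mult[OF k(1) gh(2)] unfolding k by simp
  from diff_mem[OF eq(2) this] have "\<beta> (g \<otimes> inv h) \<in> \<Lambda>" by (simp add: algebra_simps)
  then have "g \<otimes> inv h = \<one>" using faithful k by blast
  then show ?thesis using gh by (metis k(3) l_one)
qed

lemma beta_translation_mult:
  assumes "g \<in> translation_set" "h \<in> carrier G"
  shows "\<beta> (g \<otimes> h) - (\<beta> g + \<beta> h) \<in> \<Lambda>"
  using beta_mult[of g h] assms by (simp add: add.commute)

lemma translation_set_commute:
  assumes "g \<in> translation_set" "h \<in> translation_set"
  shows "g \<otimes> h = h \<otimes> g"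
proof (rule affine_eqI)
  have "\<beta> (g \<otimes> h) - (\<beta> g + \<beta> h) \<in> \<Lambda>" "\<beta> (h \<otimes> g) - (\<beta> h + \<beta> g) \<in> \<Lambda>"
    using assms by (intro beta_translation_mult; simp)+
  from diff_mem[OF this] show "\<beta> (g \<otimes> h) - \<beta> (h \<otimes> g) \<in> \<Lambda>" by (simp add: algebra_simps)
qed (use assms in \<open>auto simp: chi_mult\<close>)

lemma subgroup_translation_set: "subgroup translation_set G"
  by (rule subgroupI) (auto simp: chi_mult chi_inv chi_one intro: exI[of _ \<one>])

lemma beta_translation_pow:
  assumes "g \<in> translation_set"
  shows "\<beta> (g [^] (n::nat)) - of_nat n * \<beta> g \<in> \<Lambda>"
proof (induction n)
  case 0 then show ?case using beta_one by simp
next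
  case (Suc n)
  have "\<beta> (g [^] n \<otimes> g) - (\<beta> (g [^] n) + \<beta> g) \<in> \<Lambda>"
    using assms by (intro beta_translation_mult) (auto simp: chi_pow)
  from add_mem[OF this Suc] show ?case by (simp add: algebra_simps)
qed

text \<open>Conjugating by the translation to the fixed point \<open>\<beta> g / (1 - \<rho> g)\<close> linearizes \<open>g\<close>.\<close>

lemma beta_pow:
  assumes g: "g \<in> carrier G" "\<rho> g \<noteq> 1"
  shows "\<beta> (g [^] (n::nat)) - (1 - \<rho> g ^ n) * (\<beta> g / (1 - \<rho> g)) \<in> \<Lambda>"
proof -
  define p where "p = \<beta> g / (1 - \<rho> g)"
  have bp: "\<beta> g = (1 - \<rho> g) * p" using g by (simp add: p_def)
  have "\<beta> (g [^] n) - (1 - \<rho> g ^ n) * p \<in> \<Lambda>"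
  proof (induction n)
    case 0 then show ?case using beta_one by simp
  next
    case (Suc n)
    have "\<beta> (g [^] n \<otimes> g) - (\<rho> g ^ n * \<beta> g + \<beta> (g [^] n)) \<in> \<Lambda>"
      using beta_mult[of "g [^] n" g] g by (simp add: chi_pow)
    from add_mem[OF this Suc] show ?case by (simp add: bp algebra_simps)
  qed
  then show ?thesis unfolding p_def .
qed

text \<open>An element that is not a translation has a fixed point and acts linearly around it, so
  its powers are governed by the multiplier alone.\<close>

lemma pow_eq_one_of_chi:
  assumes g: "g \<in> carrier G" "\<rho> g \<noteq> 1" "\<rho> g ^ m = 1"
  shows "g [^] m = \<one>"
  using beta_pow[OF g(1,2), of m] g by (intro faithful) (auto simp: chi_pow)

text \<open>Makes the translation vectors a module over the multipliers, so that a polynomial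
  relation satisfied by \<open>\<rho> g\<close> becomes a relation in the group between a
  translation and its conjugates.\<close>

lemma beta_conj:
  assumes t: "t \<in> translation_set" and g: "g \<in> carrier G"
  shows "\<beta> (g \<otimes> t \<otimes> inv g) - \<rho> g * \<beta> t \<in> \<Lambda>"
proof -
  have k: "g \<otimes> t \<otimes> inv g \<in> carrier G" "\<rho> (g \<otimes> t \<otimes> inv g) = 1" "(g \<otimes> t \<otimes> inv g) \<otimes> g = g \<otimes> t"
    using t g by (auto simp: chi_mult chi_inv chi_nonzero m_assoc)
  have "\<beta> (g \<otimes> t) - (\<beta> g + \<beta> (g \<otimes> t \<otimes> inv g)) \<in> \<Lambda>"
    using beta_mult[OF k(1) g] unfolding k by simp
  moreover have "\<beta> (g \<otimes> t) - (\<rho> g * \<beta> t + \<beta> g) \<in> \<Lambda>" using t g by (intro beta_mult) auto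
  ultimately show ?thesis using diff_mem by (force simp: algebra_simps)
qed

lemma conj_translation: "t \<in> translation_set \<Longrightarrow> g \<in> carrier G \<Longrightarrow> g \<otimes> t \<otimes> inv g \<in> translation_set"
  by (simp add: chi_mult chi_inv chi_nonzero)

lemma conj_relation_neg:
  assumes t: "t \<in> translation_set" and g: "g \<in> carrier G" "\<rho> g = -1"
  shows "(g \<otimes> t \<otimes> inv g) \<otimes> t = \<one>"
proof (rule faithful)
  let ?u = "g \<otimes> t \<otimes> inv g"
  have u: "?u \<in> translation_set" by (rule conj_translation[OF t g(1)])
  have "\<beta> (?u \<otimes> t) - (\<beta> ?u + \<beta> t) \<in> \<Lambda>" using u t by (intro beta_translation_mult) auto
  from add_mem[OF this beta_conj[OF t g(1)]] show "\<beta> (?u \<otimes> t) \<in> \<Lambda>" by (simp add: g(2))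
qed (use t g in \<open>auto simp: chi_inv chi_nonzero chi_mult\<close>)

lemma conj_relation_cubic:
  assumes t: "t \<in> translation_set" and g: "g \<in> carrier G" "\<rho> g ^ 2 + \<rho> g + 1 = 0"
  shows "(g \<otimes> (g \<otimes> t \<otimes> inv g) \<otimes> inv g) \<otimes> ((g \<otimes> t \<otimes> inv g) \<otimes> t) = \<one>"
proof (rule faithful)
  let ?u = "g \<otimes> t \<otimes> inv g"
  let ?v = "g \<otimes> ?u \<otimes> inv g"
  have u: "?u \<in> translation_set" by (rule conj_translation[OF t g(1)])
  have v: "?v \<in> translation_set" by (rule conj_translation[OF u g(1)])
  have "\<beta> (?u \<otimes> t) - (\<beta> ?u + \<beta> t) \<in> \<Lambda>" using u t by (intro beta_translation_mult) auto
  moreover have "\<beta> (?v \<otimes> (?u \<otimes> t)) - (\<beta> ?v + \<beta> (?u \<otimes> t)) \<in> \<Lambda>"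
    using v u t by (intro beta_translation_mult) auto
  ultimately have 1: "\<beta> (?v \<otimes> (?u \<otimes> t)) - (\<beta> ?v + (\<beta> ?u + \<beta> t)) \<in> \<Lambda>"
    using add_mem by (force simp: algebra_simps)
  have bu: "\<beta> ?u - \<rho> g * \<beta> t \<in> \<Lambda>" by (rule beta_conj[OF t g(1)])
  have "\<rho> g * (\<beta> ?u - \<rho> g * \<beta> t) \<in> \<Lambda>" by (rule chi_lattice[OF g(1) bu])
  from add_mem[OF this beta_conj[OF u g(1)]] have bv: "\<beta> ?v - \<rho> g * (\<rho> g * \<beta> t) \<in> \<Lambda>"
    by (simp add: algebra_simps)
  have "\<beta> (?v \<otimes> (?u \<otimes> t)) - (\<rho> g ^ 2 + \<rho> g + 1) * \<beta> t \<in> \<Lambda>"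
    using add_mem[OF add_mem[OF 1 bu] bv] by (simp add: algebra_simps power2_eq_square)
  then show "\<beta> (?v \<otimes> (?u \<otimes> t)) \<in> \<Lambda>" using g(2) by simp
qed (use t g in \<open>auto simp: chi_inv chi_nonzero chi_mult\<close>)

text \<open>The \<open>m\<close>-torsion of the torus is a copy of (Z/m)^2, and faithfulness embeds
  \<open>S\<close> into it. If \<open>S\<close> has the maximal size \<open>m^2\<close>, it
  therefore meets every class of \<open>l / m\<close>.\<close>

lemma torsion_bound_and_conj:
  assumes m: "m > 0" and S: "S \<subseteq> translation_set" "\<And>t. t \<in> S \<Longrightarrow> t [^] m = \<one>"
  shows "card S \<le> m\<^sup>2"
    and "card S = m\<^sup>2 \<Longrightarrow> l \<in> \<Lambda> \<Longrightarrow> \<exists>t\<in>S. \<beta> t - l / of_nat m \<in> \<Lambda>"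
proof -
  obtain a b x y where bl: "bounded_linear x" "bounded_linear y"
    and dec: "\<And>z. z = of_real (x z) * a + of_real (y z) * b"
    and xy: "\<And>s t. x (of_real s * a + of_real t * b) = s"
      "\<And>s t. y (of_real s * a + of_real t * b) = t"
    and c: "\<Lambda> = {z. x z \<in> \<int> \<and> y z \<in> \<int>}"
    by (rule coordinates, rule that)
  interpret x: bounded_linear x by (rule bl)
  interpret y: bounded_linear y by (rule bl)
  \<comment> \<open>For an \<open>m\<close>-torsion point, \<open>r\<close> gives its two
    coordinates multiplied by \<open>m\<close>, as residues modulo \<open>m\<close>.\<close>
  define r where "r z = (\<lfloor>real m * x z\<rfloor> mod int m, \<lfloor>real m * y z\<rfloor> mod int m)" for z
  define I where "I = {0..<int m} \<times> {0..<int m}"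
  have cardI: "finite I" "card I = m\<^sup>2" by (auto simp: I_def card_cartesian_product power2_eq_square)
  have rI: "r z \<in> I" for z using m by (simp add: r_def I_def)
  have int_eq: "p - q \<in> \<int>"
    if "real m * p \<in> \<int>" "real m * q \<in> \<int>" "\<lfloor>real m * p\<rfloor> mod int m = \<lfloor>real m * q\<rfloor> mod int m" for p q
  proof -
    have "int m dvd \<lfloor>real m * p\<rfloor> - \<lfloor>real m * q\<rfloor>" using that(3) by (simp add: mod_eq_dvd_iff)
    then obtain k where k: "\<lfloor>real m * p\<rfloor> - \<lfloor>real m * q\<rfloor> = int m * k" by (auto simp: dvd_def)
    have "real m * p - real m * q = of_int (\<lfloor>real m * p\<rfloor> - \<lfloor>real m * q\<rfloor>)"
      using that(1,2) by (simp add: of_int_floor)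
    also have "\<dots> = real m * of_int k" unfolding k by simp
    finally have "real m * (p - q) = real m * of_int k" by (simp add: algebra_simps)
    then have "p - q = of_int k" using m by simp
    then show ?thesis by simp
  qed
  have r_eq: "z - w \<in> \<Lambda>" if zw: "of_nat m * z \<in> \<Lambda>" "of_nat m * w \<in> \<Lambda>" and r: "r z = r w" for z w
  proof -
    have sc: "of_nat m * z = real m *\<^sub>R z" for z :: complex by (simp add: scaleR_conv_of_real)
    have "real m * x z \<in> \<int>" "real m * x w \<in> \<int>" "real m * y z \<in> \<int>" "real m * y w \<in> \<int>"
      using zw unfolding c sc by (auto simp: x.scaleR y.scaleR)
    then show ?thesis using r int_eq unfolding c by (auto simp: r_def x.diff y.diff)
  qed
  have tors: "of_nat m * \<beta> t \<in> \<Lambda>" if "t \<in> S" for t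
  proof -
    have t: "t \<in> translation_set" "t [^] m = \<one>" using that S by auto
    from diff_mem[OF beta_one, of "\<beta> \<one> - of_nat m * \<beta> t"] beta_translation_pow[OF t(1), of m] t(2)
    show ?thesis by simp
  qed
  have inj: "inj_on (\<lambda>t. r (\<beta> t)) S"
  proof (rule inj_onI)
    fix s t assume "s \<in> S" "t \<in> S" "r (\<beta> s) = r (\<beta> t)"
    moreover from this have "s \<in> translation_set" "t \<in> translation_set" using S by blast+
    ultimately show "s = t" using r_eq tors by (intro affine_eqI) auto
  qed
  have sub: "(\<lambda>t. r (\<beta> t)) ` S \<subseteq> I" using rI by auto
  show "card S \<le> m\<^sup>2" using card_inj_on_le[OF inj sub cardI(1)] cardI(2) by simp
  assume card: "card S = m\<^sup>2" and l: "l \<in> \<Lambda>"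
  have "(\<lambda>t. r (\<beta> t)) ` S = I"
    using card_subset_eq[OF cardI(1) sub] card cardI(2) by (simp add: card_image inj)
  then obtain t where t: "t \<in> S" "r (\<beta> t) = r (l / of_nat m)" using rI by (metis imageE)
  have "\<beta> t - l / of_nat m \<in> \<Lambda>" by (rule r_eq[OF tors[OF t(1)] _ t(2)]) (use l m in simp)
  then show "\<exists>t\<in>S. \<beta> t - l / of_nat m \<in> \<Lambda>" using t(1) by blast
qed

text \<open>If \<open>g\<close> commuted with the full \<open>m\<close>-torsion,
  \<open>\<rho> g - 1\<close> would map all points \<open>l / m\<close> into the lattice. Then
  \<open>(\<rho> g - 1) / m\<close> would be a lattice multiplier of modulus below 1, hence
  0.\<close>

lemma full_torsion_not_centralized:
  assumes m: "m > 0" and S: "S \<subseteq> translation_set" "\<And>t. t \<in> S \<Longrightarrow> t [^] m = \<one>" "card S = m\<^sup>2"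
    and g: "g \<in> carrier G" "\<rho> g \<noteq> 1" "norm (\<rho> g - 1) < real m"
  shows "\<exists>t\<in>S. g \<otimes> t \<otimes> inv g \<noteq> t"
proof (rule ccontr)
  assume "\<not> ?thesis"
  then have central: "g \<otimes> t \<otimes> inv g = t" if "t \<in> S" for t using that by blast
  have "(\<rho> g - 1) / of_nat m * l \<in> \<Lambda>" if l: "l \<in> \<Lambda>" for l
  proof -
    obtain t where t: "t \<in> S" "\<beta> t - l / of_nat m \<in> \<Lambda>" using torsion_bound_and_conj(2)[OF m S l] by blast
    have "\<beta> t - \<rho> g * \<beta> t \<in> \<Lambda>"
      using beta_conj[of t g] central[OF t(1)] g S(1) t(1) by auto
    moreover have "(\<rho> g * (\<beta> t - l / of_nat m)) - (\<beta> t - l / of_nat m) \<in> \<Lambda>"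
      by (intro diff_mem chi_lattice g t)
    ultimately have "- (\<rho> g * (l / of_nat m) - l / of_nat m) \<in> \<Lambda>"
      using add_mem by (force simp: algebra_simps)
    then show ?thesis unfolding minus_mem_iff by (simp add: left_diff_distrib diff_divide_distrib)
  qed
  moreover have "norm ((\<rho> g - 1) / of_nat m) = norm (\<rho> g - 1) / real m" by (simp add: norm_divide)
  then have "norm ((\<rho> g - 1) / of_nat m) < 1" using g(3) m by simp
  ultimately have "(\<rho> g - 1) / of_nat m = 0" by (rule small_multiplier_eq_zero)
  then show False using g(2) m by simp
qed

end

lemma cubic_root_of_unity:
  obtains w :: complex where "w\<^sup>2 + w + 1 = 0"
proof
  show "(Complex (- 1/2) (sqrt 3 / 2))\<^sup>2 + Complex (- 1/2) (sqrt 3 / 2) + 1 = 0"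
    by (simp add: complex_eq_iff power2_eq_square)
qed

lemma cubic_root_facts:
  fixes w :: complex
  assumes "w\<^sup>2 + w + 1 = 0"
  shows "w ^ 3 = 1" "w \<noteq> 1" "w\<^sup>2 \<noteq> 1" "w\<^sup>2 \<noteq> w"
proof -
  have "(w - 1) * (w\<^sup>2 + w + 1) = w ^ 3 - 1" by (simp add: power2_eq_square power3_eq_cube algebra_simps)
  then show "w ^ 3 = 1" using assms by simp
  show w1: "w \<noteq> 1" using assms by auto
  show "w\<^sup>2 \<noteq> 1"
  proof
    assume sq: "w\<^sup>2 = 1"
    have "w + 2 = 0" using assms unfolding sq by (simp add: algebra_simps)
    then have "w = -2" by (simp add: eq_neg_iff_add_eq_0)
    then show False using sq by simp
  qed
  show "w\<^sup>2 \<noteq> w"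
  proof
    assume "w\<^sup>2 = w"
    moreover from this have "w \<noteq> 0" using assms by auto
    ultimately show False using w1 by (simp add: power2_eq_square)
  qed
qed

lemma cube_roots_of_unity:
  fixes u z :: complex
  assumes u: "u ^ 3 = 1" "u \<noteq> 1" and z: "z ^ 3 = 1"
  shows "z = 1 \<or> z = u \<or> z = u\<^sup>2"
proof -
  have "(u - 1) * (u\<^sup>2 + u + 1) = u ^ 3 - 1" by (simp add: power2_eq_square power3_eq_cube algebra_simps)
  then have "(u - 1) * (u\<^sup>2 + u + 1) = 0" using u by simp
  then have zero: "u\<^sup>2 + u + 1 = 0" using u(2) by (metis mult_eq_0_iff eq_iff_diff_eq_0)
  have "(z - u) * (z - u\<^sup>2) = z\<^sup>2 - (u\<^sup>2 + u + 1) * z + z + u ^ 3"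
    by (simp add: power2_eq_square power3_eq_cube algebra_simps)
  then have "(z - u) * (z - u\<^sup>2) = z\<^sup>2 + z + 1" unfolding zero u(1) by (simp only: mult_zero_left diff_zero)
  then have "(z - 1) * ((z - u) * (z - u\<^sup>2)) = (z - 1) * (z\<^sup>2 + z + 1)" by (simp only:)
  also have "\<dots> = z ^ 3 - 1" by (simp add: power2_eq_square power3_eq_cube algebra_simps)
  finally have "(z - 1) * ((z - u) * (z - u\<^sup>2)) = 0" unfolding z by simp
  then show ?thesis unfolding mult_eq_0_iff right_minus_eq .
qed

context affine_group
begin

text \<open>A nontrivial subgroup of a group of prime order is everything; since \<open>p\<close> is
  2 or 3, the roots can be listed from a single nontrivial value.\<close>

lemma chi_image_prime:
  assumes H: "subgroup H G" and p: "p = 2 \<or> p = 3" and pow: "\<And>h. h \<in> H \<Longrightarrow> \<rho> h ^ p = 1"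
  shows "\<rho> ` H = {1} \<or> \<rho> ` H = {z. z ^ p = 1}"
proof (cases "\<rho> ` H = {1}")
  case False
  have one: "1 \<in> \<rho> ` H" using subgroup.one_closed[OF H] chi_one by (metis image_eqI)
  then obtain h where h: "h \<in> H" "\<rho> h \<noteq> 1" using False by auto
  have hc: "h \<in> carrier G" using subgroup.mem_carrier[OF H h(1)] .
  have h2: "(\<rho> h)\<^sup>2 \<in> \<rho> ` H"
    using subgroup.m_closed[OF H h(1) h(1)] hc chi_mult by (metis imageI power2_eq_square)
  have "{z. z ^ p = 1} \<subseteq> \<rho> ` H"
  proof safe
    fix z :: complex assume z: "z ^ p = 1"
    from p show "z \<in> \<rho> ` H"
    proof
      assume p2: "p = 2"
      then have "\<rho> h = -1" using pow[OF h(1)] h(2) by (simp add: power2_eq_1_iff)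
      moreover have "z = 1 \<or> z = -1" using z p2 by (simp add: power2_eq_1_iff)
      ultimately show ?thesis using h(1) one by (metis imageI)
    next
      assume "p = 3"
      then have "z = 1 \<or> z = \<rho> h \<or> z = (\<rho> h)\<^sup>2" using pow[OF h(1)] h(2) z by (intro cube_roots_of_unity) auto
      then show ?thesis using h(1) h2 one by auto
    qed
  qed
  then show ?thesis using pow by auto
qed simp

text \<open>Every multiplier has order dividing 4 or 6, and the whole image is killed by one of
  these exponents. The element \<open>g0\<close> rules out the images of order 1 and 2; the rest is
  listing roots of unity.\<close>

lemma chi_image:
  assumes g0: "g0 \<in> carrier G" "(\<rho> g0)\<^sup>2 \<noteq> 1"
  shows "\<exists>d\<in>{3, 4, 6}. \<rho> ` carrier G = {z. z ^ d = 1}"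
proof -
  let ?H = "\<rho> ` carrier G"
  define w where "w = \<rho> g0"
  have w: "w \<in> ?H" "w\<^sup>2 \<noteq> 1" using g0 by (auto simp: w_def)
  have closed: "u * v \<in> ?H" if "u \<in> ?H" "v \<in> ?H" for u v
    using that chi_mult by (metis (no_types, lifting) image_iff m_closed)
  have one: "1 \<in> ?H" using chi_one by (metis image_eqI one_closed)
  have unit: "z ^ 4 = 1 \<or> z ^ 6 = 1" if "z \<in> ?H" for z
    using that unit_multiplier chi_lattice norm_chi by auto
  have nz: "z \<noteq> 0" if "z \<in> ?H" for z using that chi_nonzero by auto
  \<comment> \<open>If \<open>u\<close> violates the first and \<open>v\<close> the second
    alternative, then \<open>u ^ 6 = 1\<close> and \<open>v ^ 4 = 1\<close>, so \<open>u * v\<close>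
    violates both.\<close>
  have "(\<forall>z\<in>?H. z ^ 4 = 1) \<or> (\<forall>z\<in>?H. z ^ 6 = 1)"
  proof (rule ccontr)
    assume "\<not> ?thesis"
    then obtain u v where uv: "u \<in> ?H" "u ^ 4 \<noteq> 1" "v \<in> ?H" "v ^ 6 \<noteq> 1" by auto
    then have "u ^ 6 = 1" "v ^ 4 = 1" using unit by blast+
    moreover have "(u * v) ^ 4 = 1 \<or> (u * v) ^ 6 = 1" using unit closed uv by blast
    ultimately show False using uv by (auto simp: power_mult_distrib)
  qed
  then show ?thesis
  proof
    assume 4: "\<forall>z\<in>?H. z ^ 4 = 1"
    have "(w\<^sup>2)\<^sup>2 = 1" using bspec[OF 4 w(1)] by (simp flip: power_mult)
    then have w2: "w\<^sup>2 = -1" using w(2) power2_eq_1_iff[of "w\<^sup>2"] by blast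
    have m1: "-1 \<in> ?H" using closed[OF w(1) w(1)] w2 by (simp add: power2_eq_square)
    have mw: "- w \<in> ?H" using closed[OF m1 w(1)] by simp
    have "{z. z ^ 4 = 1} \<subseteq> ?H"
    proof safe
      fix z :: complex assume z: "z ^ 4 = 1"
      have "(z\<^sup>2)\<^sup>2 = 1" using z by (simp flip: power_mult)
      then have "z\<^sup>2 = 1 \<or> z\<^sup>2 = w\<^sup>2" using w2 power2_eq_1_iff[of "z\<^sup>2"] by metis
      then have "z = 1 \<or> z = -1 \<or> z = w \<or> z = - w" by (auto simp: power2_eq_1_iff power2_eq_iff)
      then show "z \<in> ?H" using one m1 w(1) mw by auto
    qed
    then show ?thesis using 4 by auto
  next
    assume 6: "\<forall>z\<in>?H. z ^ 6 = 1"
    define u where "u = w\<^sup>2"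
    have u: "u \<in> ?H" "u ^ 3 = 1" "u \<noteq> 1"
      using closed[OF w(1) w(1)] bspec[OF 6 w(1)] w(2)
      by (simp_all add: u_def flip: power_mult) (simp add: power2_eq_square)
    have three: "z \<in> ?H" if "z ^ 3 = 1" for z
      using cube_roots_of_unity[OF u(2,3) that] one u(1) closed[OF u(1) u(1)] by (auto simp: power2_eq_square)
    show ?thesis
    proof (cases "\<forall>z\<in>?H. z ^ 3 = 1")
      case True
      then have "?H = {z. z ^ 3 = 1}" using three by auto
      then show ?thesis by blast
    next
      case False
      then obtain v where v: "v \<in> ?H" "v ^ 3 \<noteq> 1" by blast
      have "(v ^ 3)\<^sup>2 = 1" using bspec[OF 6 v(1)] by (simp flip: power_mult)
      then have "v ^ 3 = -1" using v(2) power2_eq_1_iff[of "v ^ 3"] by blast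
      moreover have "v ^ 3 \<in> ?H" using closed[OF v(1) closed[OF v(1) v(1)]] by (simp add: power3_eq_cube mult.assoc)
      ultimately have m1: "-1 \<in> ?H" by simp
      have "{z. z ^ 6 = 1} \<subseteq> ?H"
      proof safe
        fix z :: complex assume "z ^ 6 = 1"
        then have "(z ^ 3)\<^sup>2 = 1" by (simp flip: power_mult)
        then have "z ^ 3 = 1 \<or> (- z) ^ 3 = 1" using power2_eq_1_iff[of "z ^ 3"] by auto
        then show "z \<in> ?H" using three[of z] three[of "- z"] closed[OF m1, of "- z"] by auto
      qed
      then have "?H = {z. z ^ 6 = 1}" using 6 by auto
      then show ?thesis by blast
    qed
  qed
qed

end

lemma (in group) card_ge_3_of_cube:
  assumes "subgroup H G" "finite H" "h \<in> H" "h \<noteq> \<one>" "h [^] (3::nat) = \<one>"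
  shows "card H \<ge> 3"
proof -
  interpret subgroup H G by fact
  have h: "h \<in> carrier G" using assms by auto
  have hh: "h \<otimes> h \<otimes> h = \<one>" using assms(5) h by (simp add: numeral_3_eq_3)
  have 1: "h \<otimes> h \<noteq> \<one>" using hh h assms(4) by auto
  have 2: "h \<otimes> h \<noteq> h" using h assms(4) by (metis l_cancel_one)
  have "card {\<one>, h, h \<otimes> h} = 3" using 1 2 assms(4) by auto
  moreover have "{\<one>, h, h \<otimes> h} \<subseteq> H" using assms by auto
  ultimately show ?thesis using card_mono[OF assms(2)] by metis
qed

section \<open>Two actions of the same group and their translation subgroups\<close>

locale affine_pair = A: affine_group G \<Lambda>1 \<rho>1 \<beta>1 + B: affine_group G \<Lambda>2 \<rho>2 \<beta>2
  for G :: "('g, 'c) monoid_scheme" (structure) and \<Lambda>1 \<rho>1 \<beta>1 \<Lambda>2 \<rho>2 \<beta>2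
begin

abbreviation "T1 \<equiv> {g \<in> carrier G. \<rho>1 g = 1}"
abbreviation "T2 \<equiv> {g \<in> carrier G. \<rho>2 g = 1}"

text \<open>Apply \<open>\<rho>2\<close> to the group relation forced on the first curve:
  \<open>t\<close> times its conjugate is trivial, and a character does not see the
  conjugation.\<close>

lemma chi2_sq: 
  assumes "t \<in> T1" "g \<in> carrier G" "\<rho>1 g = -1"
  shows "(\<rho>2 t)\<^sup>2 = 1"
proof -
  have "\<rho>2 ((g \<otimes> t \<otimes> inv g) \<otimes> t) = 1" using A.conj_relation_neg[OF assms] B.chi_one by simp
  then show ?thesis using assms by (simp add: B.chi_conj B.chi_mult[of "g \<otimes> t \<otimes> inv g"] power2_eq_square)
qed

lemma chi2_cube:
  assumes "t \<in> T1" "g \<in> carrier G" "(\<rho>1 g)\<^sup>2 + \<rho>1 g + 1 = 0"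
  shows "(\<rho>2 t) ^ 3 = 1"
proof -
  let ?u = "g \<otimes> t \<otimes> inv g"
  have c: "t \<in> carrier G" "?u \<in> carrier G" "g \<otimes> ?u \<otimes> inv g \<in> carrier G" "?u \<otimes> t \<in> carrier G" using assms by auto
  have "\<rho>2 ((g \<otimes> ?u \<otimes> inv g) \<otimes> (?u \<otimes> t)) = 1" using A.conj_relation_cubic[OF assms] B.chi_one by simp
  then show ?thesis
    by (simp only: B.chi_mult[OF c(3,4)] B.chi_mult[OF c(2,1)] B.chi_conj[OF assms(2) c(2)]
        B.chi_conj[OF assms(2) c(1)] power3_eq_cube mult.assoc)
qed

text \<open>
  \<open>\<rho>2\<close> is invariant under conjugation, and the conjugates of a translation satisfy the linear
  relations \<open>1 + \<omega> + \<omega>^2 = 0\<close> and \<open>1 + (-1) = 0\<close> of the conjugating roots of unity.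
\<close>

lemma chi2_translations:
  assumes img: "\<rho>1 ` carrier G = {z. z ^ d = 1}" and d: "d \<in> {3, 4, 6}"
  shows "\<rho>2 ` T1 = {1} \<or> (d = 3 \<and> \<rho>2 ` T1 = {z. z ^ 3 = 1}) \<or> (d = 4 \<and> \<rho>2 ` T1 = {z. z ^ 2 = 1})"
proof -
  obtain w :: complex where w: "w\<^sup>2 + w + 1 = 0" by (rule cubic_root_of_unity)
  have w3: "w ^ 3 = 1" using cubic_root_facts[OF w] by blast
  have cube: "(\<rho>2 t) ^ 3 = 1" if d36: "d = 3 \<or> d = 6" and t: "t \<in> T1" for t
  proof -
    have "w ^ 6 = (w ^ 3)\<^sup>2" by (simp flip: power_mult)
    then have "w ^ d = 1" using d36 w3 by auto
    then obtain g where "g \<in> carrier G" "\<rho>1 g = w" using img by (metis (mono_tags, lifting) image_iff mem_Collect_eq)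
    then show ?thesis using chi2_cube[OF t] w by blast
  qed
  have sq: "(\<rho>2 t)\<^sup>2 = 1" if d46: "d = 4 \<or> d = 6" and t: "t \<in> T1" for t
  proof -
    have "(-1::complex) ^ d = 1" using d46 by auto
    then obtain g where "g \<in> carrier G" "\<rho>1 g = -1" using img by (metis (mono_tags, lifting) image_iff mem_Collect_eq)
    then show ?thesis using chi2_sq[OF t] by blast
  qed
  from d consider "d = 3" | "d = 4" | "d = 6" by auto
  then show ?thesis
  proof cases
    case 1
    then show ?thesis using B.chi_image_prime[OF A.subgroup_translation_set, of 3] cube by blast
  next
    case 2
    then show ?thesis using B.chi_image_prime[OF A.subgroup_translation_set, of 2] sq by blast
  next
    case 3
    \<comment> \<open>For \<open>d = 6\<close> both \<open>-1\<close> and a primitive cube root are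
      multipliers, so the value has trivial square and trivial cube.\<close>
    have "\<rho>2 t = 1" if "t \<in> T1" for t
      using cube[OF disjI2[OF 3] that] sq[OF disjI2[OF 3] that] by (simp add: power3_eq_cube power2_eq_square)
    moreover have "\<one> \<in> T1" by (simp add: A.chi_one)
    ultimately have "\<rho>2 ` T1 = {1}" by (force simp: image_iff)
    then show ?thesis by blast
  qed
qed

text \<open>On \<open>T1\<close> the kernel of \<open>\<rho>2\<close> is
  \<open>T1 \<inter> T2\<close>; the image of \<open>\<rho>2\<close> thus measures how far
  \<open>T1\<close> is from lying in \<open>T2\<close>.\<close>

lemma card_T1: "card T1 = card (\<rho>2 ` T1) * card (T1 \<inter> T2)"
proof -
  have "finite T1" using A.finite_carrier by simp
  from A.card_eq_card_image_mult_card_kernel[where f = \<rho>2, OF A.subgroup_translation_set this]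
  have "card T1 = card (\<rho>2 ` T1) * card {h \<in> T1. \<rho>2 h = 1}" using B.chi_mult B.chi_one by blast
  moreover have "{h \<in> T1. \<rho>2 h = 1} = T1 \<inter> T2" by blast
  ultimately show ?thesis by (simp only:)
qed

lemma card_G:
  assumes "\<rho>1 ` carrier G = {z. z ^ d = 1}" "d > 0"
  shows "card (carrier G) = d * card T1"
  using A.card_eq_card_image_mult_card_kernel[OF A.subgroup_self A.finite_carrier, of \<rho>1] assms
  by (simp add: A.chi_mult A.chi_one card_roots_unity_eq)

lemma K_subgroup: "subgroup (T1 \<inter> T2) G"
  using A.subgroup_translation_set B.subgroup_translation_set A.subgroups_Inter_pair by blast

text \<open>Both characters have abelian target and hence kill commutators. When the intersection is
  trivial, all of \<open>T1\<close> becomes central.\<close>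

lemma commutator_in_K:
  assumes "g \<in> carrier G" "e \<in> T1"
  shows "(g \<otimes> e \<otimes> inv g) \<otimes> inv e \<in> T1 \<inter> T2"
proof -
  have "\<rho>2 g \<noteq> 0" "\<rho>2 e \<noteq> 0" "\<rho>1 g \<noteq> 0" using assms B.chi_nonzero A.chi_nonzero by auto
  then show ?thesis using assms by (auto simp: A.chi_mult B.chi_mult A.chi_inv B.chi_inv field_simps)
qed

end

section \<open>Recognizing the exceptional groups\<close>

lemma inj_on_power_cubic:
  fixes w :: complex
  assumes "w\<^sup>2 + w + 1 = 0"
  shows "inj_on (\<lambda>k. w ^ k) {0..<3::nat}"
  using cubic_root_facts[OF assms] unfolding inj_on_def
  by (auto simp: numeral_3_eq_3 atLeast0LessThan lessThan_Suc power2_eq_square)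

lemma inj_on_power_quartic:
  fixes w :: complex
  assumes w: "w\<^sup>2 = -1"
  shows "inj_on (\<lambda>k. w ^ k) {0..<4::nat}"
proof -
  have w1: "w \<noteq> 1" "w \<noteq> -1" "w \<noteq> 0" using w by auto
  have w3: "w ^ 3 = - w" using w by (simp add: power3_eq_cube power2_eq_square)
  show ?thesis
  proof (rule linorder_inj_onI')
    fix a b :: nat assume ab: "a \<in> {0..<4}" "b \<in> {0..<4}" "a < b"
    then consider "b - a = 1" | "b - a = 2" | "b - a = 3" by fastforce
    then have "w ^ (b - a) \<noteq> 1" using w w1 w3 by cases (auto simp: minus_equation_iff[of w])
    moreover have "w ^ b = w ^ a * w ^ (b - a)" using ab(3) by (simp flip: power_add)
    ultimately show "w ^ a \<noteq> w ^ b" using w1(3) by auto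
  qed
qed

lemma (in group) inj_on_hom_pair:
  assumes e: "e \<in> carrier G" "e [^] m = \<one>" and f: "f \<in> carrier G" "f [^] m = \<one>"
    and m: "m > 0" and comm: "e \<otimes> f = f \<otimes> e"
    and triv: "\<And>i j. i < m \<Longrightarrow> j < m \<Longrightarrow> e [^] i \<otimes> f [^] j = \<one> \<Longrightarrow> i = 0 \<and> j = 0"
  shows "inj_on (\<lambda>(a, b). e [^] nat a \<otimes> f [^] nat b)
    (carrier (integer_mod_group m \<times>\<times> integer_mod_group m))"
proof -
  let ?N = "integer_mod_group m \<times>\<times> integer_mod_group m"
  let ?A = "\<lambda>(a, b). e [^] nat a \<otimes> f [^] nat b"
  interpret N: group ?N by (intro DirProd_group group_integer_mod_group)
  interpret h: group_hom ?N G ?A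
    by (unfold_locales) (rule hom_integer_mod_group_pair[OF e f m comm])
  have "kernel ?N G ?A = {\<one>\<^bsub>?N\<^esub>}"
  proof
    show "kernel ?N G ?A \<subseteq> {\<one>\<^bsub>?N\<^esub>}"
    proof
      fix x assume "x \<in> kernel ?N G ?A"
      then obtain a b where x: "x = (a, b)" "0 \<le> a" "a < int m" "0 \<le> b" "b < int m"
        "e [^] nat a \<otimes> f [^] nat b = \<one>"
        using m by (auto simp: kernel_def carrier_integer_mod_group simp del: pow_nat)
      then have "nat a = 0 \<and> nat b = 0" by (intro triv) auto
      then show "x \<in> {\<one>\<^bsub>?N\<^esub>}" using x by simp
    qed
    show "{\<one>\<^bsub>?N\<^esub>} \<subseteq> kernel ?N G ?A" by (simp add: kernel_def)
  qed
  then show ?thesis by (rule h.trivial_ker_imp_inj)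
qed

lemma (in group) conj_mult:
  "g \<in> carrier G \<Longrightarrow> x \<in> carrier G \<Longrightarrow> y \<in> carrier G \<Longrightarrow>
    g \<otimes> (x \<otimes> y) \<otimes> inv g = (g \<otimes> x \<otimes> inv g) \<otimes> (g \<otimes> y \<otimes> inv g)"
proof -
  assume c: "g \<in> carrier G" "x \<in> carrier G" "y \<in> carrier G"
  then have "inv g \<otimes> (g \<otimes> (y \<otimes> inv g)) = y \<otimes> inv g" by (simp flip: m_assoc)
  then show ?thesis using c by (simp add: m_assoc)
qed

lemma (in group) conj_pow:
  assumes "g \<in> carrier G" "x \<in> carrier G"
  shows "g \<otimes> x [^] (n::nat) \<otimes> inv g = (g \<otimes> x \<otimes> inv g) [^] n"
  using assms by (induction n) (simp_all add: conj_mult)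

lemma (in group) commute_of_conj:
  assumes "g \<in> carrier G" "x \<in> carrier G" "y \<in> carrier G" "g \<otimes> x \<otimes> inv g = y"
  shows "g \<otimes> x = y \<otimes> g"
  using assms by (metis inv_closed inv_solve_right m_closed)

text \<open>Restates \<open>exceptional\<close> in the shape that
  \<open>iso_semidirect_product\<close> delivers.\<close>

lemma exceptionalI:
  shows "G \<cong> semidirect_product (integer_mod_group 3) (integer_mod_group 3) (\<lambda>k. id ^^ nat k) \<Longrightarrow> exceptional G"
    "G \<cong> semidirect_product (integer_mod_group 2) (integer_mod_group 4) (\<lambda>k. id ^^ nat k) \<Longrightarrow> exceptional G"
    "G \<cong> semidirect_product (integer_mod_group 3 \<times>\<times> integer_mod_group 3) (integer_mod_group 3)
       (\<lambda>k. (\<lambda>(a, b). ((- b) mod 3, (a - b) mod 3)) ^^ nat k) \<Longrightarrow> exceptional G"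
    "G \<cong> semidirect_product (integer_mod_group 2 \<times>\<times> integer_mod_group 2) (integer_mod_group 4)
       (\<lambda>k. (\<lambda>(a, b). ((- b) mod 2, a mod 2)) ^^ nat k) \<Longrightarrow> exceptional G"
  unfolding exceptional_def Let_def semidirect_product_trivial phi3_def[abs_def] phi4_def[abs_def]
  by blast+

context affine_pair
begin

lemma one_mem_K: "\<one> \<in> T1 \<inter> T2"
  by (simp add: A.chi_one B.chi_one)

lemma K_trivial:
  assumes "card (T1 \<inter> T2) = 1" "k \<in> T1 \<inter> T2"
  shows "k = \<one>"
  using assms one_mem_K by (metis card_1_singletonE singletonD)

lemma commute_of_K_trivial:
  assumes K: "card (T1 \<inter> T2) = 1" and g: "g \<in> carrier G" and e: "e \<in> T1"
  shows "g \<otimes> e = e \<otimes> g"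
proof -
  have "(g \<otimes> e \<otimes> inv g) \<otimes> inv e = \<one>" by (rule K_trivial[OF K commutator_in_K[OF g e]])
  then have "g \<otimes> e \<otimes> inv g = e" using g e by (simp add: A.inv_solve_right')
  then show ?thesis using g e by (intro A.commute_of_conj) auto
qed

text \<open>All of \<open>T1\<close> turns out to have exponent 3, so it has order 3 or 9. In the
  first case \<open>T1\<close> is central and the group is Z_3 x Z_3; in the second
  \<open>T1\<close> is the full 3-torsion of the first curve and is not centralized by
  \<open>g\<close>, which gives the semidirect product with \<open>phi3\<close>.\<close>

lemma exceptional_cubic:
  assumes img: "\<rho>1 ` carrier G = {z. z ^ 3 = 1}"
    and img1: "\<rho>2 ` T1 = {z. z ^ 3 = 1}" and img2: "\<rho>1 ` T2 = {z. z ^ 3 = 1}"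
  shows "exceptional G"
proof -
  let ?K = "T1 \<inter> T2"
  obtain w :: complex where w: "w\<^sup>2 + w + 1 = 0" by (rule cubic_root_of_unity)
  note wf = cubic_root_facts[OF w]
  \<comment> \<open>The element \<open>g\<close> translates the second curve, so it commutes with
    \<open>?K\<close>, but it multiplies by \<open>w\<close> on the first. The cubic conjugation
    relation on the first curve then reads \<open>k^3 = 1\<close> for
    \<open>k \<in> ?K\<close>.\<close>
  have "w \<in> \<rho>1 ` T2" using img2 wf by simp
  then obtain g where g: "g \<in> T2" "\<rho>1 g = w" by auto
  have gc: "g \<in> carrier G" using g by simp
  have g3: "g [^] (3::nat) = \<one>" using gc g wf by (intro A.pow_eq_one_of_chi) auto
  have Kcomm: "g \<otimes> k \<otimes> inv g = k" if k: "k \<in> ?K" for k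
    using B.translation_set_commute[of g k] g k by (auto simp: A.m_assoc)
  have K3: "k [^] (3::nat) = \<one>" if k: "k \<in> ?K" for k
  proof -
    have "k \<otimes> (k \<otimes> k) = \<one>" using A.conj_relation_cubic[of k g] Kcomm[OF k] k gc g w by auto
    then show ?thesis using k by (simp add: numeral_3_eq_3 A.m_assoc)
  qed
  \<comment> \<open>Outside \<open>?K\<close> the element is not a translation of the second curve,
    and its order is read off at a fixed point there.\<close>
  have T3: "t [^] (3::nat) = \<one>" if t: "t \<in> T1" for t
  proof (cases "\<rho>2 t = 1")
    case True then show ?thesis using K3 t by auto
  next
    case False
    have "\<rho>2 t ^ 3 = 1" using img1 t by blast
    then show ?thesis using t False by (intro B.pow_eq_one_of_chi) auto
  qed
  have cT: "card T1 = 3 * card ?K" using card_T1 card_roots_unity_eq[of 3] img1 by simp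
  \<comment> \<open>A curve has only nine translations of order dividing 3. Since \<open>T1\<close>
    is three times as large as \<open>?K\<close>, this bounds \<open>?K\<close> by 3, and exponent 3
    excludes order 2.\<close>
  have "card T1 \<le> 3\<^sup>2" by (rule A.torsion_bound_and_conj(1)) (use T3 in auto)
  then have K3': "card ?K \<le> 3" using cT by simp
  have Kfin: "finite ?K" using A.finite_carrier by simp
  have cG: "card (carrier G) = 3 * card T1" using card_G[OF img] by simp
  have "card ?K = 1 \<or> card ?K = 3"
  proof (cases "?K = {\<one>}")
    case False
    then obtain k where "k \<in> ?K" "k \<noteq> \<one>" using one_mem_K by auto
    then have "card ?K \<ge> 3" using A.card_ge_3_of_cube[OF K_subgroup Kfin] K3 by blast
    then show ?thesis using K3' by simp
  qed simp
  then show ?thesis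
  proof
    assume K1: "card ?K = 1"
    have "w \<in> \<rho>2 ` T1" using img1 wf by simp
    then obtain e where e: "e \<in> T1" "\<rho>2 e = w" by auto
    have ec: "e \<in> carrier G" using e by simp
    have swap: "g \<otimes> e = e \<otimes> g" by (rule commute_of_K_trivial[OF K1 gc e(1)])
    have "G \<cong> semidirect_product (integer_mod_group 3) (integer_mod_group 3) (\<lambda>k. id ^^ nat k)"
    proof (rule A.iso_semidirect_product[where A = "\<lambda>a. e [^] nat a" and g = g and f = \<rho>1])
      show "(\<lambda>a. e [^] nat a) \<in> hom (integer_mod_group 3) G"
        by (rule A.hom_integer_mod_group) (use e T3 in auto)
      show "inj_on (\<lambda>a. e [^] nat a) (carrier (integer_mod_group 3))"
      proof (rule inj_onI)
        fix a b assume ab: "a \<in> carrier (integer_mod_group 3)" "b \<in> carrier (integer_mod_group 3)"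
          "e [^] nat a = e [^] nat b"
        then have "w ^ nat a = w ^ nat b" using B.chi_pow[OF ec] e(2) by metis
        then have "nat a = nat b"
          by (rule inj_onD[OF inj_on_power_cubic[OF w]]) (use ab in \<open>auto simp: carrier_integer_mod_group\<close>)
        then show "a = b" using ab by (auto simp: carrier_integer_mod_group)
      qed
      show "g \<otimes> e [^] nat x = e [^] nat (id x) \<otimes> g" for x
        using A.group_commutes_pow[of e g "nat x"] swap ec gc by simp
    qed (use g gc g3 e wf inj_on_power_cubic[OF w] cG cT K1 in
        \<open>auto simp: A.chi_mult A.chi_one A.chi_pow A.finite_carrier carrier_integer_mod_group simp del: pow_nat\<close>)
    then show ?thesis by (rule exceptionalI)
  next
    assume K3'': "card ?K = 3"
    then have c9: "card T1 = 3\<^sup>2" using cT by simp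
    have "norm (w - 1) < 3"
    proof -
      have "norm w = 1" using wf(1) power_eq_1_iff[of w 3] by simp
      then show ?thesis using norm_triangle_ineq4[of w 1] by simp
    qed
    \<comment> \<open>Now \<open>T1\<close> is the full 3-torsion; \<open>e\<close> and its
      conjugate \<open>f\<close> will be a basis over Z/3 in which conjugation by \<open>g\<close>
      has the matrix of \<open>phi3\<close>.\<close>
    then obtain e where e: "e \<in> T1" "g \<otimes> e \<otimes> inv g \<noteq> e"
      using A.full_torsion_not_centralized[of 3 T1 g] T3 c9 gc g(2) wf(2) by auto
    define f where "f = g \<otimes> e \<otimes> inv g"
    have f: "f \<in> T1" unfolding f_def by (rule A.conj_translation[OF e(1) gc])
    have c: "e \<in> carrier G" "f \<in> carrier G" using e f by auto
    have comm: "e \<otimes> f = f \<otimes> e" by (rule A.translation_set_commute[OF e(1) f])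
    define y where "y = \<rho>2 e"
    have y1: "y \<noteq> 1"
    proof
      assume "y = 1"
      then have "e \<in> ?K" using e by (auto simp: y_def)
      then show False using Kcomm e by blast
    qed
    have yf: "\<rho>2 f = y" unfolding f_def y_def using B.chi_conj gc c by blast
    have y3: "y ^ 3 = 1" using img1 e(1) unfolding y_def by blast
    have e3: "e [^] (3::nat) = \<one>" "f [^] (3::nat) = \<one>" using T3 e f by auto
    have e3': "e \<otimes> (e \<otimes> e) = \<one>" "f \<otimes> (f \<otimes> f) = \<one>"
      using e3 c by (simp_all add: numeral_3_eq_3 A.m_assoc)
    \<comment> \<open>The relation \<open>1 + w + w^2 = 0\<close> expresses the second conjugate of
      \<open>e\<close> as the inverse of \<open>e \<otimes> f\<close>; squares stand for inverses
      because the exponent is 3.\<close>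
    have rel: "g \<otimes> f \<otimes> inv g = e [^] (2::nat) \<otimes> f [^] (2::nat)"
    proof -
      have gf: "g \<otimes> f \<otimes> inv g \<in> carrier G" using gc c by simp
      have "(g \<otimes> f \<otimes> inv g) \<otimes> (f \<otimes> e) = \<one>"
        using A.conj_relation_cubic[OF e(1) gc] g(2) w unfolding f_def by simp
      moreover have "(e [^] (2::nat) \<otimes> f [^] (2::nat)) \<otimes> (f \<otimes> e) = \<one>"
      proof -
        have "(e [^] (2::nat) \<otimes> f [^] (2::nat)) \<otimes> (f \<otimes> e) = (e \<otimes> e) \<otimes> ((f \<otimes> (f \<otimes> f)) \<otimes> e)"
          using c by (simp add: numeral_2_eq_2 A.m_assoc)
        also have "\<dots> = \<one>" using e3' c by (simp add: A.m_assoc)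
        finally show ?thesis .
      qed
      ultimately show ?thesis using gf c by (metis A.m_closed A.nat_pow_closed A.right_cancel)
    qed
    have "G \<cong> semidirect_product (integer_mod_group 3 \<times>\<times> integer_mod_group 3) (integer_mod_group 3)
       (\<lambda>k. (\<lambda>(a, b). ((- b) mod 3, (a - b) mod 3)) ^^ nat k)"
    proof (rule A.iso_semidirect_product[where A = "\<lambda>(a, b). e [^] nat a \<otimes> f [^] nat b" and g = g and f = \<rho>1])
      show "group (integer_mod_group 3 \<times>\<times> integer_mod_group 3)"
        by (intro DirProd_group group_integer_mod_group)
      show "(\<lambda>(a, b). e [^] nat a \<otimes> f [^] nat b) \<in> hom (integer_mod_group 3 \<times>\<times> integer_mod_group 3) G"
        by (rule A.hom_integer_mod_group_pair) (use c e3 comm in auto)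
      show "inj_on (\<lambda>(a, b). e [^] nat a \<otimes> f [^] nat b) (carrier (integer_mod_group 3 \<times>\<times> integer_mod_group 3))"
      proof (rule A.inj_on_hom_pair)
        fix i j :: nat assume ij: "i < 3" "j < 3" "e [^] i \<otimes> f [^] j = \<one>"
        have "\<rho>2 (e [^] i \<otimes> f [^] j) = y ^ i * y ^ j"
          using c yf by (simp add: B.chi_mult B.chi_pow y_def)
        then have yij: "y ^ (i + j) = 1" using ij(3) B.chi_one by (simp add: power_add)
        have y2: "y * y \<noteq> 1" using y3 y1 by (metis mult.right_neutral power3_eq_cube mult.assoc)
        have fe: "f \<noteq> e" using e(2) by (simp add: f_def)
        have y4: "y * (y * (y * y)) = y" using y3 by (metis mult.assoc mult_1 power3_eq_cube)
        \<comment> \<open>As \<open>\<rho>2\<close> takes the same nontrivial value \<open>y\<close>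
          on \<open>e\<close> and on \<open>f\<close>, it excludes every case with
          \<open>i + j\<close> not divisible by 3. The two remaining nonzero pairs would give
          \<open>e = f\<close>.\<close>
        from ij(1,2) consider "i = 0 \<and> j = 0" | "i = 1 \<and> j = 2" | "i = 2 \<and> j = 1"
          | "i + j = 1" | "i + j = 2" | "i + j = 4" by linarith
        then show "i = 0 \<and> j = 0"
        proof cases
          case 2
          then have "e \<otimes> (f \<otimes> f) = \<one>" using ij(3) c by (simp add: numeral_2_eq_2)
          then have "e \<otimes> (f \<otimes> f) \<otimes> f = f" using c by simp
          then have "e = f" using e3' c by (simp add: A.m_assoc)
          then show ?thesis using fe by simp
        next
          case 3
          then have "e \<otimes> e \<otimes> f = \<one>" using ij(3) c by (simp add: numeral_2_eq_2)
          then have "e \<otimes> (e \<otimes> e \<otimes> f) = e" using c by simp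
          moreover have "e \<otimes> (e \<otimes> e \<otimes> f) = (e \<otimes> (e \<otimes> e)) \<otimes> f" using c by (simp add: A.m_assoc)
          ultimately have "f = e" unfolding e3' using c by simp
          then show ?thesis using fe by simp
        qed (use yij y1 y2 y4 in \<open>auto simp: numeral_eq_Suc\<close>)
      qed (use c e3 comm in auto)
      fix x assume "x \<in> carrier (integer_mod_group 3 \<times>\<times> integer_mod_group 3)"
      then obtain a b where x: "x = (a, b)" "0 \<le> a" "0 \<le> b" by (auto simp: carrier_integer_mod_group)
      define i j where "i = nat a" and "j = nat b"
      have ij: "a = int i" "b = int j" using x by (auto simp: i_def j_def)
      \<comment> \<open>The coefficient \<open>-1\<close> is replaced by \<open>2\<close> modulo 3,
        to obtain natural exponents.\<close>
      have m: "(- b) mod 3 = int (2 * j) mod 3" "(a - b) mod 3 = int (i + 2 * j) mod 3"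
        unfolding ij by presburger+
      have "nat (int k mod 3) = k mod 3" for k by (simp add: nat_mod_distrib)
      then have n: "nat ((- b) mod 3) = (2 * j) mod 3" "nat ((a - b) mod 3) = (i + 2 * j) mod 3"
        by (simp_all only: m)
      have "g \<otimes> (e [^] i \<otimes> f [^] j) \<otimes> inv g = f [^] i \<otimes> (e [^] (2::nat) \<otimes> f [^] (2::nat)) [^] j"
        using gc c by (simp add: A.conj_mult A.conj_pow rel f_def[symmetric])
      also have "(e [^] (2::nat) \<otimes> f [^] (2::nat)) [^] j = e [^] (2 * j) \<otimes> f [^] (2 * j)"
      proof -
        have "e [^] (2::nat) \<otimes> f [^] (2::nat) = f [^] (2::nat) \<otimes> e [^] (2::nat)"
          by (rule A.translation_set_commute) (use e f in \<open>auto simp: A.chi_pow\<close>)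
        then have "(e [^] (2::nat) \<otimes> f [^] (2::nat)) [^] j = (e [^] (2::nat)) [^] j \<otimes> (f [^] (2::nat)) [^] j"
          by (rule A.pow_mult_distrib) (use c in auto)
        then show ?thesis using c by (simp only: A.nat_pow_pow)
      qed
      also have "f [^] i \<otimes> (e [^] (2 * j) \<otimes> f [^] (2 * j)) = e [^] (2 * j) \<otimes> (f [^] i \<otimes> f [^] (2 * j))"
      proof -
        have "f [^] i \<otimes> e [^] (2 * j) = e [^] (2 * j) \<otimes> f [^] i"
          by (rule A.translation_set_commute) (use e f in \<open>auto simp: A.chi_pow\<close>)
        then show ?thesis using c by (simp flip: A.m_assoc)
      qed
      also have "\<dots> = e [^] nat ((- b) mod 3) \<otimes> f [^] nat ((a - b) mod 3)"
        unfolding n A.nat_pow_mod[OF c(1) e3(1)] A.nat_pow_mod[OF c(2) e3(2)]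
        using c by (simp add: A.nat_pow_mult)
      finally show "g \<otimes> (case x of (a, b) \<Rightarrow> e [^] nat a \<otimes> f [^] nat b) =
        (case (case x of (a, b) \<Rightarrow> (- b mod 3, (a - b) mod 3)) of (a, b) \<Rightarrow> e [^] nat a \<otimes> f [^] nat b) \<otimes> g"
        unfolding x(1) prod.case i_def[symmetric] j_def[symmetric]
        using gc c by (intro A.commute_of_conj) auto
    qed (use g gc g3 e f wf inj_on_power_cubic[OF w] cG c9 in
        \<open>auto simp: A.chi_mult A.chi_one A.chi_pow A.finite_carrier carrier_integer_mod_group card_cartesian_product simp del: pow_nat\<close>)
    then show ?thesis by (rule exceptionalI)
  qed
qed

text \<open>As in the cubic case, with exponent 2 and \<open>T1\<close> of order 2 or 4. Two
  elements share the role of the former \<open>g\<close>: the translations \<open>T2\<close> of the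
  second curve realize only the multipliers 1 and -1 on the first, so \<open>s \<in> T2\<close>
  shows that the intersection has exponent 2, while an arbitrary \<open>g\<close> with multiplier
  \<open>\<i>\<close> generates the factor Z_4.\<close>

lemma exceptional_quartic:
  assumes img: "\<rho>1 ` carrier G = {z. z ^ 4 = 1}"
    and img1: "\<rho>2 ` T1 = {z. z ^ 2 = 1}" and img2: "\<rho>1 ` T2 = {z. z ^ 2 = 1}"
  shows "exceptional G"
proof -
  let ?K = "T1 \<inter> T2"
  have "-1 \<in> \<rho>1 ` T2" using img2 by simp
  then obtain s where s: "s \<in> T2" "\<rho>1 s = -1" by auto
  have "\<i> \<in> \<rho>1 ` carrier G" using img by simp
  then obtain g where gc: "g \<in> carrier G" and g: "\<rho>1 g = \<i>" by auto
  have g4: "g [^] (4::nat) = \<one>" using gc g by (intro A.pow_eq_one_of_chi) auto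
  have K2: "k \<otimes> k = \<one>" if k: "k \<in> ?K" for k
  proof -
    have "s \<otimes> k \<otimes> inv s = k"
      using B.translation_set_commute[of s k] s k by (auto simp: A.m_assoc)
    then show ?thesis using A.conj_relation_neg[of k s] k s by auto
  qed
  have T2: "t [^] (2::nat) = \<one>" if t: "t \<in> T1" for t
  proof (cases "\<rho>2 t = 1")
    case True then show ?thesis using K2 t by (auto simp: numeral_2_eq_2)
  next
    case False
    have "\<rho>2 t ^ 2 = 1" using img1 t by blast
    then show ?thesis using t False by (intro B.pow_eq_one_of_chi) auto
  qed
  have cT: "card T1 = 2 * card ?K" using card_T1 card_roots_unity_eq[of 2] img1 by simp
  have "card T1 \<le> 2\<^sup>2" by (rule A.torsion_bound_and_conj(1)) (use T2 in auto)
  then have "card ?K \<le> 2" using cT by simp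
  moreover have "card ?K > 0" using one_mem_K A.finite_carrier card_gt_0_iff by fastforce
  ultimately have "card ?K = 1 \<or> card ?K = 2" by linarith
  moreover have cG: "card (carrier G) = 4 * card T1" using card_G[OF img] by simp
  ultimately show ?thesis
  proof (elim disjE)
    assume K1: "card ?K = 1"
    have "-1 \<in> \<rho>2 ` T1" using img1 by simp
    then obtain e where e: "e \<in> T1" "\<rho>2 e = -1" by auto
    have ec: "e \<in> carrier G" using e by simp
    have swap: "g \<otimes> e = e \<otimes> g" by (rule commute_of_K_trivial[OF K1 gc e(1)])
    have e1: "e \<noteq> \<one>" using e B.chi_one by auto
    have "G \<cong> semidirect_product (integer_mod_group 2) (integer_mod_group 4) (\<lambda>k. id ^^ nat k)"
    proof (rule A.iso_semidirect_product[where A = "\<lambda>a. e [^] nat a" and g = g and f = \<rho>1])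
      show "(\<lambda>a. e [^] nat a) \<in> hom (integer_mod_group 2) G"
        by (rule A.hom_integer_mod_group) (use e T2 in auto)
      show "inj_on (\<lambda>a. e [^] nat a) (carrier (integer_mod_group 2))"
      proof (rule inj_onI)
        fix a b assume ab: "a \<in> carrier (integer_mod_group 2)" "b \<in> carrier (integer_mod_group 2)"
          "e [^] nat a = e [^] nat b"
        then have "a \<in> {0, 1}" "b \<in> {0, 1}" by (auto simp: carrier_integer_mod_group)
        then show "a = b" using ab(3) e1 ec by auto
      qed
      show "g \<otimes> e [^] nat x = e [^] nat (id x) \<otimes> g" for x
        using A.group_commutes_pow[of e g "nat x"] swap ec gc by simp
    qed (use g gc g4 e inj_on_power_quartic[of \<i>] cG cT K1 in
        \<open>auto simp: A.chi_mult A.chi_one A.chi_pow A.finite_carrier carrier_integer_mod_group simp del: pow_nat\<close>)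
    then show ?thesis by (rule exceptionalI)
  next
    assume K2': "card ?K = 2"
    then have c4: "card T1 = 2\<^sup>2" using cT by simp
    have "norm (\<i> - 1) < 2" using sqrt2_less_2 by (simp add: cmod_def)
    then obtain e where e: "e \<in> T1" "g \<otimes> e \<otimes> inv g \<noteq> e"
      using A.full_torsion_not_centralized[of 2 T1 g] T2 c4 gc g by auto
    define f where "f = g \<otimes> e \<otimes> inv g"
    have f: "f \<in> T1" unfolding f_def by (rule A.conj_translation[OF e(1) gc])
    have c: "e \<in> carrier G" "f \<in> carrier G" using e f by auto
    have comm: "e \<otimes> f = f \<otimes> e" by (rule A.translation_set_commute[OF e(1) f])
    have e2: "e [^] (2::nat) = \<one>" "f [^] (2::nat) = \<one>" using T2 e f by auto
    have e2': "e \<otimes> e = \<one>" "f \<otimes> f = \<one>" using e2 c by (simp_all add: numeral_2_eq_2)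
    have rel: "g \<otimes> f \<otimes> inv g = e"
    proof -
      \<comment> \<open>The square of \<open>g\<close> acts as -1 on the first curve, so conjugating
        \<open>e\<close> twice inverts it, and \<open>e\<close> is its own inverse. This is the
        matrix of \<open>phi4\<close> modulo 2.\<close>
      have "\<rho>1 (g \<otimes> g) = -1" using gc g by (simp add: A.chi_mult)
      then have "((g \<otimes> g) \<otimes> e \<otimes> inv (g \<otimes> g)) \<otimes> e = \<one>"
        using gc by (intro A.conj_relation_neg[OF e(1)]) auto
      moreover have "(g \<otimes> g) \<otimes> e \<otimes> inv (g \<otimes> g) = g \<otimes> f \<otimes> inv g"
        unfolding f_def using gc c by (simp add: A.m_assoc A.inv_mult_group)
      ultimately have "(g \<otimes> f \<otimes> inv g) \<otimes> e = e \<otimes> e" using e2' by simp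
      then show ?thesis using gc c by (metis A.inv_closed A.m_closed A.right_cancel)
    qed
    have "e \<noteq> \<one>" using e(2) gc by auto
    moreover have "f \<noteq> \<one>"
    proof
      assume "f = \<one>"
      then have "g \<otimes> f \<otimes> inv g = \<one>" using gc by simp
      then show False using rel \<open>e \<noteq> \<one>\<close> by simp
    qed
    moreover have "e \<otimes> f \<noteq> \<one>"
    proof
      assume "e \<otimes> f = \<one>"
      then have "e \<otimes> f = e \<otimes> e" using e2' by simp
      then have "f = e" using c by simp
      then show False using e(2) f_def by simp
    qed
    ultimately have triv: "i = 0 \<and> j = 0" if "i < 2" "j < 2" "e [^] i \<otimes> f [^] j = \<one>" for i j :: nat
      using that c by (auto simp: less_2_cases_iff)
    have "G \<cong> semidirect_product (integer_mod_group 2 \<times>\<times> integer_mod_group 2) (integer_mod_group 4)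
       (\<lambda>k. (\<lambda>(a, b). ((- b) mod 2, a mod 2)) ^^ nat k)"
    proof (rule A.iso_semidirect_product[where A = "\<lambda>(a, b). e [^] nat a \<otimes> f [^] nat b" and g = g and f = \<rho>1])
      show "group (integer_mod_group 2 \<times>\<times> integer_mod_group 2)"
        by (intro DirProd_group group_integer_mod_group)
      show "(\<lambda>(a, b). e [^] nat a \<otimes> f [^] nat b) \<in> hom (integer_mod_group 2 \<times>\<times> integer_mod_group 2) G"
        by (rule A.hom_integer_mod_group_pair) (use c e2 comm in auto)
      show "inj_on (\<lambda>(a, b). e [^] nat a \<otimes> f [^] nat b) (carrier (integer_mod_group 2 \<times>\<times> integer_mod_group 2))"
        by (rule A.inj_on_hom_pair) (use c e2 comm triv in auto)
      fix x assume "x \<in> carrier (integer_mod_group 2 \<times>\<times> integer_mod_group 2)"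
      then obtain a b where x: "x = (a, b)" "0 \<le> a" "0 \<le> b" by (auto simp: carrier_integer_mod_group)
      define i j where "i = nat a" and "j = nat b"
      have ij: "a = int i" "b = int j" using x by (auto simp: i_def j_def)
      have "(- b) mod 2 = int j mod 2" unfolding ij by presburger
      then have n: "nat ((- b) mod 2) = j mod 2" "nat (a mod 2) = i mod 2"
        by (simp_all add: nat_mod_distrib ij)
      have "g \<otimes> (e [^] i \<otimes> f [^] j) \<otimes> inv g = f [^] i \<otimes> e [^] j"
        using gc c by (simp add: A.conj_mult A.conj_pow rel f_def[symmetric])
      also have "\<dots> = e [^] j \<otimes> f [^] i"
        by (rule A.translation_set_commute) (use e f in \<open>auto simp: A.chi_pow\<close>)
      also have "\<dots> = e [^] nat ((- b) mod 2) \<otimes> f [^] nat (a mod 2)"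
        unfolding n A.nat_pow_mod[OF c(1) e2(1)] A.nat_pow_mod[OF c(2) e2(2)] ..
      finally show "g \<otimes> (case x of (a, b) \<Rightarrow> e [^] nat a \<otimes> f [^] nat b) =
        (case (case x of (a, b) \<Rightarrow> (- b mod 2, a mod 2)) of (a, b) \<Rightarrow> e [^] nat a \<otimes> f [^] nat b) \<otimes> g"
        unfolding x(1) prod.case i_def[symmetric] j_def[symmetric]
        using gc c by (intro A.commute_of_conj) auto
    qed (use g gc g4 e f inj_on_power_quartic[of \<i>] cG c4 in
        \<open>auto simp: A.chi_mult A.chi_one A.chi_pow A.finite_carrier carrier_integer_mod_group card_cartesian_product simp del: pow_nat\<close>)
    then show ?thesis by (rule exceptionalI)
  qed
qed

end

text \<open>The products \<open>d * card S\<close> are 3, 4 or 6 when \<open>S\<close> is trivial, 9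
  when \<open>d = 3\<close> with the cube roots, and 8 when \<open>d = 4\<close> with the square
  roots. Since 8 and 9 arise in one way only, a nontrivial set would have to occur on both sides,
  and the last two assumptions exclude this.\<close>

lemma index_equation:
  fixes S1 S2 :: "complex set"
  assumes "S1 = {1} \<or> d1 = 3 \<and> S1 = {z. z ^ 3 = 1} \<or> d1 = 4 \<and> S1 = {z. z ^ 2 = 1}"
    and "S2 = {1} \<or> d2 = 3 \<and> S2 = {z. z ^ 3 = 1} \<or> d2 = 4 \<and> S2 = {z. z ^ 2 = 1}"
    and "d1 * card S1 = d2 * card S2" "d1 \<in> {3, 4, 6}" "d2 \<in> {3, 4, 6 :: nat}"
    and "\<not> (d1 = 3 \<and> S1 = {z. z ^ 3 = 1} \<and> S2 = {z. z ^ 3 = 1})"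
    and "\<not> (d1 = 4 \<and> S1 = {z. z ^ 2 = 1} \<and> S2 = {z. z ^ 2 = 1})"
  shows "S1 = {1} \<and> S2 = {1}"
proof -
  have c: "card {z::complex. z ^ 3 = 1} = 3" "card {z::complex. z ^ 2 = 1} = 2" "card {1::complex} = 1"
    using card_roots_unity_eq[of 3] card_roots_unity_eq[of 2] by simp_all
  from assms(1,2) show ?thesis
  proof (elim disjE conjE)
    assume "S1 = {1}" "S2 = {1}"
    then show ?thesis by blast
  qed (insert assms(3-7) c, elim insertE emptyE; simp only: refl HOL.simp_thms; simp)+
qed

text \<open>
  With \<open>T1\<close>, \<open>T2\<close> the translation subgroups and \<open>K\<close> their intersection, the indices of \<open>K\<close> satisfy
  \<open>d1 * [T1 : K] = d2 * [T2 : K]\<close>, where \<open>[Ti : K]\<close> is \<open>1\<close>, or \<open>3\<close> if \<open>di = 3\<close>, or \<open>2\<close> if \<open>di = 4\<close>.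
  Hence \<open>d1 = d2\<close>, and a nontrivial index forces an exceptional group.
\<close>

lemma translation_set_eq:
  assumes A: "affine_group G \<Lambda>1 \<rho>1 \<beta>1" and B: "affine_group G \<Lambda>2 \<rho>2 \<beta>2"
    and img1: "\<rho>1 ` carrier G = {z. z ^ d1 = 1}" "d1 \<in> {3, 4, 6}"
    and img2: "\<rho>2 ` carrier G = {z. z ^ d2 = 1}" "d2 \<in> {3, 4, 6}"
    and exc: "\<not> exceptional G"
  shows "{g \<in> carrier G. \<rho>1 g = 1} = {g \<in> carrier G. \<rho>2 g = 1}"
proof -
  interpret A: affine_group G \<Lambda>1 \<rho>1 \<beta>1 by (rule A)
  interpret B: affine_group G \<Lambda>2 \<rho>2 \<beta>2 by (rule B)
  interpret AB: affine_pair G \<Lambda>1 \<rho>1 \<beta>1 \<Lambda>2 \<rho>2 \<beta>2 ..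
  interpret BA: affine_pair G \<Lambda>2 \<rho>2 \<beta>2 \<Lambda>1 \<rho>1 \<beta>1 ..
  let ?T1 = "{g \<in> carrier G. \<rho>1 g = 1}" and ?T2 = "{g \<in> carrier G. \<rho>2 g = 1}"
  note opt1 = AB.chi2_translations[OF img1] and opt2 = BA.chi2_translations[OF img2]
  have K: "?T2 \<inter> ?T1 = ?T1 \<inter> ?T2" by blast
  have "card (?T1 \<inter> ?T2) > 0" using AB.one_mem_K A.finite_carrier card_gt_0_iff by fastforce
  moreover have "d1 * (card (\<rho>2 ` ?T1) * card (?T1 \<inter> ?T2)) = d2 * (card (\<rho>1 ` ?T2) * card (?T1 \<inter> ?T2))"
    using AB.card_G[OF img1(1)] BA.card_G[OF img2(1)] AB.card_T1 BA.card_T1 img1(2) img2(2) K by auto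
  ultimately have eq: "d1 * card (\<rho>2 ` ?T1) = d2 * card (\<rho>1 ` ?T2)" by simp
  have "\<not> (d1 = 3 \<and> \<rho>2 ` ?T1 = {z. z ^ 3 = 1} \<and> \<rho>1 ` ?T2 = {z. z ^ 3 = 1})"
    using AB.exceptional_cubic img1(1) exc by blast
  moreover have "\<not> (d1 = 4 \<and> \<rho>2 ` ?T1 = {z. z ^ 2 = 1} \<and> \<rho>1 ` ?T2 = {z. z ^ 2 = 1})"
    using AB.exceptional_quartic img1(1) exc by blast
  ultimately have "\<rho>2 ` ?T1 = {1} \<and> \<rho>1 ` ?T2 = {1}"
    by (rule index_equation[OF opt1 opt2 eq img1(2) img2(2)])
  then show ?thesis by blast
qed

text \<open>The composition law and the identity translate into the axioms by uniqueness of affine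
  lifts; the multipliers preserve the lattice because the affine maps descend to the
  quotient.\<close>

lemma faithful_action_affine:
  assumes G: "group G" "finite (carrier G)" and lat: "complex_lattice \<Lambda>"
    and act: "faithful_holomorphic_action G (elliptic_curve \<Lambda>) \<phi>"
  obtains \<rho> \<beta> where "affine_group G \<Lambda> \<rho> \<beta>"
    "\<And>g z. g \<in> carrier G \<Longrightarrow> \<phi> g (coset \<Lambda> z) = coset \<Lambda> (\<rho> g * z + \<beta> g)"
proof -
  interpret group G by fact
  interpret curve_lattice \<Lambda> by unfold_locales fact
  have hol: "\<And>g. g \<in> carrier G \<Longrightarrow> holomorphic_map (elliptic_curve \<Lambda>) (elliptic_curve \<Lambda>) (\<phi> g)"
    and ga: "group_action G (range (coset \<Lambda>)) \<phi>" and fa: "faithful_action G (range (coset \<Lambda>)) \<phi>"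
    using act by (auto simp: faithful_holomorphic_action_def holomorphic_action_def)
  interpret act: group_action G "range (coset \<Lambda>)" \<phi> by fact
  have "\<forall>g\<in>carrier G. \<exists>\<alpha> \<beta>. \<forall>z. \<phi> g (coset \<Lambda> z) = coset \<Lambda> (\<alpha> * z + \<beta>)"
    using affine_lift[OF hol] by metis
  then obtain \<rho> \<beta> where lift: "\<And>g z. g \<in> carrier G \<Longrightarrow> \<phi> g (coset \<Lambda> z) = coset \<Lambda> (\<rho> g * z + \<beta> g)"
    by metis
  have mult: "coset \<Lambda> (\<rho> (g \<otimes>\<^bsub>G\<^esub> h) * z + \<beta> (g \<otimes>\<^bsub>G\<^esub> h)) = coset \<Lambda> ((\<rho> g * \<rho> h) * z + (\<rho> g * \<beta> h + \<beta> g))"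
    if "g \<in> carrier G" "h \<in> carrier G" for g h z
  proof -
    have "\<phi> (g \<otimes>\<^bsub>G\<^esub> h) (coset \<Lambda> z) = \<phi> g (\<phi> h (coset \<Lambda> z))"
      using that by (intro act.composition_rule) auto
    then show ?thesis using that by (simp add: lift algebra_simps)
  qed
  have one: "coset \<Lambda> (\<rho> \<one>\<^bsub>G\<^esub> * z + \<beta> \<one>\<^bsub>G\<^esub>) = coset \<Lambda> (1 * z + 0)" for z
    using lift[OF one_closed, of z] by (simp flip: act.id_eq_one)
  have "affine_group G \<Lambda> \<rho> \<beta>"
  proof
    show "finite (carrier G)" by fact
    show "\<rho> (g \<otimes>\<^bsub>G\<^esub> h) = \<rho> g * \<rho> h" "\<beta> (g \<otimes>\<^bsub>G\<^esub> h) - (\<rho> g * \<beta> h + \<beta> g) \<in> \<Lambda>"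
      if "g \<in> carrier G" "h \<in> carrier G" for g h
      using affine_lift_unique[OF mult[OF that]] by blast+
    show "\<rho> \<one>\<^bsub>G\<^esub> = 1" using affine_lift_unique(1)[OF one] .
    show "\<rho> g * l \<in> \<Lambda>" if "g \<in> carrier G" "l \<in> \<Lambda>" for g l
    proof -
      have "coset \<Lambda> (\<rho> g * (0 + l) + \<beta> g) = coset \<Lambda> (\<rho> g * 0 + \<beta> g)"
        using lift[OF that(1), of "0 + l"] lift[OF that(1), of 0] that(2) by (simp only: coset_add)
      then show ?thesis by (simp add: coset_eq_iff)
    qed
    show "g = \<one>\<^bsub>G\<^esub>" if g: "g \<in> carrier G" "\<rho> g = 1" "\<beta> g \<in> \<Lambda>" for g
    proof -
      \<comment> \<open>Outside the curve \<open>\<phi> h\<close> takes the default value, so two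
        group elements that agree on the curve act by the same function and injectivity of the
        action applies.\<close>
      have ext: "\<phi> h \<in> extensional (range (coset \<Lambda>))" if "h \<in> carrier G" for h
        using that act.bij_prop0 act.group_hom hom_in_carrier[of \<phi> G "BijGroup (range (coset \<Lambda>))"]
        by (auto simp: group_hom_def group_hom_axioms_def BijGroup_def Bij_def hom_def)
      have "\<phi> g = \<phi> \<one>\<^bsub>G\<^esub>"
      proof (rule extensionalityI[OF ext[OF g(1)] ext[OF one_closed]])
        fix x assume "x \<in> range (coset \<Lambda>)"
        then show "\<phi> g x = \<phi> \<one>\<^bsub>G\<^esub> x"
          using lift[OF g(1)] g by (auto simp flip: act.id_eq_one)
      qed
      then show ?thesis
        using fa g(1) by (auto simp: faithful_action_def faithful_action_axioms_def dest: inj_onD)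
    qed
  qed
  then show ?thesis using that lift by blast
qed

section \<open>Holomorphic functions of several variables\<close>

definition cdiff_on :: "(complex ^ 'n::finite \<Rightarrow> complex) \<Rightarrow> (complex ^ 'n) set \<Rightarrow> bool" where
  "cdiff_on f U \<longleftrightarrow>
     (\<forall>z \<in> U. \<exists>D. (f has_derivative D) (at z) \<and> (\<forall>c w. D (c *s w) = c * D w))"

lemma hol_complex_affine_space: "hol complex_affine_space U = {f. cdiff_on f U}"
  by (simp add: complex_affine_space_def cdiff_on_def)

lemma cdiff_on_subset: "cdiff_on f U \<Longrightarrow> V \<subseteq> U \<Longrightarrow> cdiff_on f V"
  by (auto simp: cdiff_on_def)

lemma cdiff_on_const [intro]: "cdiff_on (\<lambda>z. c) U"
  unfolding cdiff_on_def
proof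
  fix z :: "complex ^ 'a"
  show "\<exists>D. ((\<lambda>z. c) has_derivative D) (at z) \<and> (\<forall>c w. D (c *s w) = c * D w)"
    by (rule exI[of _ "\<lambda>_. 0"]) auto
qed

lemma cdiff_on_component: "cdiff_on (\<lambda>z. z $ i) U"
  unfolding cdiff_on_def
proof
  fix z :: "complex ^ 'a"
  show "\<exists>D. ((\<lambda>z. z $ i) has_derivative D) (at z) \<and> (\<forall>c w. D (c *s w) = c * D w)"
    by (rule exI[of _ "\<lambda>w. w $ i"]) (auto intro: bounded_linear_imp_has_derivative bounded_linear_vec_nth)
qed

lemma cdiff_on_add: "cdiff_on f U \<Longrightarrow> cdiff_on g U \<Longrightarrow> cdiff_on (\<lambda>z. f z + g z) U"
  unfolding cdiff_on_def
proof safe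
  fix z assume "z \<in> U" and fg: "\<forall>z\<in>U. \<exists>D. (f has_derivative D) (at z) \<and> (\<forall>c w. D (c *s w) = c * D w)"
    "\<forall>z\<in>U. \<exists>D. (g has_derivative D) (at z) \<and> (\<forall>c w. D (c *s w) = c * D w)"
  then obtain D D' where "(f has_derivative D) (at z)" "\<forall>c w. D (c *s w) = c * D w"
    "(g has_derivative D') (at z)" "\<forall>c w. D' (c *s w) = c * D' w" by meson
  then show "\<exists>D. ((\<lambda>z. f z + g z) has_derivative D) (at z) \<and> (\<forall>c w. D (c *s w) = c * D w)"
    by (intro exI[of _ "\<lambda>w. D w + D' w"]) (auto intro: has_derivative_add simp: distrib_left)
qed

lemma cdiff_on_mult: "cdiff_on f U \<Longrightarrow> cdiff_on g U \<Longrightarrow> cdiff_on (\<lambda>z. f z * g z) U"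
  unfolding cdiff_on_def
proof safe
  fix z assume "z \<in> U" and fg: "\<forall>z\<in>U. \<exists>D. (f has_derivative D) (at z) \<and> (\<forall>c w. D (c *s w) = c * D w)"
    "\<forall>z\<in>U. \<exists>D. (g has_derivative D) (at z) \<and> (\<forall>c w. D (c *s w) = c * D w)"
  then obtain D D' where "(f has_derivative D) (at z)" "\<forall>c w. D (c *s w) = c * D w"
    "(g has_derivative D') (at z)" "\<forall>c w. D' (c *s w) = c * D' w" by meson
  then show "\<exists>D. ((\<lambda>z. f z * g z) has_derivative D) (at z) \<and> (\<forall>c w. D (c *s w) = c * D w)"
    using has_derivative_mult[of f D z UNIV g D']
    by (intro exI[of _ "\<lambda>w. f z * D' w + D w * g z"] conjI) (simp_all add: algebra_simps)
qed

lemma cdiff_on_minus: "cdiff_on f U \<Longrightarrow> cdiff_on (\<lambda>z. - f z) U"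
  using cdiff_on_mult[OF cdiff_on_const[of "-1"]] by simp

lemma cdiff_on_diff: "cdiff_on f U \<Longrightarrow> cdiff_on g U \<Longrightarrow> cdiff_on (\<lambda>z. f z - g z) U"
  using cdiff_on_add[OF _ cdiff_on_minus] by fastforce

lemma cdiff_on_local:
  assumes "\<And>z. z \<in> U \<Longrightarrow> \<exists>V g. open V \<and> z \<in> V \<and> cdiff_on g V \<and> (\<forall>w\<in>V. f w = g w)"
  shows "cdiff_on f U"
  unfolding cdiff_on_def
proof
  fix z assume "z \<in> U"
  then obtain V g where V: "open V" "z \<in> V" "cdiff_on g V" "\<forall>w\<in>V. f w = g w" using assms by blast
  then obtain D where D: "(g has_derivative D) (at z)" "\<forall>c w. D (c *s w) = c * D w"
    unfolding cdiff_on_def by blast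
  have "(f has_derivative D) (at z)"
    using has_derivative_transform_within_open[OF D(1) V(1,2)] V(4) by simp
  then show "\<exists>D. (f has_derivative D) (at z) \<and> (\<forall>c w. D (c *s w) = c * D w)" using D by blast
qed

lemma cdiff_on_cong: "open U \<Longrightarrow> cdiff_on g U \<Longrightarrow> (\<And>z. z \<in> U \<Longrightarrow> f z = g z) \<Longrightarrow> cdiff_on f U"
  by (rule cdiff_on_local) blast

lemma cdiff_on_compose:
  assumes f: "cdiff_on f U" and A: "\<And>z. z \<in> V \<Longrightarrow> A z \<in> U"
    and D: "\<And>z. (A has_derivative D) (at z)" "\<And>c w. D (c *s w) = c *s D w"
  shows "cdiff_on (\<lambda>z. f (A z)) V"
  unfolding cdiff_on_def
proof
  fix z assume "z \<in> V"
  then obtain E where E: "(f has_derivative E) (at (A z))" "\<forall>c w. E (c *s w) = c * E w"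
    using f A unfolding cdiff_on_def by blast
  have "((\<lambda>z. f (A z)) has_derivative (\<lambda>w. E (D w))) (at z)"
    by (rule has_derivative_compose[OF D(1) E(1)])
  then show "\<exists>D. ((\<lambda>z. f (A z)) has_derivative D) (at z) \<and> (\<forall>c w. D (c *s w) = c * D w)"
    using E(2) D(2) by auto
qed

lemma cdiff_on_imp_continuous_on: "cdiff_on f U \<Longrightarrow> continuous_on U f"
  unfolding cdiff_on_def
  by (meson continuous_at_imp_continuous_on has_derivative_continuous)

lemma norm_vector_scalar_mult: "norm (c *s v) = norm c * norm (v :: complex ^ 'n::finite)"
  by (simp add: norm_vec_def norm_mult L2_set_right_distrib)

lemma bounded_linear_vector_scalar_mult: "bounded_linear (\<lambda>t. t *s (v :: complex ^ 'n::finite))"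
  by (rule linear_conv_bounded_linear[THEN iffD1])
    (auto simp: vec_eq_iff algebra_simps intro!: linearI)

lemma slice_has_field_derivative:
  fixes f :: "complex ^ 'n::finite \<Rightarrow> complex"
  assumes "(f has_derivative D) (at (z + t *s v))" "\<And>c w. D (c *s w) = c * D w"
  shows "((\<lambda>t. f (z + t *s v)) has_field_derivative D v) (at t)"
proof -
  have "((\<lambda>t. t *s v) has_derivative (\<lambda>h. h *s v)) (at t)"
    by (rule bounded_linear_imp_has_derivative[OF bounded_linear_vector_scalar_mult])
  then have "((\<lambda>t. z + t *s v) has_derivative (\<lambda>h. h *s v)) (at t)"
    using has_derivative_add[OF has_derivative_const[of z]] by fastforce
  from has_derivative_compose[OF this assms(1)]
  have "((\<lambda>t. f (z + t *s v)) has_derivative (\<lambda>h. D (h *s v))) (at t)" by simp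
  moreover have "(\<lambda>h. D (h *s v)) = (*) (D v)" using assms(2) by (simp add: fun_eq_iff mult.commute)
  ultimately show ?thesis by (simp add: has_field_derivative_def)
qed

lemma slice_holomorphic:
  fixes f :: "complex ^ 'n::finite \<Rightarrow> complex"
  assumes "cdiff_on f U" "\<And>t. t \<in> S \<Longrightarrow> z + t *s v \<in> U"
  shows "(\<lambda>t. f (z + t *s v)) holomorphic_on S"
  unfolding holomorphic_on_def
proof
  fix t assume "t \<in> S"
  then obtain D where "(f has_derivative D) (at (z + t *s v))" "\<And>c w. D (c *s w) = c * D w"
    using assms unfolding cdiff_on_def by blast
  from slice_has_field_derivative[OF this]
  show "(\<lambda>t. f (z + t *s v)) field_differentiable at t within S"
    by (meson field_differentiable_at_within field_differentiable_def)
qed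

text \<open>Cauchy's inequality on circles of radius \<open>r / 4\<close> around points of the half
  disc bounds the second derivative by \<open>2 * M / (r / 4)^2\<close>, whence the factor
  32.\<close>

lemma taylor_estimate:
  assumes hol: "f holomorphic_on ball 0 r" and M: "\<And>t. t \<in> ball 0 r \<Longrightarrow> norm (f t) \<le> M"
    and r: "r > 0" and t: "norm t \<le> r / 2"
  shows "norm (f t - f 0 - deriv f 0 * t) \<le> 32 * M / r\<^sup>2 * (norm t)\<^sup>2"
proof -
  have "norm (f t - (\<Sum>i\<le>1. (deriv ^^ i) f 0 * (t - 0) ^ i / fact i))
      \<le> (fact 2 * M / (r/4)^2) * norm (t - 0) ^ (Suc 1) / fact 1"
  proof (rule complex_Taylor[where f = "\<lambda>i. (deriv ^^ i) f" and S = "cball 0 (r/2)", simplified funpow_0])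
    show "((deriv ^^ i) f has_field_derivative (deriv ^^ Suc i) f x) (at x within cball 0 (r/2))"
      if x: "x \<in> cball 0 (r/2)" for i x
    proof -
      have "x \<in> ball 0 r" using x r by auto
      then have "((deriv ^^ i) f has_field_derivative deriv ((deriv ^^ i) f) x) (at x)"
        by (intro holomorphic_derivI[OF holomorphic_higher_deriv[OF hol]]) auto
      then show ?thesis by (simp add: has_field_derivative_at_within)
    qed
    show "norm ((deriv ^^ Suc 1) f x) \<le> fact 2 * M / (r/4)^2" if x: "x \<in> cball 0 (r/2)" for x
    proof -
      have sub: "cball x (r/4) \<subseteq> ball 0 r"
      proof
        fix y assume "y \<in> cball x (r/4)"
        then show "y \<in> ball 0 r" using x r norm_triangle_ineq[of x "y - x"] by (auto simp: dist_norm norm_minus_commute)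
      qed
      have "norm ((deriv ^^ 2) f x) \<le> fact 2 * M / (r/4)^2"
      proof (rule Cauchy_inequality)
        show "f holomorphic_on ball x (r/4)" using sub by (intro holomorphic_on_subset[OF hol]) auto
        show "continuous_on (cball x (r/4)) f" using sub
          by (intro holomorphic_on_imp_continuous_on holomorphic_on_subset[OF hol])
        fix y assume "norm (x - y) = r / 4"
        then show "norm (f y) \<le> M" using sub by (intro M) (auto simp: dist_norm)
      qed (use r in auto)
      then show ?thesis by (simp add: numeral_2_eq_2)
    qed
  qed (use r t in auto)
  then show ?thesis by (simp add: power2_eq_square field_simps)
qed

text \<open>Restrict to the complex line through \<open>z\<close> in direction \<open>w\<close>,
  normalized to unit speed. The constant is the same for all directions.\<close>

lemma cdiff_taylor_estimate:
  fixes f :: "complex ^ 'n::finite \<Rightarrow> complex"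
  assumes f: "cdiff_on f U" and sub: "ball z r \<subseteq> U" and r: "r > 0"
    and M: "\<And>u. u \<in> ball z r \<Longrightarrow> norm (f u) \<le> M"
    and D: "(f has_derivative D) (at z)" "\<And>c w. D (c *s w) = c * D w"
    and w: "norm w \<le> r / 2"
  shows "norm (f (z + w) - f z - D w) \<le> 32 * M / r\<^sup>2 * (norm w)\<^sup>2"
proof (cases "w = 0")
  case True
  have "D 0 = 0" using D(2)[of 0 0] by simp
  then show ?thesis using True by simp
next
  case False
  define v where "v = of_real (1 / norm w) *s w"
  have nv: "norm v = 1" using False by (simp add: v_def norm_vector_scalar_mult norm_divide)
  have wv: "of_real (norm w) *s v = w"
    using False by (simp add: v_def vec_eq_iff field_simps)
  have in_ball: "z + t *s v \<in> ball z r" if "t \<in> ball 0 r" for t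
    using that by (simp add: dist_norm norm_vector_scalar_mult nv)
  let ?p = "\<lambda>t. f (z + t *s v)"
  have "norm (?p (of_real (norm w)) - ?p 0 - deriv ?p 0 * of_real (norm w))
      \<le> 32 * M / r\<^sup>2 * (norm (of_real (norm w) :: complex))\<^sup>2"
  proof (rule taylor_estimate)
    show "?p holomorphic_on ball 0 r"
      by (rule slice_holomorphic[OF f]) (use in_ball sub in blast)
  qed (use M in_ball r w in auto)
  moreover have "deriv ?p 0 = D v"
    by (rule DERIV_imp_deriv, rule slice_has_field_derivative) (use D in auto)
  moreover have "D w = of_real (norm w) * D v" using D(2) wv by metis
  ultimately show ?thesis by (simp add: wv mult.commute)
qed

text \<open>
  The second order Taylor remainder in direction \<open>w\<close> is \<open>O(|w|^2)\<close>, uniformly along the line in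
  direction \<open>v\<close>, and holomorphic in the line parameter; Cauchy's inequality then bounds its
  derivative by \<open>O(|w|^2)\<close>.
\<close>

lemma cdiff_on_partial_derivative:
  fixes v :: "complex ^ 'n::finite"
  assumes U: "open U" and f: "cdiff_on f U"
  shows "cdiff_on (\<lambda>z. deriv (\<lambda>t. f (z + t *s v)) 0) U"
  unfolding cdiff_on_def
proof
  let ?g = "\<lambda>z. deriv (\<lambda>t. f (z + t *s v)) 0"
  fix z0 assume "z0 \<in> U"
  then obtain R where R: "R > 0" "cball z0 R \<subseteq> U" using U open_contains_cball by metis
  \<comment> \<open>Base points will be taken within \<open>\<rho>\<close> of \<open>z0\<close>.
    Their balls of radius \<open>2 * \<rho>\<close> then stay inside the compact ball of radius
    \<open>4 * \<rho>\<close>, where \<open>f\<close> is bounded.\<close>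
  define \<rho> where "\<rho> = R / 4"
  have \<rho>: "\<rho> > 0" "cball z0 (4 * \<rho>) \<subseteq> U" using R by (auto simp: \<rho>_def)
  define \<delta> where "\<delta> = \<rho> / (norm v + 1)"
  have \<delta>: "\<delta> > 0" "\<delta> * norm v \<le> \<rho>"
    using \<rho> by (auto simp: \<delta>_def field_simps add_pos_nonneg)
  have "compact (f ` cball z0 (4 * \<rho>))"
    using \<rho> by (intro compact_continuous_image cdiff_on_imp_continuous_on cdiff_on_subset[OF f]) auto
  then obtain M where M: "\<And>u. u \<in> cball z0 (4 * \<rho>) \<Longrightarrow> norm (f u) \<le> M"
    using compact_imp_bounded bounded_iff by (metis imageI)
  obtain D where D: "\<And>z. z \<in> U \<Longrightarrow> (f has_derivative D z) (at z)"
      "\<And>z c w. z \<in> U \<Longrightarrow> D z (c *s w) = c * D z w"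
    using f unfolding cdiff_on_def by metis
  have near: "z0 + t *s v \<in> cball z0 \<rho>" if "t \<in> ball 0 \<delta>" for t
  proof -
    have "norm t * norm v \<le> \<delta> * norm v" using that by (intro mult_right_mono) auto
    then show ?thesis using \<delta> by (simp add: dist_norm norm_vector_scalar_mult)
  qed
  have inU: "z0 + t *s v + w \<in> U" if "t \<in> ball 0 \<delta>" "norm w \<le> \<rho>" for t w
  proof -
    have "dist z0 (z0 + (t *s v + w)) = norm (t *s v + w)"
      by (metis add_diff_cancel_left' dist_commute dist_norm)
    moreover have "norm (t *s v) \<le> \<rho>" using near[OF that(1)] by (simp add: dist_norm)
    ultimately have "dist z0 (z0 + t *s v + w) \<le> \<rho> + \<rho>"
      using that(2) norm_triangle_ineq[of "t *s v" w] by (simp add: add.assoc)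
    then show ?thesis using \<rho> by auto
  qed
  have inU0: "z0 + t *s v \<in> U" if "t \<in> ball 0 \<delta>" for t using inU[OF that, of 0] \<rho> by simp
  \<comment> \<open>The Taylor constant for radius \<open>2 * \<rho>\<close>, independent of the
    base point on the line and of the direction.\<close>
  define C where "C = 32 * M / (2 * \<rho>)\<^sup>2"
  define E where "E w t = D (z0 + t *s v) w" for w t
  have est: "norm (f (z0 + t *s v + w) - f (z0 + t *s v) - E w t) \<le> C * (norm w)\<^sup>2"
    if t: "t \<in> ball 0 \<delta>" and w: "norm w \<le> \<rho>" for t w
    unfolding C_def E_def
  proof (rule cdiff_taylor_estimate[OF f])
    have sub: "ball (z0 + t *s v) (2 * \<rho>) \<subseteq> cball z0 (4 * \<rho>)"
    proof
      fix y assume "y \<in> ball (z0 + t *s v) (2 * \<rho>)"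
      then show "y \<in> cball z0 (4 * \<rho>)"
        using near[OF t] dist_triangle[of z0 y "z0 + t *s v"] \<rho>(1) unfolding mem_ball mem_cball by linarith
    qed
    then show "ball (z0 + t *s v) (2 * \<rho>) \<subseteq> U" using \<rho> by blast
    show "\<And>u. u \<in> ball (z0 + t *s v) (2 * \<rho>) \<Longrightarrow> norm (f u) \<le> M" using sub M by blast
  qed (use \<rho> w D inU0[OF t] in auto)
  have holf: "(\<lambda>t. f (z0 + t *s v + w)) holomorphic_on ball 0 \<delta>" if "norm w \<le> \<rho>" for w
    using slice_holomorphic[OF f, of "ball 0 \<delta>" "z0 + w" v] inU[OF _ that] by (simp add: algebra_simps)
  \<comment> \<open>The function \<open>E w\<close> is a locally uniform limit of difference
    quotients with step \<open>w / (n + 1)\<close>; the quadratic remainder gives the rate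
    \<open>1 / (n + 1)\<close>.\<close>
  have holE_small: "E w holomorphic_on ball 0 \<delta>" if w: "norm w \<le> \<rho>" for w
  proof (rule holomorphic_uniform_sequence)
    let ?w = "\<lambda>n. (1 / of_nat (Suc n)) *s w"
    let ?q = "\<lambda>n t. of_nat (Suc n) * (f (z0 + t *s v + ?w n) - f (z0 + t *s v))"
    have nw: "norm (?w n) = norm w / real (Suc n)" for n
      by (simp add: norm_vector_scalar_mult norm_divide del: of_nat_Suc)
    have wle: "norm (?w n) \<le> \<rho>" for n
    proof -
      have "norm w / real (Suc n) \<le> norm w / 1" by (intro divide_left_mono) auto
      then show ?thesis using w nw[of n] by simp
    qed
    show "?q n holomorphic_on ball 0 \<delta>" for n
      using holf[OF wle[of n]] holf[of 0] \<rho> by (intro holomorphic_intros) auto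
    have qE: "norm (?q n t - E w t) \<le> C * (norm w)\<^sup>2 / real (Suc n)" if t: "t \<in> ball 0 \<delta>" for n t
    proof -
      have "E (?w n) t = 1 / of_nat (Suc n) * E w t"
        unfolding E_def by (rule D(2)) (rule inU0[OF t])
      then have "?q n t - E w t = of_nat (Suc n) * (f (z0 + t *s v + ?w n) - f (z0 + t *s v) - E (?w n) t)"
        by (simp add: field_simps del: of_nat_Suc)
      then have "norm (?q n t - E w t) \<le> real (Suc n) * (C * (norm (?w n))\<^sup>2)"
        using est[OF t wle[of n]] by (simp add: norm_mult mult_left_mono del: of_nat_Suc)
      also have "\<dots> = C * (norm w)\<^sup>2 / real (Suc n)"
        unfolding nw by (simp add: power2_eq_square field_simps del: of_nat_Suc)
      finally show ?thesis .
    qed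
    fix t :: complex assume "t \<in> ball 0 \<delta>"
    then obtain d where d: "d > 0" "cball t d \<subseteq> ball 0 \<delta>" using open_contains_cball open_ball by metis
    have "uniform_limit (cball t d) ?q (E w) sequentially"
    proof (rule uniform_limitI)
      fix e :: real assume e: "e > 0"
      have "(\<lambda>n. C * (norm w)\<^sup>2 / real (Suc n)) \<longlonglongrightarrow> 0"
        using LIMSEQ_Suc[OF lim_const_over_n[of "C * (norm w)\<^sup>2"]] by simp
      then have "\<forall>\<^sub>F n in sequentially. C * (norm w)\<^sup>2 / real (Suc n) < e"
        using e by (rule order_tendstoD)
      then show "\<forall>\<^sub>F n in sequentially. \<forall>x\<in>cball t d. dist (?q n x) (E w x) < e"
      proof eventually_elim
        case (elim n)
        show ?case using qE[of _ n] d(2) elim by (fastforce simp: dist_norm)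
      qed
    qed
    then show "\<exists>d>0. cball t d \<subseteq> ball 0 \<delta> \<and> uniform_limit (cball t d) ?q (E w) sequentially"
      using d by blast
  qed auto
  \<comment> \<open>Complex homogeneity in \<open>w\<close> reduces an arbitrary vector to a short
    one; \<open>s\<close> is the scaling factor.\<close>
  have holE: "E w holomorphic_on ball 0 \<delta>" for w
  proof -
    define s :: complex where "s = of_real (\<rho> / (norm w + 1))"
    have ns: "norm s = \<rho> / (norm w + 1)"
      unfolding s_def norm_of_real using \<rho> by (intro abs_of_nonneg divide_nonneg_nonneg) auto
    have "norm s > 0" unfolding ns using \<rho>(1) norm_ge_zero[of w] by (intro divide_pos_pos) linarith+
    then have s: "s \<noteq> 0" by auto
    from ns have "norm (s *s w) = \<rho> * (norm w / (norm w + 1))"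
      by (simp add: norm_vector_scalar_mult)
    also have "\<dots> \<le> \<rho> * 1" using \<rho>
      by (intro mult_left_mono) (simp_all, smt (verit) divide_le_eq_1 norm_ge_zero)
    finally have "norm (s *s w) \<le> \<rho>" by simp
    then have "(\<lambda>t. (1 / s) * E (s *s w) t) holomorphic_on ball 0 \<delta>"
      by (intro holomorphic_intros holE_small)
    then show ?thesis
      by (rule holomorphic_transform) (use s D(2) inU0 in \<open>auto simp: E_def\<close>)
  qed
  \<comment> \<open>The mixed second derivative in the directions \<open>v\<close> and
    \<open>w\<close>: the expected derivative of \<open>?g\<close>, applied to
    \<open>w\<close>.\<close>
  define L where "L w = deriv (E w) 0" for w
  have dE: "E w field_differentiable (at 0)" for w
    using holE \<delta> by (intro holomorphic_on_imp_differentiable_at[of _ "ball 0 \<delta>"]) auto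
  have Eadd: "E (w + w') t = E w t + E w' t" if "t \<in> ball 0 \<delta>" for w w' t
    unfolding E_def using has_derivative_bounded_linear[OF D(1)[OF inU0[OF that]]]
    by (simp add: bounded_linear.linear linear_add)
  have ev: "\<forall>\<^sub>F t in nhds 0. t \<in> ball 0 \<delta>" using \<delta> by (intro eventually_nhds_in_open) auto
  have Ladd: "L (w + w') = L w + L w'" for w w'
  proof -
    have "deriv (E (w + w')) 0 = deriv (\<lambda>t. E w t + E w' t) 0"
      by (rule deriv_cong_ev) (use Eadd in \<open>auto intro!: eventually_mono[OF ev]\<close>)
    then show ?thesis unfolding L_def by (simp add: deriv_add dE)
  qed
  have Lscale: "L (c *s w) = c * L w" for c w
  proof -
    have "deriv (E (c *s w)) 0 = deriv (\<lambda>t. c * E w t) 0"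
      by (rule deriv_cong_ev) (use D(2) inU0 in \<open>auto simp: E_def intro!: eventually_mono[OF ev]\<close>)
    then show ?thesis unfolding L_def by (simp add: deriv_cmult dE)
  qed
  have "linear L"
  proof (rule linearI)
    fix r :: real and w :: "complex ^ 'n"
    have "r *\<^sub>R w = of_real r *s w"
      unfolding vec_eq_iff vector_scaleR_component vector_smult_component
      by (simp add: scaleR_conv_of_real)
    then show "L (r *\<^sub>R w) = r *\<^sub>R L w" by (simp add: Lscale scaleR_conv_of_real)
  qed (rule Ladd)
  then have bl: "bounded_linear L" by (simp add: linear_conv_bounded_linear)
  have dif: "norm (?g (z0 + w) - ?g z0 - L w) \<le> C * (norm w)\<^sup>2 / (\<delta> / 2)" if w: "norm w \<le> \<rho>" for w
  proof -
    let ?R = "\<lambda>t. f (z0 + t *s v + w) - f (z0 + t *s v) - E w t"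
    have holR: "?R holomorphic_on ball 0 \<delta>"
      using holf[OF w] holf[of 0] \<rho> holE by (intro holomorphic_intros) auto
    have "norm ((deriv ^^ 1) ?R 0) \<le> fact 1 * (C * (norm w)\<^sup>2) / (\<delta> / 2) ^ 1"
    proof (rule Cauchy_inequality)
      show "?R holomorphic_on ball 0 (\<delta> / 2)" by (rule holomorphic_on_subset[OF holR]) (use \<delta> in auto)
      show "continuous_on (cball 0 (\<delta> / 2)) ?R"
        by (intro holomorphic_on_imp_continuous_on holomorphic_on_subset[OF holR]) (use \<delta> in auto)
      fix t :: complex assume "norm (0 - t) = \<delta> / 2"
      then show "norm (?R t) \<le> C * (norm w)\<^sup>2" using \<delta> by (intro est w) auto
    qed (use \<delta> in auto)
    moreover have "deriv ?R 0 = ?g (z0 + w) - ?g z0 - L w"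
    proof -
      have fd: "(\<lambda>t. f (z0 + t *s v + w)) field_differentiable (at 0)"
        "(\<lambda>t. f (z0 + t *s v)) field_differentiable (at 0)"
        using holf[OF w] holf[of 0] \<rho> \<delta>
        by (auto intro!: holomorphic_on_imp_differentiable_at[of _ "ball 0 \<delta>"])
      then have "deriv ?R 0 = deriv (\<lambda>t. f (z0 + t *s v + w)) 0 - ?g z0 - L w"
        unfolding L_def by (simp add: deriv_diff dE field_differentiable_diff)
      then show ?thesis by (simp add: algebra_simps)
    qed
    ultimately show ?thesis by simp
  qed
  have "(?g has_derivative L) (at z0)"
  proof (rule has_derivativeI_sandwich[OF \<rho>(1) bl])
    let ?H = "\<lambda>y. C / (\<delta> / 2) * norm (y - z0)"
    have "(?H \<longlongrightarrow> C / (\<delta> / 2) * norm (z0 - z0)) (at z0)" by (intro tendsto_intros)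
    then show "(?H \<longlongrightarrow> 0) (at z0)" by simp
    fix y assume y: "y \<noteq> z0" "dist y z0 < \<rho>"
    have "norm (?g y - ?g z0 - L (y - z0)) \<le> C * (norm (y - z0))\<^sup>2 / (\<delta> / 2)"
      using dif[of "y - z0"] y by (simp add: dist_norm)
    then show "norm (?g y - ?g z0 - L (y - z0)) / norm (y - z0) \<le> ?H y"
      using y by (simp add: divide_le_eq power2_eq_square mult_ac)
  qed
  then show "\<exists>L. (?g has_derivative L) (at z0) \<and> (\<forall>c w. L (c *s w) = c * L w)"
    using Lscale by blast
qed

section \<open>Cohomology of vector fields\<close>

lemma tangent_vectorD:
  assumes v: "tangent_vector X x v" and fg: "f \<in> germs X x" "g \<in> germs X x"
  shows "openin (ctop X) U \<Longrightarrow> x \<in> U \<Longrightarrow> (\<And>y. y \<in> U \<Longrightarrow> f y = g y) \<Longrightarrow> v f = v g"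
    and "v (\<lambda>y. f y + g y) = v f + v g"
    and "v (\<lambda>y. f y * g y) = f x * v g + v f * g x"
    and "v (\<lambda>y. c * f y) = c * v f"
proof -
  note * = v[unfolded tangent_vector_def, THEN conjunct1, rule_format, OF fg]
  note 1 = *[THEN conjunct1, rule_format, OF conjI, OF _ conjI]
  show "openin (ctop X) U \<Longrightarrow> x \<in> U \<Longrightarrow> (\<And>y. y \<in> U \<Longrightarrow> f y = g y) \<Longrightarrow> v f = v g"
    by (rule 1) auto
  show "v (\<lambda>y. f y + g y) = v f + v g" by (rule *[THEN conjunct2, THEN conjunct1])
  show "v (\<lambda>y. f y * g y) = f x * v g + v f * g x" by (rule *[THEN conjunct2, THEN conjunct2])
  show "v (\<lambda>y. c * f y) = c * v f"
    by (rule v[unfolded tangent_vector_def, THEN conjunct2, rule_format, OF fg(1)])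
qed

lemma cohomologousE:
  assumes "((\<U>, \<theta>), (\<V>, \<eta>)) \<in> cohomologous X"
  obtains \<W> r s \<tau> where "(\<U>, \<theta>) \<in> cocycles X" "(\<V>, \<eta>) \<in> cocycles X" "open_cover X \<W>"
    "\<And>W. W \<in> \<W> \<Longrightarrow> r W \<in> \<U> \<and> W \<subseteq> r W \<and> s W \<in> \<V> \<and> W \<subseteq> s W \<and> vector_field X W (\<tau> W)"
    "\<And>W W' x f. W \<in> \<W> \<Longrightarrow> W' \<in> \<W> \<Longrightarrow> x \<in> W \<inter> W' \<Longrightarrow> f \<in> germs X x \<Longrightarrow>
      \<theta> (r W) (r W') x f - \<eta> (s W) (s W') x f = \<tau> W' x f - \<tau> W x f"
proof -
  from assms have *: "(\<U>, \<theta>) \<in> cocycles X \<and> (\<V>, \<eta>) \<in> cocycles X \<and>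
     (\<exists>\<W> r s \<tau>. open_cover X \<W> \<and>
        (\<forall>W \<in> \<W>. r W \<in> \<U> \<and> W \<subseteq> r W \<and> s W \<in> \<V> \<and> W \<subseteq> s W \<and> vector_field X W (\<tau> W)) \<and>
        (\<forall>W \<in> \<W>. \<forall>W' \<in> \<W>. \<forall>x \<in> W \<inter> W'. \<forall>f \<in> germs X x.
           \<theta> (r W) (r W') x f - \<eta> (s W) (s W') x f = \<tau> W' x f - \<tau> W x f))"
    unfolding cohomologous_def mem_Collect_eq prod.case .
  then obtain \<W> r s \<tau> where W: "open_cover X \<W>"
    "\<forall>W \<in> \<W>. r W \<in> \<U> \<and> W \<subseteq> r W \<and> s W \<in> \<V> \<and> W \<subseteq> s W \<and> vector_field X W (\<tau> W)"
    "\<forall>W \<in> \<W>. \<forall>W' \<in> \<W>. \<forall>x \<in> W \<inter> W'. \<forall>f \<in> germs X x.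
           \<theta> (r W) (r W') x f - \<eta> (s W) (s W') x f = \<tau> W' x f - \<tau> W x f"
    by (elim conjE exE)
  show thesis
    by (rule that[OF *[THEN conjunct1] *[THEN conjunct2, THEN conjunct1] W(1) bspec[OF W(2)]
          W(3)[rule_format]])
qed

lemma cohomologousI:
  assumes "(\<U>, \<theta>) \<in> cocycles X" "(\<V>, \<eta>) \<in> cocycles X" "open_cover X \<W>"
    and "\<And>W. W \<in> \<W> \<Longrightarrow> r W \<in> \<U> \<and> W \<subseteq> r W \<and> s W \<in> \<V> \<and> W \<subseteq> s W \<and> vector_field X W (\<tau> W)"
    and "\<And>W W' x f. W \<in> \<W> \<Longrightarrow> W' \<in> \<W> \<Longrightarrow> x \<in> W \<inter> W' \<Longrightarrow> f \<in> germs X x \<Longrightarrow>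
      \<theta> (r W) (r W') x f - \<eta> (s W) (s W') x f = \<tau> W' x f - \<tau> W x f"
  shows "((\<U>, \<theta>), (\<V>, \<eta>)) \<in> cohomologous X"
  unfolding cohomologous_def mem_Collect_eq prod.case
proof (rule conjI[OF assms(1) conjI[OF assms(2)]], rule exI[of _ \<W>], rule exI[of _ r], rule exI[of _ s],
    rule exI[of _ \<tau>], intro conjI)
  show "\<forall>W \<in> \<W>. r W \<in> \<U> \<and> W \<subseteq> r W \<and> s W \<in> \<V> \<and> W \<subseteq> s W \<and> vector_field X W (\<tau> W)"
    by (rule ballI, rule assms(4))
  show "\<forall>W \<in> \<W>. \<forall>W' \<in> \<W>. \<forall>x \<in> W \<inter> W'. \<forall>f \<in> germs X x.
      \<theta> (r W) (r W') x f - \<eta> (s W) (s W') x f = \<tau> W' x f - \<tau> W x f"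
    by (rule ballI, rule ballI, rule ballI, rule ballI, rule assms(5))
qed (fact assms(3))

lemma cocyclesD:
  assumes "(\<U>, \<theta>) \<in> cocycles X"
  shows "open_cover X \<U>"
    and "\<And>U V. U \<in> \<U> \<Longrightarrow> V \<in> \<U> \<Longrightarrow> vector_field X (U \<inter> V) (\<theta> U V)"
    and "\<And>U V W x f. U \<in> \<U> \<Longrightarrow> V \<in> \<U> \<Longrightarrow> W \<in> \<U> \<Longrightarrow> x \<in> U \<inter> V \<inter> W \<Longrightarrow> f \<in> germs X x \<Longrightarrow>
      \<theta> U V x f + \<theta> V W x f = \<theta> U W x f"
    and "U \<in> \<U> \<Longrightarrow> openin (ctop X) U" "U \<in> \<U> \<Longrightarrow> U \<subseteq> topspace (ctop X)"
proof -
  from assms have *: "open_cover X \<U> \<and>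
     (\<forall>U \<in> \<U>. \<forall>V \<in> \<U>. vector_field X (U \<inter> V) (\<theta> U V)) \<and>
     (\<forall>U \<in> \<U>. \<forall>V \<in> \<U>. \<forall>W \<in> \<U>. \<forall>x \<in> U \<inter> V \<inter> W. \<forall>f \<in> germs X x.
        \<theta> U V x f + \<theta> V W x f = \<theta> U W x f)"
    unfolding cocycles_def mem_Collect_eq prod.case .
  show c: "open_cover X \<U>" by (rule *[THEN conjunct1])
  show "\<And>U V. U \<in> \<U> \<Longrightarrow> V \<in> \<U> \<Longrightarrow> vector_field X (U \<inter> V) (\<theta> U V)"
    by (rule *[THEN conjunct2, THEN conjunct1, rule_format])
  show "\<And>U V W x f. U \<in> \<U> \<Longrightarrow> V \<in> \<U> \<Longrightarrow> W \<in> \<U> \<Longrightarrow> x \<in> U \<inter> V \<inter> W \<Longrightarrow> f \<in> germs X x \<Longrightarrow>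
      \<theta> U V x f + \<theta> V W x f = \<theta> U W x f"
    by (rule *[THEN conjunct2, THEN conjunct2, rule_format])
  show "U \<in> \<U> \<Longrightarrow> openin (ctop X) U" using c unfolding open_cover_def by blast
  then show "U \<in> \<U> \<Longrightarrow> U \<subseteq> topspace (ctop X)" by (rule openin_subset)
qed

lemma cocyclesI:
  assumes "open_cover X \<U>"
    and "\<And>U V. U \<in> \<U> \<Longrightarrow> V \<in> \<U> \<Longrightarrow> vector_field X (U \<inter> V) (\<theta> U V)"
    and "\<And>U V W x f. U \<in> \<U> \<Longrightarrow> V \<in> \<U> \<Longrightarrow> W \<in> \<U> \<Longrightarrow> x \<in> U \<inter> V \<inter> W \<Longrightarrow> f \<in> germs X x \<Longrightarrow>
      \<theta> U V x f + \<theta> V W x f = \<theta> U W x f"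
  shows "(\<U>, \<theta>) \<in> cocycles X"
  unfolding cocycles_def mem_Collect_eq prod.case
  by (intro conjI ballI) (fact assms(1), rule assms(2), assumption+, rule assms(3))

text \<open>The closure properties that make vector fields an additive group and the relation on
  cocycles an equivalence. The last one expresses that values outside the open set are
  irrelevant.\<close>

locale sheaf_space =
  fixes X :: "'a cspace"
  assumes hol_zero: "\<And>U. openin (ctop X) U \<Longrightarrow> (\<lambda>_. 0) \<in> hol X U"
    and hol_add: "\<And>U f g. openin (ctop X) U \<Longrightarrow> f \<in> hol X U \<Longrightarrow> g \<in> hol X U \<Longrightarrow> (\<lambda>x. f x + g x) \<in> hol X U"
    and hol_minus: "\<And>U f. openin (ctop X) U \<Longrightarrow> f \<in> hol X U \<Longrightarrow> (\<lambda>x. - f x) \<in> hol X U"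
    and hol_cong: "\<And>U f g. openin (ctop X) U \<Longrightarrow> f \<in> hol X U \<Longrightarrow> (\<And>x. x \<in> U \<Longrightarrow> f x = g x) \<Longrightarrow> g \<in> hol X U"
begin

lemma tangent_vector_zero: "tangent_vector X x (\<lambda>_. 0)"
  by (simp add: tangent_vector_def)

lemma tangent_vector_add:
  assumes v: "tangent_vector X x v" and w: "tangent_vector X x w"
  shows "tangent_vector X x (\<lambda>f. v f + w f)"
  unfolding tangent_vector_def
proof (intro conjI ballI allI impI)
  fix f g U assume fg: "f \<in> germs X x" "g \<in> germs X x"
  note D = tangent_vectorD[OF v fg] tangent_vectorD[OF w fg]
  { assume U: "openin (ctop X) U \<and> x \<in> U \<and> (\<forall>y\<in>U. f y = g y)"
    then have "v f = v g" "w f = w g" by (auto intro: D(1)[of U] D(5)[of U])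
    then show "v f + w f = v g + w g" by simp }
  show "v (\<lambda>y. f y + g y) + w (\<lambda>y. f y + g y) = v f + w f + (v g + w g)"
    unfolding D(2,6) by simp
  show "v (\<lambda>y. f y * g y) + w (\<lambda>y. f y * g y) = f x * (v g + w g) + (v f + w f) * g x"
    unfolding D(3,7) by (simp add: distrib_left distrib_right)
next
  fix f c assume f: "f \<in> germs X x"
  show "v (\<lambda>y. c * f y) + w (\<lambda>y. c * f y) = c * (v f + w f)"
    unfolding tangent_vectorD(4)[OF v f f] tangent_vectorD(4)[OF w f f] by (simp add: distrib_left)
qed

lemma tangent_vector_scale:
  assumes v: "tangent_vector X x v"
  shows "tangent_vector X x (\<lambda>f. a * v f)"
  unfolding tangent_vector_def
proof (intro conjI ballI allI impI)
  fix f g U assume fg: "f \<in> germs X x" "g \<in> germs X x"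
  note D = tangent_vectorD[OF v fg]
  { assume "openin (ctop X) U \<and> x \<in> U \<and> (\<forall>y\<in>U. f y = g y)"
    then have "v f = v g" by (auto intro: D(1)[of U])
    then show "a * v f = a * v g" by simp }
  show "a * v (\<lambda>y. f y + g y) = a * v f + a * v g"
    unfolding D(2) by (simp add: distrib_left)
  show "a * v (\<lambda>y. f y * g y) = f x * (a * v g) + (a * v f) * g x"
    unfolding D(3) by (simp add: distrib_left)
next
  fix f c assume f: "f \<in> germs X x"
  show "a * v (\<lambda>y. c * f y) = c * (a * v f)"
    unfolding tangent_vectorD(4)[OF v f f] by simp
qed

lemma vector_field_zero: "vector_field X U (\<lambda>_ _. 0)"
  by (simp add: vector_field_def tangent_vector_zero hol_zero)

lemma vector_field_add:
  assumes "vector_field X U v" "vector_field X U w"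
  shows "vector_field X U (\<lambda>x f. v x f + w x f)"
  using assms tangent_vector_add hol_add unfolding vector_field_def by simp

lemma vector_field_minus:
  assumes "vector_field X U v"
  shows "vector_field X U (\<lambda>x f. - v x f)"
  using assms tangent_vector_scale[where a = "-1"] hol_minus unfolding vector_field_def by simp

lemma vector_field_diff:
  assumes "vector_field X U v" "vector_field X U w"
  shows "vector_field X U (\<lambda>x f. v x f - w x f)"
  using vector_field_add[OF assms(1) vector_field_minus[OF assms(2)]] by simp

lemma vector_field_subset: "vector_field X U v \<Longrightarrow> V \<subseteq> U \<Longrightarrow> vector_field X V v"
  unfolding vector_field_def by blast

lemma cohomologous_refl:
  assumes "u \<in> cocycles X"
  shows "(u, u) \<in> cohomologous X"
proof -
  obtain \<U> \<theta> where u: "u = (\<U>, \<theta>)" by (cases u)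
  show ?thesis unfolding u
    by (rule cohomologousI[where \<W> = \<U> and r = "\<lambda>U. U" and s = "\<lambda>U. U" and \<tau> = "\<lambda>_ _ _. 0"])
      (use assms[unfolded u] in \<open>auto simp: vector_field_zero dest: cocyclesD(1)\<close>)
qed

lemma cohomologous_sym:
  assumes "(u, v) \<in> cohomologous X"
  shows "(v, u) \<in> cohomologous X"
proof -
  obtain \<U> \<theta> where u: "u = (\<U>, \<theta>)" by (cases u)
  obtain \<V> \<eta> where v: "v = (\<V>, \<eta>)" by (cases v)
  from assms[unfolded u v] obtain \<W> r s \<tau> where c: "(\<U>, \<theta>) \<in> cocycles X" "(\<V>, \<eta>) \<in> cocycles X" "open_cover X \<W>"
    and W: "\<And>W. W \<in> \<W> \<Longrightarrow> r W \<in> \<U> \<and> W \<subseteq> r W \<and> s W \<in> \<V> \<and> W \<subseteq> s W \<and> vector_field X W (\<tau> W)"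
    and eq: "\<And>W W' x f. W \<in> \<W> \<Longrightarrow> W' \<in> \<W> \<Longrightarrow> x \<in> W \<inter> W' \<Longrightarrow> f \<in> germs X x \<Longrightarrow>
      \<theta> (r W) (r W') x f - \<eta> (s W) (s W') x f = \<tau> W' x f - \<tau> W x f"
    by (rule cohomologousE) (rule that)
  show ?thesis unfolding u v
  proof (rule cohomologousI[OF c(2,1,3), where r = s and s = r and \<tau> = "\<lambda>W x f. - \<tau> W x f"])
    fix W W' x f assume "W \<in> \<W>" "W' \<in> \<W>" "x \<in> W \<inter> W'" "f \<in> germs X x"
    from eq[OF this] show "\<eta> (s W) (s W') x f - \<theta> (r W) (r W') x f = - \<tau> W' x f - - \<tau> W x f"
      by (metis minus_diff_eq minus_diff_minus)
  qed (use W vector_field_minus in blast)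
qed

lemma cohomologous_trans:
  assumes "(u, v) \<in> cohomologous X" "(v, w) \<in> cohomologous X"
  shows "(u, w) \<in> cohomologous X"
proof -
  obtain \<U> \<theta> where u: "u = (\<U>, \<theta>)" by (cases u)
  obtain \<V> \<eta> where v: "v = (\<V>, \<eta>)" by (cases v)
  obtain \<Q> \<kappa> where w: "w = (\<Q>, \<kappa>)" by (cases w)
  from assms(1)[unfolded u v] obtain \<A> r1 s1 \<tau>1 where c: "(\<U>, \<theta>) \<in> cocycles X" "(\<V>, \<eta>) \<in> cocycles X" and A: "open_cover X \<A>"
    and W1: "\<And>W. W \<in> \<A> \<Longrightarrow> r1 W \<in> \<U> \<and> W \<subseteq> r1 W \<and> s1 W \<in> \<V> \<and> W \<subseteq> s1 W \<and> vector_field X W (\<tau>1 W)"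
    and eq1: "\<And>W W' x f. W \<in> \<A> \<Longrightarrow> W' \<in> \<A> \<Longrightarrow> x \<in> W \<inter> W' \<Longrightarrow> f \<in> germs X x \<Longrightarrow>
      \<theta> (r1 W) (r1 W') x f - \<eta> (s1 W) (s1 W') x f = \<tau>1 W' x f - \<tau>1 W x f"
    by (rule cohomologousE) (rule that)
  from assms(2)[unfolded v w] obtain \<B> r2 s2 \<tau>2 where c2: "(\<Q>, \<kappa>) \<in> cocycles X" and B: "open_cover X \<B>"
    and W2: "\<And>W. W \<in> \<B> \<Longrightarrow> r2 W \<in> \<V> \<and> W \<subseteq> r2 W \<and> s2 W \<in> \<Q> \<and> W \<subseteq> s2 W \<and> vector_field X W (\<tau>2 W)"
    and eq2: "\<And>W W' x f. W \<in> \<B> \<Longrightarrow> W' \<in> \<B> \<Longrightarrow> x \<in> W \<inter> W' \<Longrightarrow> f \<in> germs X x \<Longrightarrow>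
      \<eta> (r2 W) (r2 W') x f - \<kappa> (s2 W) (s2 W') x f = \<tau>2 W' x f - \<tau>2 W x f"
    by (rule cohomologousE) (rule that)
  define \<W> where "\<W> = {A \<inter> B | A B. A \<in> \<A> \<and> B \<in> \<B>}"
  have "\<forall>W\<in>\<W>. \<exists>A B. A \<in> \<A> \<and> B \<in> \<B> \<and> W = A \<inter> B" by (auto simp: \<W>_def)
  then obtain a b where ab: "\<And>W. W \<in> \<W> \<Longrightarrow> a W \<in> \<A> \<and> b W \<in> \<B> \<and> W = a W \<inter> b W" by metis
  \<comment> \<open>On the common refinement the middle cocycle \<open>\<eta>\<close> is seen
    through two different refinement maps, \<open>s1\<close> and \<open>r2\<close>. The last summand
    is the standard homotopy between these two restrictions.\<close>
  define \<tau> where "\<tau> W x f = \<tau>1 (a W) x f + \<tau>2 (b W) x f - \<eta> (s1 (a W)) (r2 (b W)) x f" for W x f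
  note vf = cocyclesD(2)[OF c(2)] and coc = cocyclesD(3)[OF c(2)]
  have cover: "open_cover X \<W>"
  proof -
    have "\<Union>\<W> = \<Union>\<A> \<inter> \<Union>\<B>" unfolding \<W>_def by blast
    then show ?thesis using A B unfolding open_cover_def \<W>_def by auto
  qed
  have ref: "r1 (a W) \<in> \<U> \<and> W \<subseteq> r1 (a W) \<and> s2 (b W) \<in> \<Q> \<and> W \<subseteq> s2 (b W) \<and> vector_field X W (\<tau> W)"
    if W: "W \<in> \<W>" for W
  proof -
    note w1 = W1[of "a W"] and w2 = W2[of "b W"] and ww = ab[OF W]
    have "vector_field X W (\<tau>1 (a W))" "vector_field X W (\<tau>2 (b W))"
      using w1 w2 ww by (auto intro: vector_field_subset)
    moreover have "vector_field X W (\<eta> (s1 (a W)) (r2 (b W)))"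
      by (rule vector_field_subset[OF vf]) (use w1 w2 ww in auto)
    ultimately have "vector_field X W (\<tau> W)"
      unfolding \<tau>_def by (intro vector_field_diff vector_field_add)
    then show ?thesis using w1 w2 ww by blast
  qed
  have "\<theta> (r1 (a W)) (r1 (a W')) x f - \<kappa> (s2 (b W)) (s2 (b W')) x f = \<tau> W' x f - \<tau> W x f"
    if W: "W \<in> \<W>" "W' \<in> \<W>" "x \<in> W \<inter> W'" "f \<in> germs X x" for W W' x f
  proof -
    note ww = ab[OF W(1)] and w' = ab[OF W(2)]
    let ?s = "s1 (a W)" and ?s' = "s1 (a W')" and ?r = "r2 (b W)" and ?r' = "r2 (b W')"
    have m: "?s \<in> \<V>" "?s' \<in> \<V>" "?r \<in> \<V>" "?r' \<in> \<V>" "x \<in> ?s" "x \<in> ?s'" "x \<in> ?r" "x \<in> ?r'"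
      using W1 W2 ww w' W(3) by blast+
    have 1: "\<theta> (r1 (a W)) (r1 (a W')) x f - \<eta> ?s ?s' x f = \<tau>1 (a W') x f - \<tau>1 (a W) x f"
      by (rule eq1) (use ww w' W in auto)
    have 2: "\<eta> ?r ?r' x f - \<kappa> (s2 (b W)) (s2 (b W')) x f = \<tau>2 (b W') x f - \<tau>2 (b W) x f"
      by (rule eq2) (use ww w' W in auto)
    have 3: "\<eta> ?s ?s' x f + \<eta> ?s' ?r' x f = \<eta> ?s ?r' x f"
      "\<eta> ?s ?r x f + \<eta> ?r ?r' x f = \<eta> ?s ?r' x f"
      using m W(4) by (auto intro!: coc)
    have "(\<theta> (r1 (a W)) (r1 (a W')) x f - \<eta> ?s ?s' x f) + (\<eta> ?r ?r' x f - \<kappa> (s2 (b W)) (s2 (b W')) x f)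
      + ((\<eta> ?s ?s' x f + \<eta> ?s' ?r' x f) - (\<eta> ?s ?r x f + \<eta> ?r ?r' x f))
      = \<tau> W' x f - \<tau> W x f + (\<eta> ?s' ?r' x f - \<eta> ?s ?r x f)"
      unfolding 1 2 3 \<tau>_def by (simp add: algebra_simps)
    then show ?thesis by (simp add: algebra_simps)
  qed
  from cohomologousI[OF c(1) c2 cover ref this] show ?thesis unfolding u w .
qed

end

section \<open>Automorphisms acting on the first cohomology\<close>

locale sheaf_automorphism = sheaf_space X for X :: "'a cspace" +
  fixes g h :: "'a \<Rightarrow> 'a"
  assumes hol_g: "holomorphic_map X X g" and hol_h: "holomorphic_map X X h"
    and hg: "\<And>x. x \<in> topspace (ctop X) \<Longrightarrow> h (g x) = x"
    and gh: "\<And>x. x \<in> topspace (ctop X) \<Longrightarrow> g (h x) = x"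
begin

abbreviation "S \<equiv> topspace (ctop X)"

lemma g_mem: "x \<in> S \<Longrightarrow> g x \<in> S" and h_mem: "x \<in> S \<Longrightarrow> h x \<in> S"
  using hol_g hol_h unfolding holomorphic_map_def continuous_map_def by auto

lemma inv_into_g: "y \<in> S \<Longrightarrow> inv_into S g y = h y"
  by (rule inv_into_f_eq) (use hg gh h_mem in \<open>auto intro: inj_on_inverseI[of _ h]\<close>)

lemma image_g: "U \<subseteq> S \<Longrightarrow> g ` U = pre X h U"
  unfolding pre_def using hg gh g_mem h_mem by (auto simp: image_iff subset_iff) metis

lemma image_g_space: "g ` S = S"
proof
  show "S \<subseteq> g ` S"
  proof
    fix y assume "y \<in> S"
    then show "y \<in> g ` S" using gh h_mem by (intro image_eqI[where x = "h y"]) auto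
  qed
qed (use g_mem in auto)

lemma h_mem_of_image: "U \<subseteq> S \<Longrightarrow> y \<in> g ` U \<Longrightarrow> h y \<in> U"
  using hg by auto

lemma pre_image_g: "U \<subseteq> S \<Longrightarrow> pre X g (g ` U) = U"
  unfolding pre_def using hg by (auto simp: subset_iff) metis

lemma openin_pre_g: "openin (ctop X) U \<Longrightarrow> openin (ctop X) (pre X g U)"
  using hol_g by (simp add: holomorphic_map_def continuous_map_def pre_def)

lemma openin_image_g: "openin (ctop X) U \<Longrightarrow> openin (ctop X) (g ` U)"
  using hol_h by (simp add: image_g openin_subset holomorphic_map_def continuous_map_def) (simp add: pre_def)

lemma germs_comp:
  assumes "y \<in> S" "f \<in> germs X y"
  shows "f \<circ> g \<in> germs X (h y)"
proof -
  obtain U where U: "openin (ctop X) U" "y \<in> U" "f \<in> hol X U" using assms(2) by (auto simp: germs_def)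
  have "h y \<in> pre X g U" using assms(1) U(2) gh h_mem by (simp add: pre_def)
  moreover have "f \<circ> g \<in> hol X (pre X g U)" using hol_g U by (simp add: holomorphic_map_def)
  ultimately show ?thesis using openin_pre_g[OF U(1)] by (auto simp: germs_def)
qed

lemma tangent_vector_push:
  assumes y: "y \<in> S" and v: "tangent_vector X (h y) v"
  shows "tangent_vector X y (\<lambda>f. v (f \<circ> g))"
  unfolding tangent_vector_def
proof (intro conjI ballI allI impI)
  fix f k U assume fk: "f \<in> germs X y" "k \<in> germs X y"
  note D = tangent_vectorD[OF v germs_comp[OF y fk(1)] germs_comp[OF y fk(2)]]
  { assume U: "openin (ctop X) U \<and> y \<in> U \<and> (\<forall>x\<in>U. f x = k x)"
    show "v (f \<circ> g) = v (k \<circ> g)"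
      by (rule D(1)[of "pre X g U"]) (use U openin_pre_g y gh h_mem in \<open>auto simp: pre_def\<close>) }
  show "v ((\<lambda>y. f y + k y) \<circ> g) = v (f \<circ> g) + v (k \<circ> g)"
    using D(2) by (simp only: o_def)
  show "v ((\<lambda>y. f y * k y) \<circ> g) = f y * v (k \<circ> g) + v (f \<circ> g) * k y"
    using D(3) gh[OF y] by (simp only: o_def)
next
  fix f c assume "f \<in> germs X y"
  from germs_comp[OF y this] show "v ((\<lambda>y. c * f y) \<circ> g) = c * v (f \<circ> g)"
    using tangent_vectorD(4)[OF v] by (simp only: o_def)
qed

lemma vector_field_push:
  assumes v: "vector_field X U v" and U: "U \<subseteq> S"
  shows "vector_field X (g ` U) (push_vfield X g v)"
  unfolding vector_field_def
proof (intro conjI ballI allI impI)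
  fix y assume y: "y \<in> g ` U"
  then have yS: "y \<in> S" using U g_mem by auto
  have "h y \<in> U" using y U by (auto simp: hg subset_iff)
  then have "tangent_vector X (h y) (v (h y))" using v by (simp add: vector_field_def)
  from tangent_vector_push[OF yS this] show "tangent_vector X y (push_vfield X g v y)"
    by (simp add: push_vfield_def inv_into_g[OF yS])
next
  fix V f assume V: "openin (ctop X) V \<and> V \<subseteq> g ` U \<and> f \<in> hol X V"
  then have VS: "V \<subseteq> S" using openin_subset by blast
  have pV: "openin (ctop X) (pre X g V)" "pre X g V \<subseteq> U"
    using V openin_pre_g pre_image_g[OF U] by (auto simp: pre_def)
  have "f \<circ> g \<in> hol X (pre X g V)" using hol_g V by (simp add: holomorphic_map_def)
  then have "(\<lambda>x. v x (f \<circ> g)) \<in> hol X (pre X g V)" using v pV by (simp add: vector_field_def)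
  then have "(\<lambda>x. v x (f \<circ> g)) \<circ> h \<in> hol X (pre X h (pre X g V))"
    using hol_h pV by (simp add: holomorphic_map_def)
  moreover have "pre X h (pre X g V) = V" using VS gh h_mem by (auto simp: pre_def)
  ultimately have hol: "(\<lambda>x. v x (f \<circ> g)) \<circ> h \<in> hol X V" by simp
  show "(\<lambda>x. push_vfield X g v x f) \<in> hol X V"
  proof (rule hol_cong[OF _ hol])
    fix y assume "y \<in> V"
    then have "y \<in> S" using VS by blast
    then show "((\<lambda>x. v x (f \<circ> g)) \<circ> h) y = push_vfield X g v y f"
      by (simp add: push_vfield_def inv_into_g)
  qed (use V in blast)
qed

lemma push_cocycle_mem:
  assumes "(\<U>, \<theta>) \<in> cocycles X"
  shows "push_cocycle X g (\<U>, \<theta>) \<in> cocycles X"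
proof -
  note cover = cocyclesD(1)[OF assms] and vf = cocyclesD(2)[OF assms] and coc = cocyclesD(3)[OF assms]
  have US: "U \<subseteq> S" if "U \<in> \<U>" for U using that cover by (auto simp: open_cover_def dest: openin_subset)
  have f1: "open_cover X ((`) g ` \<U>)"
  proof -
    have "\<Union>((`) g ` \<U>) = g ` S" using cover unfolding open_cover_def by blast
    also have "\<dots> = S" by (rule image_g_space)
    finally show ?thesis using cover openin_image_g by (auto simp: open_cover_def)
  qed
  have f2: "vector_field X (g ` U \<inter> g ` V) (push_vfield X g (\<theta> (pre X g (g ` U)) (pre X g (g ` V))))"
    if UV: "U \<in> \<U>" "V \<in> \<U>" for U V
  proof -
    have "inj_on g S" using hg by (rule inj_on_inverseI)
    then have "g ` U \<inter> g ` V = g ` (U \<inter> V)" using US[OF UV(1)] US[OF UV(2)] by (simp add: inj_on_image_Int)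
    then show ?thesis
      using vector_field_push[OF vf[OF UV]] US UV by (simp add: pre_image_g le_infI1)
  qed
  have f3: "push_vfield X g (\<theta> (pre X g (g ` U)) (pre X g (g ` V))) y f
      + push_vfield X g (\<theta> (pre X g (g ` V)) (pre X g (g ` W))) y f
      = push_vfield X g (\<theta> (pre X g (g ` U)) (pre X g (g ` W))) y f"
    if UVW: "U \<in> \<U>" "V \<in> \<U>" "W \<in> \<U>" and y: "y \<in> g ` U \<inter> g ` V \<inter> g ` W" and f: "f \<in> germs X y" for U V W y f
  proof -
    have yS: "y \<in> S" using y US[OF UVW(1)] g_mem by auto
    have "h y \<in> U" "h y \<in> V" "h y \<in> W" using y UVW by (auto intro!: h_mem_of_image US)
    then show ?thesis using UVW coc[OF UVW, of "h y" "f \<circ> g"] germs_comp[OF yS f]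
      by (simp add: US pre_image_g push_vfield_def inv_into_g[OF yS])
  qed
  show ?thesis unfolding push_cocycle_def prod.case
  proof (rule cocyclesI[OF f1])
    fix U V assume "U \<in> (`) g ` \<U>" "V \<in> (`) g ` \<U>"
    then obtain A B where "U = g ` A" "V = g ` B" "A \<in> \<U>" "B \<in> \<U>" by blast
    then show "vector_field X (U \<inter> V) (push_vfield X g (\<theta> (pre X g U) (pre X g V)))"
      using f2[of A B] by simp
  next
    fix U V W y f assume "U \<in> (`) g ` \<U>" "V \<in> (`) g ` \<U>" "W \<in> (`) g ` \<U>"
      and y: "y \<in> U \<inter> V \<inter> W" "f \<in> germs X y"
    then obtain A B C where "U = g ` A" "V = g ` B" "W = g ` C" "A \<in> \<U>" "B \<in> \<U>" "C \<in> \<U>" by blast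
    then show "push_vfield X g (\<theta> (pre X g U) (pre X g V)) y f + push_vfield X g (\<theta> (pre X g V) (pre X g W)) y f
      = push_vfield X g (\<theta> (pre X g U) (pre X g W)) y f"
      using f3[of A B C y f] y by (simp only:)
  qed
qed

lemma push_cocycle_cohomologous:
  assumes "(u, v) \<in> cohomologous X"
  shows "(push_cocycle X g u, push_cocycle X g v) \<in> cohomologous X"
proof -
  obtain \<U> \<theta> where u: "u = (\<U>, \<theta>)" by (cases u)
  obtain \<V> \<eta> where v: "v = (\<V>, \<eta>)" by (cases v)
  from assms[unfolded u v] obtain \<W> r s \<tau> where c: "(\<U>, \<theta>) \<in> cocycles X" "(\<V>, \<eta>) \<in> cocycles X" and cover: "open_cover X \<W>"
    and W: "\<And>W. W \<in> \<W> \<Longrightarrow> r W \<in> \<U> \<and> W \<subseteq> r W \<and> s W \<in> \<V> \<and> W \<subseteq> s W \<and> vector_field X W (\<tau> W)"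
    and eq: "\<And>W W' x f. W \<in> \<W> \<Longrightarrow> W' \<in> \<W> \<Longrightarrow> x \<in> W \<inter> W' \<Longrightarrow> f \<in> germs X x \<Longrightarrow>
      \<theta> (r W) (r W') x f - \<eta> (s W) (s W') x f = \<tau> W' x f - \<tau> W x f"
    by (rule cohomologousE) (rule that)
  note US = cocyclesD(5)[OF c(1)] cocyclesD(5)[OF c(2)]
  have WS: "W \<subseteq> S" if "W \<in> \<W>" for W using that cover by (auto simp: open_cover_def dest: openin_subset)
  define r' where "r' W = g ` r (pre X g W)" for W
  define s' where "s' W = g ` s (pre X g W)" for W
  define \<tau>' where "\<tau>' W = push_vfield X g (\<tau> (pre X g W))" for W
  have cover': "open_cover X ((`) g ` \<W>)"
  proof -
    have "\<Union>((`) g ` \<W>) = g ` S" using cover unfolding open_cover_def by blast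
    also have "\<dots> = S" by (rule image_g_space)
    finally show ?thesis using cover openin_image_g by (auto simp: open_cover_def)
  qed
  have 1: "r' W \<in> (`) g ` \<U> \<and> W \<subseteq> r' W \<and> s' W \<in> (`) g ` \<V> \<and> W \<subseteq> s' W \<and> vector_field X W (\<tau>' W)"
    if "W \<in> (`) g ` \<W>" for W
  proof -
    from that obtain Z where Z: "Z \<in> \<W>" "W = g ` Z" by blast
    have "vector_field X W (\<tau>' W)"
      unfolding \<tau>'_def Z(2) pre_image_g[OF WS[OF Z(1)]] using W[OF Z(1)] WS[OF Z(1)] by (intro vector_field_push) auto
    then show ?thesis
      using W[OF Z(1)] unfolding r'_def s'_def Z(2) pre_image_g[OF WS[OF Z(1)]] by blast
  qed
  have 2: "push_vfield X g (\<theta> (pre X g (r' W)) (pre X g (r' W'))) y f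
      - push_vfield X g (\<eta> (pre X g (s' W)) (pre X g (s' W'))) y f = \<tau>' W' y f - \<tau>' W y f"
    if WW: "W \<in> (`) g ` \<W>" "W' \<in> (`) g ` \<W>" and y: "y \<in> W \<inter> W'" and f: "f \<in> germs X y" for W W' y f
  proof -
    obtain Z Z' where Z: "Z \<in> \<W>" "W = g ` Z" "Z' \<in> \<W>" "W' = g ` Z'" using WW by blast
    have yS: "y \<in> S" using y Z WS g_mem by auto
    have "h y \<in> Z" "h y \<in> Z'" using y Z by (auto intro!: h_mem_of_image WS)
    then show ?thesis
      using eq[OF Z(1,3), of "h y" "f \<circ> g"] germs_comp[OF yS f] W[OF Z(1)] W[OF Z(3)]
      by (simp add: Z WS US pre_image_g push_vfield_def inv_into_g[OF yS] r'_def s'_def \<tau>'_def)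
  qed
  show ?thesis
    using push_cocycle_mem[OF c(1)] push_cocycle_mem[OF c(2)] cover' 1 2
    unfolding u v push_cocycle_def prod.case by (rule cohomologousI)
qed

text \<open>Pushing forward respects the relation on cocycles, so invariance of a class can be
  tested on one representative.\<close>

lemma push_H1_fixed:
  assumes "(u, push_cocycle X g u) \<in> cohomologous X"
  shows "push_H1 X g (cohomologous X `` {u}) = cohomologous X `` {u}"
proof
  have u: "u \<in> cocycles X" using assms by (auto simp: cohomologous_def)
  show "push_H1 X g (cohomologous X `` {u}) \<subseteq> cohomologous X `` {u}"
  proof
    fix w assume "w \<in> push_H1 X g (cohomologous X `` {u})"
    then obtain v where "(u, v) \<in> cohomologous X" "(push_cocycle X g v, w) \<in> cohomologous X"
      unfolding push_H1_def by blast
    then show "w \<in> cohomologous X `` {u}"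
      using cohomologous_trans[OF cohomologous_trans[OF assms push_cocycle_cohomologous]] by blast
  qed
  show "cohomologous X `` {u} \<subseteq> push_H1 X g (cohomologous X `` {u})"
  proof
    fix w assume "w \<in> cohomologous X `` {u}"
    then have "(push_cocycle X g u, w) \<in> cohomologous X"
      using cohomologous_trans[OF cohomologous_sym[OF assms]] by blast
    then show "w \<in> push_H1 X g (cohomologous X `` {u})"
      unfolding push_H1_def using cohomologous_refl[OF u] by blast
  qed
qed

end

text \<open>The only place where rigidity is unfolded: the class of \<open>u\<close> is invariant,
  so it is the zero class.\<close>

lemma (in sheaf_space) rigid_action_imp_trivial:
  assumes rigid: "rigid_action G X \<phi>"
    and aut: "\<And>g. g \<in> carrier G \<Longrightarrow> \<exists>h. sheaf_automorphism X (\<phi> g) h"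
    and u: "u \<in> cocycles X" "\<And>g. g \<in> carrier G \<Longrightarrow> (u, push_cocycle X (\<phi> g) u) \<in> cohomologous X"
  shows "(u, ({topspace (ctop X)}, \<lambda>_ _ _ _. 0)) \<in> cohomologous X"
proof -
  have "push_H1 X (\<phi> g) (cohomologous X `` {u}) = cohomologous X `` {u}" if g: "g \<in> carrier G" for g
  proof -
    obtain h where "sheaf_automorphism X (\<phi> g) h" using aut[OF g] by blast
    then interpret sheaf_automorphism X "\<phi> g" h .
    show ?thesis by (rule push_H1_fixed[OF u(2)[OF g]])
  qed
  moreover have "cohomologous X `` {u} \<in> H1 X" unfolding H1_def using u(1) by (rule quotientI)
  ultimately have "cohomologous X `` {u} \<in> {c \<in> H1 X. \<forall>g \<in> carrier G. push_H1 X (\<phi> g) c = c}" by simp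
  then have "cohomologous X `` {u} = H1_zero X"
    unfolding rigid[unfolded rigid_action_def] by simp
  then have "u \<in> H1_zero X" using cohomologous_refl[OF u(1)] by (metis Image_singleton_iff)
  then show ?thesis unfolding H1_zero_def Image_singleton_iff by (rule cohomologous_sym)
qed

section \<open>Products of elliptic curves and their invariant vector fields\<close>

locale curve_family =
  fixes \<Lambda> :: "'n::finite \<Rightarrow> complex set"
  assumes lattices: "\<And>j. complex_lattice (\<Lambda> j)"
begin

sublocale E: curve_lattice "\<Lambda> j" for j
  by unfold_locales (rule lattices)

abbreviation "X \<equiv> curve_product \<Lambda>"
abbreviation "P \<equiv> coset_map \<Lambda>"

lemma coset_map_eq_iff: "P z = P w \<longleftrightarrow> (\<forall>j. z $ j - w $ j \<in> \<Lambda> j)"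
  by (simp add: coset_map_def fun_eq_iff E.coset_eq_iff)

lemma coset_map_add: "(\<And>j. l $ j \<in> \<Lambda> j) \<Longrightarrow> P (z + l) = P z"
  by (simp add: coset_map_eq_iff)

lemma topspace_curve_product: "topspace (ctop X) = range P"
proof
  show "topspace (ctop X) \<subseteq> range P"
  proof
    fix x assume "x \<in> topspace (ctop X)"
    then have "\<forall>j. \<exists>z. x j = coset (\<Lambda> j) z" by (auto simp: curve_product_def PiE_iff)
    then obtain z where "\<And>j. x j = coset (\<Lambda> j) (z j)" by metis
    then have "x = P (\<chi> j. z j)" by (simp add: coset_map_def fun_eq_iff)
    then show "x \<in> range P" by blast
  qed
qed (auto simp: curve_product_def coset_map_def)

text \<open>The product of the quotient topologies is the quotient topology of the product because
  each projection is open: a box around a lift maps to a basic open set of the product.\<close>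

lemma openin_curve_product: "openin (ctop X) U \<longleftrightarrow> U \<subseteq> range P \<and> open {z. P z \<in> U}"
proof
  assume U: "openin (ctop X) U"
  have "continuous_map euclidean (ctop X) P"
    unfolding curve_product_def cspace.simps
  proof (subst continuous_map_componentwise_UNIV, rule allI)
    fix j
    have "continuous_map euclidean (ctop (elliptic_curve (\<Lambda> j))) (coset (\<Lambda> j) \<circ> (\<lambda>z. z $ j))"
      by (rule continuous_map_compose[OF _ E.continuous_map_coset]) (simp add: continuous_on_component)
    then show "continuous_map euclidean (ctop (elliptic_curve (\<Lambda> j))) (\<lambda>z. P z j)"
      by (simp add: coset_map_def o_def)
  qed
  then show "U \<subseteq> range P \<and> open {z. P z \<in> U}"
    using U openin_subset[OF U] by (simp add: continuous_map_def topspace_curve_product)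
next
  assume U: "U \<subseteq> range P \<and> open {z. P z \<in> U}"
  show "openin (ctop X) U"
  proof (subst openin_subopen, rule ballI)
    fix x assume x: "x \<in> U"
    then obtain z where z: "x = P z" using U by blast
    have "open {z. P z \<in> U}" "z \<in> {z. P z \<in> U}" using U x z by auto
    then obtain A where A: "\<And>j. open (A j) \<and> z $ j \<in> A j" "\<And>y. (\<And>j. y $ j \<in> A j) \<Longrightarrow> P y \<in> U"
      unfolding open_vec_def by (metis (no_types, lifting) mem_Collect_eq)
    let ?B = "PiE UNIV (\<lambda>j. coset (\<Lambda> j) ` A j)"
    have "openin (ctop X) ?B"
      unfolding curve_product_def cspace.simps
      by (rule product_topology_basis) (use A E.openin_coset_image in \<open>auto intro: finite_subset[OF subset_UNIV]\<close>)
    moreover have "x \<in> ?B" using A(1) z by (auto simp: coset_map_def)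
    moreover have "?B \<subseteq> U"
    proof
      fix y assume "y \<in> ?B"
      then have "\<forall>j. \<exists>a. a \<in> A j \<and> y j = coset (\<Lambda> j) a" by (auto simp: PiE_iff)
      then obtain a where a: "\<And>j. a j \<in> A j" "\<And>j. y j = coset (\<Lambda> j) (a j)" by metis
      then have "y = P (\<chi> j. a j)" by (simp add: coset_map_def fun_eq_iff)
      then show "y \<in> U" using A(2)[of "\<chi> j. a j"] a(1) by simp
    qed
    ultimately show "\<exists>T. openin (ctop X) T \<and> x \<in> T \<and> T \<subseteq> U" by blast
  qed
qed

lemma hol_curve_product: "f \<in> hol X U \<longleftrightarrow> cdiff_on (\<lambda>z. f (P z)) {z. P z \<in> U}"
proof -
  have "pre complex_affine_space P U = {z. P z \<in> U}"
    by (simp add: pre_def complex_affine_space_def)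
  then show ?thesis by (simp add: curve_product_def hol_complex_affine_space o_def)
qed

sublocale S: sheaf_space X
proof
  fix U :: "('n \<Rightarrow> complex set) set" and f g :: "('n \<Rightarrow> complex set) \<Rightarrow> complex"
  assume U: "openin (ctop X) U"
  show "(\<lambda>_. 0) \<in> hol X U" unfolding hol_curve_product by (rule cdiff_on_const)
  assume f: "f \<in> hol X U"
  then show "(\<lambda>x. - f x) \<in> hol X U" unfolding hol_curve_product by (rule cdiff_on_minus)
  { assume "g \<in> hol X U"
    with f show "(\<lambda>x. f x + g x) \<in> hol X U" unfolding hol_curve_product by (rule cdiff_on_add) }
  assume eq: "\<And>x. x \<in> U \<Longrightarrow> f x = g x"
  have "open {z. P z \<in> U}" using U by (simp add: openin_curve_product)
  moreover have "cdiff_on (\<lambda>z. f (P z)) {z. P z \<in> U}" using f by (simp add: hol_curve_product)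
  ultimately show "g \<in> hol X U"
    unfolding hol_curve_product by (rule cdiff_on_cong) (simp add: eq)
qed

text \<open>The translation-invariant field in the \<open>j\<close>-th coordinate direction. The
  chosen lift of \<open>x\<close> is immaterial, since \<open>f \<circ> P\<close> is
  periodic.\<close>

definition dvec :: "'n \<Rightarrow> ('n \<Rightarrow> complex set) vfield" where
  "dvec j x f = deriv (\<lambda>t. f (P ((SOME z. P z = x) + t *s axis j 1))) 0"

lemma dvec_coset_map: "dvec j (P z) f = deriv (\<lambda>t. f (P (z + t *s axis j 1))) 0"
proof -
  have "P (SOME w. P w = P z) = P z" by (rule someI[of _ z]) simp
  then have "P ((SOME w. P w = P z) + u) = P (z + u)" for u
    by (simp add: coset_map_eq_iff)
  then show ?thesis by (simp add: dvec_def)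
qed

lemma germ_slice:
  assumes "f \<in> germs X (P z)"
  shows "(\<lambda>t. f (P (z + t *s v))) field_differentiable (at 0)"
proof -
  obtain U where "P z \<in> U" "cdiff_on (\<lambda>z. f (P z)) {z. P z \<in> U}"
    using assms by (auto simp: germs_def hol_curve_product)
  then obtain D where D: "((\<lambda>z. f (P z)) has_derivative D) (at z)" "\<And>c w. D (c *s w) = c * D w"
    unfolding cdiff_on_def by blast
  have "((\<lambda>t. f (P (z + t *s v))) has_field_derivative D v) (at 0)"
    by (rule slice_has_field_derivative[where f = "\<lambda>z. f (P z)"]) (use D in auto)
  then show ?thesis by (auto simp: field_differentiable_def)
qed

lemma eventually_slice:
  assumes "openin (ctop X) U" "P z \<in> U"
  shows "\<forall>\<^sub>F t in nhds 0. P (z + t *s v) \<in> U"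
proof -
  have "open {z. P z \<in> U}" using assms(1) by (simp add: openin_curve_product)
  moreover have "continuous_on UNIV (\<lambda>t. z + t *s v)"
    by (intro continuous_intros linear_continuous_on bounded_linear_vector_scalar_mult)
  ultimately have "open ((\<lambda>t. z + t *s v) -` {z. P z \<in> U})" by (intro open_vimage)
  then show ?thesis using assms(2) by (auto dest!: eventually_nhds_in_open[of _ 0])
qed

lemma tangent_vector_dvec:
  assumes x: "x \<in> range P"
  shows "tangent_vector X x (dvec j x)"
proof -
  obtain z where z: "x = P z" using x by blast
  show ?thesis unfolding z tangent_vector_def
  proof (intro conjI ballI allI impI)
    fix f g U assume fg: "f \<in> germs X (P z)" "g \<in> germs X (P z)"
    note d = germ_slice[OF fg(1)] germ_slice[OF fg(2)]
    { assume U: "openin (ctop X) U \<and> P z \<in> U \<and> (\<forall>y\<in>U. f y = g y)"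
      show "dvec j (P z) f = dvec j (P z) g"
        unfolding dvec_coset_map
      proof (rule deriv_cong_ev[OF _ refl])
        show "\<forall>\<^sub>F t in nhds 0. f (P (z + t *s axis j 1)) = g (P (z + t *s axis j 1))"
          using eventually_slice[of U z "axis j 1"] U by (auto elim: eventually_mono)
      qed }
    show "dvec j (P z) (\<lambda>y. f y + g y) = dvec j (P z) f + dvec j (P z) g"
      unfolding dvec_coset_map by (rule deriv_add[OF d])
    show "dvec j (P z) (\<lambda>y. f y * g y) = f (P z) * dvec j (P z) g + dvec j (P z) f * g (P z)"
      unfolding dvec_coset_map using deriv_mult[OF d] by simp
  next
    fix f c assume "f \<in> germs X (P z)"
    then show "dvec j (P z) (\<lambda>y. c * f y) = c * dvec j (P z) f"
      unfolding dvec_coset_map by (intro deriv_cmult germ_slice)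
  qed
qed

text \<open>The derivation laws are those of a one-variable derivative; that holomorphic functions
  are mapped to holomorphic ones is \<open>cdiff_on_partial_derivative\<close>.\<close>

lemma vector_field_dvec:
  assumes U: "U \<subseteq> range P" and c: "cdiff_on (\<lambda>z. c (P z)) {z. P z \<in> U}"
  shows "vector_field X U (\<lambda>x f. c x * dvec j x f)"
  unfolding vector_field_def
proof (intro conjI ballI allI impI)
  fix x assume "x \<in> U"
  then show "tangent_vector X x (\<lambda>f. c x * dvec j x f)"
    using U by (intro S.tangent_vector_scale tangent_vector_dvec) auto
next
  fix V f assume V: "openin (ctop X) V \<and> V \<subseteq> U \<and> f \<in> hol X V"
  then have "cdiff_on (\<lambda>z. deriv (\<lambda>t. f (P (z + t *s axis j 1))) 0) {z. P z \<in> V}"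
    by (intro cdiff_on_partial_derivative) (auto simp: openin_curve_product hol_curve_product)
  moreover have "cdiff_on (\<lambda>z. c (P z)) {z. P z \<in> V}"
    by (rule cdiff_on_subset[OF c]) (use V in auto)
  ultimately show "(\<lambda>x. c x * dvec j x f) \<in> hol X V"
    unfolding hol_curve_product dvec_coset_map by (rule cdiff_on_mult[rotated])
qed

text \<open>A chart is a branch of the coordinate \<open>z $ i\<close>, well defined modulo \<open>\<Lambda> i\<close>, on an open set of \<open>X\<close>.\<close>

definition chart :: "'n \<Rightarrow> ('n \<Rightarrow> complex set) set \<Rightarrow> (('n \<Rightarrow> complex set) \<Rightarrow> complex) \<Rightarrow> bool" where
  "chart i U \<sigma> \<longleftrightarrow> openin (ctop X) U \<and>
     (\<forall>z. P z \<in> U \<longrightarrow> (\<exists>e>0. \<exists>l\<in>\<Lambda> i. \<forall>w\<in>ball z e. P w \<in> U \<longrightarrow> \<sigma> (P w) = w $ i - l))"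

lemma chartE:
  assumes "chart i U \<sigma>" "P z \<in> U"
  obtains N l where "open N" "z \<in> N" "l \<in> \<Lambda> i" "\<And>w. w \<in> N \<Longrightarrow> P w \<in> U" "\<And>w. w \<in> N \<Longrightarrow> \<sigma> (P w) = w $ i - l"
proof -
  obtain e l where e: "e > 0" "l \<in> \<Lambda> i" "\<And>w. w \<in> ball z e \<Longrightarrow> P w \<in> U \<Longrightarrow> \<sigma> (P w) = w $ i - l"
    using assms unfolding chart_def by blast
  have "open {z. P z \<in> U}" using assms(1) by (simp add: chart_def openin_curve_product)
  then show ?thesis
    using e assms(2) by (intro that[of "ball z e \<inter> {z. P z \<in> U}" l]) auto
qed

lemma chart_exists: "\<exists>U \<sigma>. chart i U \<sigma> \<and> P z0 \<in> U"
proof -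
  obtain e s where e: "e > 0" and s: "\<And>z l. z \<in> ball (z0 $ i) e \<Longrightarrow> l \<in> \<Lambda> i \<Longrightarrow> s (coset (\<Lambda> i) (z + l)) = z"
    using E.local_section[of "z0 $ i" i] by blast
  let ?B = "ball (z0 $ i) e"
  define U where "U = {x \<in> range P. x i \<in> coset (\<Lambda> i) ` ?B}"
  have eq: "{z. P z \<in> U} = (\<lambda>z. z $ i) -` {c. coset (\<Lambda> i) c \<in> coset (\<Lambda> i) ` ?B}"
    by (auto simp: U_def coset_map_def)
  have "open {c. coset (\<Lambda> i) c \<in> coset (\<Lambda> i) ` ?B}"
    using E.openin_coset_image[OF open_ball] E.openin_elliptic_curve by blast
  then have "open {z. P z \<in> U}"
    unfolding eq by (intro open_vimage continuous_on_component continuous_on_id)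
  then have "openin (ctop X) U"
    unfolding openin_curve_product by (auto simp: U_def)
  moreover have "\<exists>d>0. \<exists>l\<in>\<Lambda> i. \<forall>w\<in>ball z d. P w \<in> U \<longrightarrow> s (P w i) = w $ i - l" if z: "P z \<in> U" for z
  proof -
    have "z $ i \<in> {c. coset (\<Lambda> i) c \<in> coset (\<Lambda> i) ` ?B}" using z by (simp add: U_def coset_map_def)
    then obtain l b where l: "l \<in> \<Lambda> i" "b \<in> ?B" "z $ i = b + l" unfolding E.preimage_coset_image by blast
    have "s (P w i) = w $ i - l" if w: "w \<in> ball z (e - dist (z0 $ i) b)" for w
    proof -
      have "dist (z $ i) (w $ i) < e - dist (z0 $ i) b" using w dist_vec_nth_le[of z i w] by simp
      then have "dist b (w $ i - l) < e - dist (z0 $ i) b" using l(3) by (simp add: dist_norm algebra_simps)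
      then have "w $ i - l \<in> ?B" using dist_triangle[of "z0 $ i" "w $ i - l" b] by simp
      from s[OF this l(1)] show ?thesis by (simp add: coset_map_def)
    qed
    then show ?thesis using l(1,2) by (intro exI[of _ "e - dist (z0 $ i) b"]) auto
  qed
  ultimately have "chart i U (\<lambda>x. s (x i))" unfolding chart_def by blast
  moreover have "P z0 \<in> U" using e by (auto simp: U_def coset_map_def)
  ultimately show ?thesis by blast
qed

lemma chart_holomorphic: "chart i U \<sigma> \<Longrightarrow> \<sigma> \<in> hol X U"
  unfolding hol_curve_product
proof (rule cdiff_on_local)
  fix z assume c: "chart i U \<sigma>" "z \<in> {z. P z \<in> U}"
  then obtain N l where "open N" "z \<in> N" "\<And>w. w \<in> N \<Longrightarrow> \<sigma> (P w) = w $ i - l" by (auto elim: chartE)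
  then show "\<exists>V g. open V \<and> z \<in> V \<and> cdiff_on g V \<and> (\<forall>w\<in>V. \<sigma> (P w) = g w)"
    by (intro exI[of _ N] exI[of _ "\<lambda>w. w $ i - l"]) (auto intro: cdiff_on_diff cdiff_on_component)
qed

text \<open>Two branches differ by a locally constant lattice vector, so although each conjugated
  branch is antiholomorphic, their difference is locally constant and hence holomorphic. This is
  what makes \<open>conj_cocycle\<close> a cocycle of holomorphic fields.\<close>

lemma chart_diff:
  assumes "chart i U \<sigma>" "chart i V \<sigma>'"
  shows "cdiff_on (\<lambda>z. cnj (\<sigma> (P z)) - cnj (\<sigma>' (P z))) {z. P z \<in> U \<inter> V}"
proof (rule cdiff_on_local)
  fix z assume z: "z \<in> {z. P z \<in> U \<inter> V}"
  then obtain N l where N: "open N" "z \<in> N" "\<And>w. w \<in> N \<Longrightarrow> \<sigma> (P w) = w $ i - l"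
    using assms(1) by (auto elim: chartE)
  obtain N' l' where N': "open N'" "z \<in> N'" "\<And>w. w \<in> N' \<Longrightarrow> \<sigma>' (P w) = w $ i - l'"
    using assms(2) z by (auto elim: chartE)
  show "\<exists>V g. open V \<and> z \<in> V \<and> cdiff_on g V \<and> (\<forall>w\<in>V. cnj (\<sigma> (P w)) - cnj (\<sigma>' (P w)) = g w)"
    using N N' by (intro exI[of _ "N \<inter> N'"] exI[of _ "\<lambda>_. cnj l' - cnj l"]) auto
qed

text \<open>Evaluating a field on a branch of the coordinate reads off its coefficient; this turns
  the coboundary equation into one between functions.\<close>

lemma dvec_chart:
  assumes "chart j U \<sigma>" "P z \<in> U"
  shows "dvec j (P z) \<sigma> = 1"
proof -
  obtain N l where N: "open N" "z \<in> N" "\<And>w. w \<in> N \<Longrightarrow> \<sigma> (P w) = w $ j - l"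
    using assms by (auto elim: chartE)
  have "continuous_on UNIV (\<lambda>t. z + t *s axis j 1)"
    by (intro continuous_intros linear_continuous_on bounded_linear_vector_scalar_mult)
  then have "open ((\<lambda>t. z + t *s axis j 1) -` N)" using N(1) by (intro open_vimage)
  then have "\<forall>\<^sub>F t in nhds 0. z + t *s axis j 1 \<in> N"
    using N(2) by (auto dest!: eventually_nhds_in_open[of _ 0])
  then have "\<forall>\<^sub>F t in nhds 0. \<sigma> (P (z + t *s axis j 1)) = z $ j + t - l"
    by (rule eventually_mono) (simp add: N(3) axis_def)
  then have "dvec j (P z) \<sigma> = deriv (\<lambda>t. z $ j + t - l) 0"
    unfolding dvec_coset_map by (rule deriv_cong_ev) simp
  also have "\<dots> = 1" by (rule DERIV_imp_deriv) (auto intro!: derivative_eq_intros)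
  finally show ?thesis .
qed

definition branch :: "'n \<Rightarrow> ('n \<Rightarrow> complex set) set \<Rightarrow> ('n \<Rightarrow> complex set) \<Rightarrow> complex" where
  "branch i U = (SOME \<sigma>. chart i U \<sigma>)"

definition chart_domains :: "'n \<Rightarrow> ('n \<Rightarrow> complex set) set set" where
  "chart_domains i = {U. \<exists>\<sigma>. chart i U \<sigma>}"

lemma chart_branch: "U \<in> chart_domains i \<Longrightarrow> chart i U (branch i U)"
  unfolding chart_domains_def branch_def mem_Collect_eq by (rule someI_ex[of "chart i U"])

text \<open>The Dolbeault class of \<open>d(cnj z\<^sub>i) \<otimes> \<partial>\<^sub>j\<close>, as a Cech cocycle.\<close>

definition conj_cocycle :: "'n \<Rightarrow> 'n \<Rightarrow> ('n \<Rightarrow> complex set) cech1" where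
  "conj_cocycle i j =
     (chart_domains i, \<lambda>U V x f. (cnj (branch i V x) - cnj (branch i U x)) * dvec j x f)"

lemma chart_domain_subset: "U \<in> chart_domains i \<Longrightarrow> U \<subseteq> range P"
  by (auto simp: chart_domains_def chart_def openin_curve_product)

lemma open_cover_charts: "open_cover X (chart_domains i)"
proof -
  have "range P \<subseteq> \<Union>(chart_domains i)" using chart_exists by (fastforce simp: chart_domains_def)
  moreover have "\<And>U. U \<in> chart_domains i \<Longrightarrow> openin (ctop X) U" by (auto simp: chart_domains_def chart_def)
  ultimately show ?thesis
    using chart_domain_subset unfolding open_cover_def topspace_curve_product by blast
qed

lemma vector_field_chart_diff:
  assumes "chart i U \<sigma>" "chart i V \<sigma>'" "W \<subseteq> U" "W \<subseteq> V"
  shows "vector_field X W (\<lambda>x f. (cnj (\<sigma> x) - cnj (\<sigma>' x)) * dvec j x f)"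
proof (rule vector_field_dvec)
  show "W \<subseteq> range P" using assms by (auto simp: chart_def openin_curve_product)
  show "cdiff_on (\<lambda>z. cnj (\<sigma> (P z)) - cnj (\<sigma>' (P z))) {z. P z \<in> W}"
    by (rule cdiff_on_subset[OF chart_diff[OF assms(1,2)]]) (use assms in auto)
qed

lemma conj_cocycle_mem: "conj_cocycle i j \<in> cocycles X"
  unfolding conj_cocycle_def
proof (rule cocyclesI[OF open_cover_charts])
  fix U V assume "U \<in> chart_domains i" "V \<in> chart_domains i"
  then show "vector_field X (U \<inter> V) (\<lambda>x f. (cnj (branch i V x) - cnj (branch i U x)) * dvec j x f)"
    by (intro vector_field_chart_diff[of i V _ U] chart_branch) auto
qed (simp add: algebra_simps)

text \<open>
  A primitive would make \<open>cnj z\<^sub>i\<close> the sum of a periodic and an entire function. The entire function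
  grows at most linearly, so it is affine by Liouville, and \<open>cnj\<close> would be complex linear on \<open>\<Lambda> i\<close>.
\<close>

lemma not_coboundary:
  assumes "(conj_cocycle i j, ({topspace (ctop X)}, \<lambda>_ _ _ _. 0)) \<in> cohomologous X"
  shows False
proof -
  from assms[unfolded conj_cocycle_def] obtain \<W> r s \<tau> where cover: "open_cover X \<W>"
    and W0: "\<And>W. W \<in> \<W> \<Longrightarrow> r W \<in> chart_domains i \<and> W \<subseteq> r W \<and> s W \<in> {topspace (ctop X)} \<and> W \<subseteq> s W
      \<and> vector_field X W (\<tau> W)"
    and eq0: "\<And>W W' x f. W \<in> \<W> \<Longrightarrow> W' \<in> \<W> \<Longrightarrow> x \<in> W \<inter> W' \<Longrightarrow> f \<in> germs X x \<Longrightarrow>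
      (cnj (branch i (r W') x) - cnj (branch i (r W) x)) * dvec j x f - 0 = \<tau> W' x f - \<tau> W x f"
    by (rule cohomologousE) (rule that)
  have W: "r W \<in> chart_domains i \<and> W \<subseteq> r W \<and> vector_field X W (\<tau> W)" if "W \<in> \<W>" for W
    using W0[OF that] by blast
  note eq = eq0[unfolded diff_0_right]
  have charts: "chart i (r W) (branch i (r W))" if "W \<in> \<W>" for W using W[OF that] chart_branch by blast
  have germ: "\<kappa> \<in> germs X (P z)" if "chart j V \<kappa>" "P z \<in> V" for V \<kappa> z
    using that chart_holomorphic[OF that(1)] by (auto simp: germs_def chart_def)
  \<comment> \<open>Evaluate the coboundary equation on a branch \<open>\<kappa>\<close> of the
    \<open>j\<close>-th coordinate, where \<open>dvec j\<close> gives 1, and move the terms of each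
    member of the cover to one side.\<close>
  have indep_W: "cnj (branch i (r W) (P z)) - \<tau> W (P z) \<kappa> = cnj (branch i (r W') (P z)) - \<tau> W' (P z) \<kappa>"
    if "W \<in> \<W>" "W' \<in> \<W>" "P z \<in> W" "P z \<in> W'" "chart j V \<kappa>" "P z \<in> V" for W W' z V \<kappa>
    using eq[OF that(1,2) _ germ[OF that(5,6)]] that dvec_chart[OF that(5,6)] by (simp add: algebra_simps)
  \<comment> \<open>Near \<open>P z\<close> two branches differ by a constant, and a derivation
    kills constants by the Leibniz rule for \<open>1 * 1\<close>.\<close>
  have indep_chart: "\<tau> W (P z) \<kappa> = \<tau> W (P z) \<kappa>'"
    if "W \<in> \<W>" "P z \<in> W" and c: "chart j V \<kappa>" "P z \<in> V" and c': "chart j V' \<kappa>'" "P z \<in> V'" for W z V \<kappa> V' \<kappa>'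
  proof -
    have tv: "tangent_vector X (P z) (\<tau> W (P z))" using W that by (auto simp: vector_field_def)
    have const: "(\<lambda>_. a) \<in> germs X (P z)" for a
      using c by (auto simp: germs_def chart_def hol_curve_product intro!: exI[of _ V])
    note D = tangent_vectorD[OF tv]
    have "\<tau> W (P z) (\<lambda>_. 1 * 1) = 1 * \<tau> W (P z) (\<lambda>_. 1) + \<tau> W (P z) (\<lambda>_. 1) * 1"
      by (rule D(3)[OF const const])
    then have one: "\<tau> W (P z) (\<lambda>_. 1) = 0" by simp
    have zero: "\<tau> W (P z) (\<lambda>_. a) = 0" for a
      using D(4)[OF const[of 1] const[of 1], of a] one by simp
    obtain N l where N: "open N" "z \<in> N" "\<And>w. w \<in> N \<Longrightarrow> \<kappa> (P w) = w $ j - l"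
      using c by (auto elim: chartE)
    obtain N' l' where N': "open N'" "z \<in> N'" "\<And>w. w \<in> N' \<Longrightarrow> \<kappa>' (P w) = w $ j - l'"
      using c' by (auto elim: chartE)
    define Q where "Q = P ` (N \<inter> N')"
    have oQ: "openin (ctop X) Q"
    proof -
      have "{w. P w \<in> Q} = (\<Union>l\<in>{l. \<forall>k. l $ k \<in> \<Lambda> k}. (\<lambda>w. w + l) ` (N \<inter> N'))"
      proof safe
        fix w assume "P w \<in> Q"
        then obtain u where u: "u \<in> N \<inter> N'" "P w = P u" by (auto simp: Q_def)
        then show "w \<in> (\<Union>l\<in>{l. \<forall>k. l $ k \<in> \<Lambda> k}. (\<lambda>w. w + l) ` (N \<inter> N'))"
          by (intro UN_I[of "w - u"] image_eqI[of _ _ u]) (auto simp: coset_map_eq_iff)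
      next
        fix w l u assume "\<forall>k. l $ k \<in> \<Lambda> k" "u \<in> N" "u \<in> N'"
        then show "P (u + l) \<in> Q" by (auto simp: coset_map_add Q_def)
      qed
      moreover have "open ((\<lambda>w. w + l) ` (N \<inter> N'))" for l
        using open_translation[of "N \<inter> N'" l] N(1) N'(1) by (simp add: add.commute open_Int)
      ultimately show ?thesis unfolding openin_curve_product by (auto simp: Q_def)
    qed
    have "\<tau> W (P z) \<kappa> = \<tau> W (P z) (\<lambda>x. \<kappa>' x + (l' - l))"
    proof (rule D(1)[OF germ[OF c] _ oQ])
      show "(\<lambda>x. \<kappa>' x + (l' - l)) \<in> germs X (P z)"
        using germ[OF c'] const[of "l' - l"] chart_holomorphic[OF c'(1)] c'
        by (auto simp: germs_def chart_def hol_curve_product intro!: exI[of _ V'] cdiff_on_add)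
      show "P z \<in> Q" using N N' by (auto simp: Q_def)
      show "\<And>y. y \<in> Q \<Longrightarrow> \<kappa> y = \<kappa>' y + (l' - l)" using N(3) N'(3) by (auto simp: Q_def)
    qed
    also have "\<dots> = \<tau> W (P z) \<kappa>'" using D(2)[OF germ[OF c'] const[of "l' - l"]] zero by simp
    finally show ?thesis .
  qed
  define Wx where "Wx x = (SOME W. W \<in> \<W> \<and> x \<in> W)" for x
  define \<kappa>x where "\<kappa>x x = (SOME \<kappa>. \<exists>V. chart j V \<kappa> \<and> x \<in> V)" for x
  have Wx: "Wx (P z) \<in> \<W> \<and> P z \<in> Wx (P z)" for z
  proof -
    have "P z \<in> \<Union>\<W>" using cover by (simp add: open_cover_def topspace_curve_product)
    then show ?thesis unfolding Wx_def by (metis (mono_tags, lifting) UnionE someI_ex)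
  qed
  have \<kappa>x: "\<exists>V. chart j V (\<kappa>x (P z)) \<and> P z \<in> V" for z
  proof -
    have "\<exists>\<kappa> V. chart j V \<kappa> \<and> P z \<in> V" using chart_exists by blast
    then show ?thesis unfolding \<kappa>x_def by (rule someI_ex[of "\<lambda>\<kappa>. \<exists>V. chart j V \<kappa> \<and> P z \<in> V"])
  qed
  \<comment> \<open>The local expressions agree on overlaps and glue to one function on the product;
    \<open>F (P z)\<close> is therefore periodic.\<close>
  define F where "F x = cnj (branch i (r (Wx x)) x) - \<tau> (Wx x) x (\<kappa>x x)" for x
  have F: "F (P z) = cnj (branch i (r W) (P z)) - \<tau> W (P z) \<kappa>"
    if "W \<in> \<W>" "P z \<in> W" "chart j V \<kappa>" "P z \<in> V" for W z V \<kappa>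
  proof -
    obtain V' where V': "chart j V' (\<kappa>x (P z))" "P z \<in> V'" using \<kappa>x by blast
    have "F (P z) = cnj (branch i (r W) (P z)) - \<tau> W (P z) (\<kappa>x (P z))"
      unfolding F_def using indep_W[OF _ that(1) _ that(2) V'] Wx by blast
    also have "\<tau> W (P z) (\<kappa>x (P z)) = \<tau> W (P z) \<kappa>" by (rule indep_chart[OF that(1,2) V' that(3,4)])
    finally show ?thesis .
  qed
  \<comment> \<open>Locally the conjugate cancels against the branch up to a constant, leaving the
    holomorphic function \<open>\<tau> W0\<close> applied to a coordinate branch.\<close>
  have "cdiff_on (\<lambda>z. cnj (z $ i) - F (P z)) UNIV"
  proof (rule cdiff_on_local)
    fix z0
    define W0 where "W0 = Wx (P z0)"
    have W0: "W0 \<in> \<W>" "P z0 \<in> W0" using Wx by (auto simp: W0_def)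
    obtain V \<kappa> where V: "chart j V \<kappa>" "P z0 \<in> V" using chart_exists by blast
    have "P z0 \<in> r W0" using W W0 by blast
    then obtain N l where N: "open N" "z0 \<in> N" "\<And>w. w \<in> N \<Longrightarrow> branch i (r W0) (P w) = w $ i - l"
      using charts[OF W0(1)] by (auto elim: chartE)
    have op: "openin (ctop X) (W0 \<inter> V)"
      using cover W0(1) V(1) by (auto simp: open_cover_def chart_def)
    have "cdiff_on (\<lambda>z. \<kappa> (P z)) {z. P z \<in> V}" using chart_holomorphic[OF V(1)] by (simp add: hol_curve_product)
    then have "\<kappa> \<in> hol X (W0 \<inter> V)" unfolding hol_curve_product by (rule cdiff_on_subset) auto
    then have "(\<lambda>x. \<tau> W0 x \<kappa>) \<in> hol X (W0 \<inter> V)" using W[OF W0(1)] op by (simp add: vector_field_def)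
    then have cd: "cdiff_on (\<lambda>z. \<tau> W0 (P z) \<kappa>) {z. P z \<in> W0 \<inter> V}" by (simp add: hol_curve_product)
    have "open {z. P z \<in> W0 \<inter> V}" using op by (simp add: openin_curve_product)
    moreover have "cdiff_on (\<lambda>z. cnj l + \<tau> W0 (P z) \<kappa>) (N \<inter> {z. P z \<in> W0 \<inter> V})"
      by (intro cdiff_on_add cdiff_on_const cdiff_on_subset[OF cd]) auto
    moreover have "cnj (w $ i) - F (P w) = cnj l + \<tau> W0 (P w) \<kappa>" if "w \<in> N \<inter> {z. P z \<in> W0 \<inter> V}" for w
      using F[OF W0(1) _ V(1), of w] N(3)[of w] that by simp
    ultimately show "\<exists>Y g. open Y \<and> z0 \<in> Y \<and> cdiff_on g Y \<and> (\<forall>w\<in>Y. cnj (w $ i) - F (P w) = g w)"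
      using N W0 V by (intro exI[of _ "N \<inter> {z. P z \<in> W0 \<inter> V}"] exI[of _ "\<lambda>z. cnj l + \<tau> W0 (P z) \<kappa>"]) auto
  qed
  \<comment> \<open>Restricting to the \<open>i\<close>-th axis reduces to one variable; there
    \<open>F\<close> is periodic under \<open>\<Lambda> i\<close>, and continuity bounds it.\<close>
  then have "(\<lambda>t. cnj ((0 + t *s axis i 1) $ i) - F (P (0 + t *s axis i 1))) holomorphic_on UNIV"
    by (rule slice_holomorphic) auto
  then have hol: "(\<lambda>t. cnj t - F (P (t *s axis i 1))) holomorphic_on UNIV" (is "?s holomorphic_on _")
    by (simp add: axis_def)
  define q where "q t = F (P (t *s axis i 1))" for t
  have per: "q (t + l) = q t" if "l \<in> \<Lambda> i" for t l
  proof -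
    have "P (t *s axis i 1 + l *s axis i 1) = P (t *s axis i 1)"
      by (rule coset_map_add) (use that in \<open>auto simp: axis_def\<close>)
    then show ?thesis by (simp add: q_def vector_sadd_rdistrib)
  qed
  have "continuous_on UNIV (\<lambda>t. cnj t - ?s t)"
    by (intro continuous_intros holomorphic_on_imp_continuous_on hol)
  then have cont: "continuous_on UNIV q" by (simp add: q_def)
  obtain M where M: "\<And>z. \<exists>l\<in>\<Lambda> i. norm (z - l) \<le> M" using E.bounded_representatives by blast
  have "compact (q ` cball 0 M)" by (intro compact_continuous_image continuous_on_subset[OF cont]) auto
  then obtain C where C: "\<And>t. t \<in> cball 0 M \<Longrightarrow> norm (q t) \<le> C"
    using compact_imp_bounded bounded_iff by (metis imageI)
  have qC: "norm (q t) \<le> C" for t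
  proof -
    obtain l where l: "l \<in> \<Lambda> i" "norm (t - l) \<le> M" using M by blast
    have "q t = q (t - l)" using per[OF l(1), of "t - l"] by simp
    then show ?thesis using C[of "t - l"] l(2) by simp
  qed
  have "norm (?s t) \<le> (1 + \<bar>C\<bar>) * norm t ^ 1" if "1 \<le> norm t" for t
  proof -
    have "norm (?s t) \<le> norm (cnj t) + norm (q t)" unfolding q_def by (rule norm_triangle_ineq4)
    also have "\<dots> \<le> norm t + \<bar>C\<bar> * 1" using qC[of t] by simp
    also have "\<dots> \<le> norm t + \<bar>C\<bar> * norm t" using that by (intro add_left_mono mult_left_mono) auto
    finally show ?thesis by (simp add: algebra_simps)
  qed
  then have lin: "?s t = (\<Sum>k\<le>1. (deriv ^^ k) ?s 0 / fact k * t ^ k)" for t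
    by (rule Liouville_polynomial[OF hol])
  define a where "a = deriv ?s 0"
  have "?s t = ?s 0 + a * t" for t by (subst lin) (simp add: a_def)
  then have affine: "cnj l - q l = - q 0 + a * l" for l by (simp add: q_def)
  have "cnj l = a * l" if "l \<in> \<Lambda> i" for l
  proof -
    have ql: "q l = q 0" using per[OF that, of 0] by simp
    have "cnj l = (- q 0 + a * l) + q l" using affine[of l] by (metis diff_add_cancel)
    then show ?thesis unfolding ql by simp
  qed
  then show False using E.not_conjugate_scaling by blast
qed

text \<open>Pushing forward multiplies \<open>dvec j\<close> by \<open>a j\<close> and divides the
  differences of conjugated branches by \<open>cnj (a i)\<close>; the assumption makes the factors
  cancel. What remains is a change of branches, which is a coboundary.\<close>

lemma conj_cocycle_push:
  assumes aut: "sheaf_automorphism X g h"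
    and lift: "\<And>z. g (P z) = P (\<chi> k. a k * z $ k + b k)"
    and a: "\<And>k. a k \<noteq> 0" "\<And>l. l \<in> \<Lambda> i \<Longrightarrow> a i * l \<in> \<Lambda> i" "a j = cnj (a i)"
  shows "(conj_cocycle i j, push_cocycle X g (conj_cocycle i j)) \<in> cohomologous X"
proof -
  interpret aut: sheaf_automorphism X g h by (rule aut)
  define A where "A z = (\<chi> k. a k * z $ k + b k)" for z :: "complex ^ 'n"
  define B where "B z = (\<chi> k. (z $ k - b k) / a k)" for z :: "complex ^ 'n"
  have AB: "A (B z) = z" "B (A z) = z" for z using a(1) by (simp_all add: A_def B_def vec_eq_iff)
  have gP: "g (P z) = P (A z)" for z by (simp add: lift A_def)
  have hP: "h (P z) = P (B z)" for z
    using gP[of "B z"] aut.hg[of "P (B z)"] by (simp add: AB topspace_curve_product)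
  have contB: "continuous_on UNIV B"
    unfolding B_def by (intro continuous_on_vec_lambda continuous_intros) (use a in auto)
  \<comment> \<open>Transporting a branch by the affine map gives again a branch on the image,
    because \<open>a i\<close> preserves the lattice \<open>\<Lambda> i\<close>.\<close>
  have chart_push: "chart i (g ` U) (\<lambda>y. a i * \<sigma> (h y) + b i)" if c: "chart i U \<sigma>" for U \<sigma>
    unfolding chart_def
  proof (intro conjI allI impI)
    have US: "U \<subseteq> topspace (ctop X)" "openin (ctop X) U" using c by (auto simp: chart_def openin_subset)
    then show "openin (ctop X) (g ` U)" by (intro aut.openin_image_g)
    fix z assume "P z \<in> g ` U"
    then have "P (B z) \<in> U" using aut.h_mem_of_image[OF US(1)] hP by metis
    then obtain N l where N: "open N" "B z \<in> N" "l \<in> \<Lambda> i" "\<And>w. w \<in> N \<Longrightarrow> \<sigma> (P w) = w $ i - l"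
      using c by (auto elim: chartE)
    have "open (B -` N)" using contB N(1) by (intro open_vimage)
    then obtain e where e: "e > 0" "ball z e \<subseteq> B -` N" using N(2) by (meson open_contains_ball vimageI)
    have "a i * \<sigma> (h (P w)) + b i = w $ i - a i * l" if "w \<in> ball z e" for w
    proof -
      have "\<sigma> (h (P w)) = (w $ i - b i) / a i - l" using N(4)[of "B w"] that e(2) by (auto simp: hP B_def)
      then show ?thesis using a(1)[of i] by (simp add: field_simps)
    qed
    then show "\<exists>e>0. \<exists>l\<in>\<Lambda> i. \<forall>w\<in>ball z e. P w \<in> g ` U \<longrightarrow> a i * \<sigma> (h (P w)) + b i = w $ i - l"
      using e(1) a(2)[OF N(3)] by blast
  qed
  have dvec_push: "dvec j (h y) (f \<circ> g) = a j * dvec j y f" if y: "y \<in> range P" "f \<in> germs X y" for y f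
  proof -
    obtain w where w: "y = P w" using y by blast
    have Aw: "A (B w + t *s axis j 1) = w + (a j * t) *s axis j 1" for t
      using a(1) by (auto simp: A_def B_def vec_eq_iff axis_def field_simps)
    have "((\<lambda>t. f (P (w + t *s axis j 1))) has_field_derivative dvec j (P w) f) (at (a j * 0))"
      using germ_slice[of f w "axis j 1"] y(2) unfolding w dvec_coset_map
      by (simp add: field_differentiable_derivI)
    then have "((\<lambda>t. f (P (w + (a j * t) *s axis j 1))) has_field_derivative dvec j (P w) f * a j) (at 0)"
      by (rule DERIV_chain2) (auto intro!: derivative_eq_intros)
    then have "deriv (\<lambda>t. f (P (w + (a j * t) *s axis j 1))) 0 = dvec j (P w) f * a j"
      by (rule DERIV_imp_deriv)
    then show ?thesis by (simp add: w hP dvec_coset_map gP Aw mult.commute)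
  qed
  define \<W> where "\<W> = {U \<inter> g ` V | U V. U \<in> chart_domains i \<and> V \<in> chart_domains i}"
  have "\<forall>W\<in>\<W>. \<exists>U V. U \<in> chart_domains i \<and> V \<in> chart_domains i \<and> W = U \<inter> g ` V"
    unfolding \<W>_def by blast
  then obtain p q where pq: "\<And>W. W \<in> \<W> \<Longrightarrow> p W \<in> chart_domains i \<and> q W \<in> chart_domains i \<and> W = p W \<inter> g ` q W"
    by metis
  have dom: "U \<subseteq> topspace (ctop X)" if "U \<in> chart_domains i" for U
    using chart_domain_subset[OF that] by (simp add: topspace_curve_product)
  \<comment> \<open>The conjugated difference between the chosen branch at \<open>y\<close> and the
    transported one; being a difference of two branches it is a holomorphic coefficient.\<close>
  define \<tau> where "\<tau> W y f = (cnj (branch i (p W) y) - cnj (a i * branch i (q W) (h y) + b i)) * dvec j y f" for W y f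
  let ?\<theta> = "\<lambda>U V x f. (cnj (branch i V x) - cnj (branch i U x)) * dvec j x f"
  have coc: "(chart_domains i, ?\<theta>) \<in> cocycles X" using conj_cocycle_mem unfolding conj_cocycle_def .
  show ?thesis unfolding conj_cocycle_def push_cocycle_def prod.case
  proof (rule cohomologousI[OF coc, where \<W> = \<W> and r = p and s = "\<lambda>W. g ` q W" and \<tau> = \<tau>])
    show "((`) g ` chart_domains i, \<lambda>U V. push_vfield X g (?\<theta> (pre X g U) (pre X g V))) \<in> cocycles X"
      using aut.push_cocycle_mem[OF coc] unfolding push_cocycle_def prod.case .
    show "open_cover X \<W>"
    proof -
      have op: "openin (ctop X) U" if "U \<in> chart_domains i" for U
        using that by (auto simp: chart_domains_def chart_def)
      have "\<Union>\<W> = \<Union>(chart_domains i) \<inter> g ` \<Union>(chart_domains i)" unfolding \<W>_def by blast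
      then show ?thesis
        using open_cover_charts[of i] aut.image_g_space op aut.openin_image_g
        unfolding open_cover_def \<W>_def by auto
    qed
    show "p W \<in> chart_domains i \<and> W \<subseteq> p W \<and> g ` q W \<in> (`) g ` chart_domains i \<and> W \<subseteq> g ` q W \<and> vector_field X W (\<tau> W)"
      if W: "W \<in> \<W>" for W
    proof -
      have "vector_field X W (\<tau> W)" unfolding \<tau>_def
        by (rule vector_field_chart_diff[OF chart_branch chart_push[OF chart_branch]]) (use pq[OF W] in auto)
      then show ?thesis using pq[OF W] by blast
    qed
    fix W W' y f assume W: "W \<in> \<W>" "W' \<in> \<W>" "y \<in> W \<inter> W'" "f \<in> germs X y"
    have yP: "y \<in> range P" using pq[OF W(1)] W(3) chart_domain_subset by blast
    then have yS: "y \<in> topspace (ctop X)" by (simp add: topspace_curve_product)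
    have "push_vfield X g (?\<theta> (pre X g (g ` q W)) (pre X g (g ` q W'))) y f
      = (cnj (branch i (q W') (h y)) - cnj (branch i (q W) (h y))) * (cnj (a i) * dvec j y f)"
      using pq[OF W(1)] pq[OF W(2)] dvec_push[OF yP W(4)] a(3)
      by (simp add: push_vfield_def aut.inv_into_g[OF yS] aut.pre_image_g dom)
    then show "?\<theta> (p W) (p W') y f - push_vfield X g (?\<theta> (pre X g (g ` q W)) (pre X g (g ` q W'))) y f
      = \<tau> W' y f - \<tau> W y f"
      by (simp add: \<tau>_def algebra_simps)
  qed
qed

end

section \<open>Lattices that are modules over a Euclidean ring\<close>

text \<open>
  Adjoin one coordinate at a time: the new basis vector almost minimizes the modulus of its last
  coordinate, so that division with remainder makes the last coordinate of any other vector vanish.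
\<close>

lemma triangular_basis:
  fixes L :: "(complex ^ 'n::finite) set" and R :: "complex set"
  assumes L_diff: "\<And>u v. u \<in> L \<Longrightarrow> v \<in> L \<Longrightarrow> u - v \<in> L"
    and L_scale: "\<And>q v. q \<in> R \<Longrightarrow> v \<in> L \<Longrightarrow> q *s v \<in> L"
    and euclid: "0 < c" "c < 1" "\<And>z. \<exists>q\<in>R. norm (z - q) \<le> c"
    and discrete: "0 < e" "\<And>v k. v \<in> L \<Longrightarrow> v $ k \<noteq> 0 \<Longrightarrow> e \<le> norm (v $ k)"
    and full: "\<And>k. \<exists>v\<in>L. v $ k \<noteq> 0 \<and> (\<forall>m. m \<noteq> k \<longrightarrow> v $ m = 0)"
    and fin: "finite S"
  shows "\<exists>v :: 'n \<Rightarrow> complex ^ 'n. (\<forall>k\<in>S. v k \<in> L \<and> (\<forall>m. m \<notin> S \<longrightarrow> v k $ m = 0)) \<and>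
    (\<forall>x\<in>L. (\<forall>m. m \<notin> S \<longrightarrow> x $ m = 0) \<longrightarrow> (\<exists>a. (\<forall>k\<in>S. a k \<in> R) \<and> x = (\<Sum>k\<in>S. a k *s v k))) \<and>
    (\<forall>a. (\<Sum>k\<in>S. a k *s v k) = 0 \<longrightarrow> (\<forall>k\<in>S. a k = 0))"
  using fin
proof (induction S rule: finite_induct)
  case empty
  then show ?case by (auto simp: vec_eq_iff)
next
  case (insert j S)
  from insert.IH obtain v where
    V: "\<forall>k\<in>S. v k \<in> L \<and> (\<forall>m. m \<notin> S \<longrightarrow> v k $ m = 0)"
      "\<forall>x\<in>L. (\<forall>m. m \<notin> S \<longrightarrow> x $ m = 0) \<longrightarrow> (\<exists>a. (\<forall>k\<in>S. a k \<in> R) \<and> x = (\<Sum>k\<in>S. a k *s v k))"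
      "\<forall>a. (\<Sum>k\<in>S. a k *s v k) = 0 \<longrightarrow> (\<forall>k\<in>S. a k = 0)"
    by (elim exE conjE)
  have v: "\<And>k. k \<in> S \<Longrightarrow> v k \<in> L" "\<And>k m. k \<in> S \<Longrightarrow> m \<notin> S \<Longrightarrow> v k $ m = 0" using V(1) by auto
  note rep = V(2)[THEN bspec, THEN mp, OF _ allI, OF _ impI] and ind = V(3)[THEN spec, THEN mp]
  define Q where "Q = {x \<in> L. \<forall>m. m \<notin> insert j S \<longrightarrow> x $ m = 0}"
  define I where "I = (\<lambda>x. norm (x $ j)) ` {x \<in> Q. x $ j \<noteq> 0}"
  obtain y where y: "y \<in> L" "y $ j \<noteq> 0" "\<And>m. m \<noteq> j \<Longrightarrow> y $ m = 0" using full by blast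
  then have "y \<in> Q" by (auto simp: Q_def)
  then have ne: "I \<noteq> {}" using y by (auto simp: I_def)
  have lower: "e \<le> i" if "i \<in> I" for i using that discrete(2) by (auto simp: I_def Q_def)
  then have bdd: "bdd_below I" by (auto simp: bdd_below_def)
  have m: "Inf I > 0" using cInf_greatest[OF ne lower] discrete(1) by linarith
  \<comment> \<open>Any value below \<open>Inf I / c\<close> suffices: a remainder is at most
    \<open>c\<close> times it, so it lies below \<open>Inf I\<close> and must vanish. Discreteness
    is what makes \<open>Inf I\<close> positive.\<close>
  then have "Inf I < Inf I / c" using euclid by (simp add: field_simps)
  then obtain i where i: "i \<in> I" "i < Inf I / c" using cInf_lessD[OF ne] by blast
  then obtain x0 where x0: "x0 \<in> Q" "x0 $ j \<noteq> 0" "norm (x0 $ j) < Inf I / c" by (auto simp: I_def)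
  define v' where "v' = v(j := x0)"
  have sum': "(\<Sum>k\<in>insert j S. a k *s v' k) = a j *s x0 + (\<Sum>k\<in>S. a k *s v k)" for a
  proof -
    have "(\<Sum>k\<in>S. a k *s v' k) = (\<Sum>k\<in>S. a k *s v k)"
      by (rule sum.cong) (use insert.hyps in \<open>auto simp: v'_def\<close>)
    then show ?thesis using insert.hyps by (simp add: v'_def)
  qed
  have 1: "v' k \<in> L \<and> (\<forall>m. m \<notin> insert j S \<longrightarrow> v' k $ m = 0)" if "k \<in> insert j S" for k
    using that v x0(1) by (auto simp: v'_def Q_def)
  have 2: "\<exists>a. (\<forall>k\<in>insert j S. a k \<in> R) \<and> x = (\<Sum>k\<in>insert j S. a k *s v' k)"
    if x: "x \<in> L" "\<forall>m. m \<notin> insert j S \<longrightarrow> x $ m = 0" for x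
  proof -
    obtain q where q: "q \<in> R" "norm (x $ j / x0 $ j - q) \<le> c" using euclid(3) by blast
    define y where "y = x - q *s x0"
    have yL: "y \<in> L" using x x0(1) q(1) L_diff L_scale by (simp add: y_def Q_def)
    have yQ: "y \<in> Q" using yL x x0(1) by (auto simp: y_def Q_def)
    have "y $ j = (x $ j / x0 $ j - q) * x0 $ j" using x0(2) by (simp add: y_def field_simps)
    then have "norm (y $ j) \<le> c * norm (x0 $ j)" using q(2) by (simp add: norm_mult mult_right_mono)
    also have "\<dots> < Inf I" using x0(3) euclid(1) by (simp add: field_simps)
    finally have "norm (y $ j) < Inf I" .
    then have yj: "y $ j = 0"
      using cInf_lower[OF _ bdd, of "norm (y $ j)"] yQ by (force simp: I_def)
    have "\<exists>a. (\<forall>k\<in>S. a k \<in> R) \<and> y = (\<Sum>k\<in>S. a k *s v k)"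
    proof (rule rep[OF yL])
      fix m assume "m \<notin> S"
      then show "y $ m = 0" using yj yQ by (cases "m = j") (auto simp: Q_def)
    qed
    then obtain a where a: "\<forall>k\<in>S. a k \<in> R" "y = (\<Sum>k\<in>S. a k *s v k)" by blast
    have "(\<Sum>k\<in>S. (a(j := q)) k *s v k) = y"
      unfolding a(2) by (rule sum.cong) (use insert.hyps in auto)
    then have "x = (\<Sum>k\<in>insert j S. (a(j := q)) k *s v' k)"
      unfolding sum' by (simp add: y_def)
    moreover have "\<forall>k\<in>insert j S. (a(j := q)) k \<in> R" using a(1) q(1) by auto
    ultimately show ?thesis by blast
  qed
  have 3: "\<forall>k\<in>insert j S. a k = 0" if "(\<Sum>k\<in>insert j S. a k *s v' k) = 0" for a
  proof -
    have eq: "a j *s x0 + (\<Sum>k\<in>S. a k *s v k) = 0" using that unfolding sum' .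
    have "(\<Sum>k\<in>S. a k *s v k) $ j = 0"
      using v(2) insert.hyps by (auto simp: sum_component intro!: sum.neutral)
    moreover have "(a j *s x0 + (\<Sum>k\<in>S. a k *s v k)) $ j = 0" unfolding eq by simp
    ultimately have "a j = 0" using x0(2) by simp
    then show ?thesis using eq ind[of a] by simp
  qed
  show ?case
  proof (rule exI[of _ v'], intro conjI)
    show "\<forall>k\<in>insert j S. v' k \<in> L \<and> (\<forall>m. m \<notin> insert j S \<longrightarrow> v' k $ m = 0)"
      by (rule ballI, rule 1)
    show "\<forall>x\<in>L. (\<forall>m. m \<notin> insert j S \<longrightarrow> x $ m = 0) \<longrightarrow>
        (\<exists>a. (\<forall>k\<in>insert j S. a k \<in> R) \<and> x = (\<Sum>k\<in>insert j S. a k *s v' k))"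
      by (rule ballI, rule impI, rule 2)
    show "\<forall>a. (\<Sum>k\<in>insert j S. a k *s v' k) = 0 \<longrightarrow> (\<forall>k\<in>insert j S. a k = 0)"
      by (rule allI, rule impI, rule 3)
  qed
qed

text \<open>The basis of \<open>L\<close> over \<open>R\<close> is independent over the complex
  numbers, so sending the standard basis to it is an automorphism \<open>M\<close> of the vector
  space; its inverse \<open>N\<close> carries \<open>L\<close> onto the vectors with coordinates in
  \<open>R\<close>.\<close>

lemma module_lattice_basis:
  fixes L :: "(complex ^ 'n::finite) set" and R :: "complex set"
  assumes L_diff: "\<And>u v. u \<in> L \<Longrightarrow> v \<in> L \<Longrightarrow> u - v \<in> L"
    and L_scale: "\<And>q v. q \<in> R \<Longrightarrow> v \<in> L \<Longrightarrow> q *s v \<in> L"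
    and euclid: "0 < c" "c < 1" "\<And>z. \<exists>q\<in>R. norm (z - q) \<le> c"
    and discrete: "0 < e" "\<And>v k. v \<in> L \<Longrightarrow> v $ k \<noteq> 0 \<Longrightarrow> e \<le> norm (v $ k)"
    and full: "\<And>k. \<exists>v\<in>L. v $ k \<noteq> 0 \<and> (\<forall>m. m \<noteq> k \<longrightarrow> v $ m = 0)"
  obtains N M :: "complex ^ 'n \<Rightarrow> complex ^ 'n" where "linear N" "linear M"
    "\<And>a z. N (a *s z) = a *s N z" "\<And>a z. M (a *s z) = a *s M z"
    "\<And>z. N (M z) = z" "\<And>z. M (N z) = z" "\<And>z. z \<in> L \<longleftrightarrow> (\<forall>k. N z $ k \<in> R)"
proof -
  obtain v :: "'n \<Rightarrow> complex ^ 'n" where v: "\<And>k. v k \<in> L"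
    and rep: "\<And>x. x \<in> L \<Longrightarrow> \<exists>a. (\<forall>k. a k \<in> R) \<and> x = (\<Sum>k\<in>UNIV. a k *s v k)"
    and ind: "\<And>a k. (\<Sum>k\<in>UNIV. a k *s v k) = 0 \<Longrightarrow> a k = 0"
  proof -
    have "\<exists>v :: 'n \<Rightarrow> complex ^ 'n. (\<forall>k\<in>UNIV. v k \<in> L \<and> (\<forall>m. m \<notin> UNIV \<longrightarrow> v k $ m = 0)) \<and>
        (\<forall>x\<in>L. (\<forall>m. m \<notin> UNIV \<longrightarrow> x $ m = 0) \<longrightarrow> (\<exists>a. (\<forall>k\<in>UNIV. a k \<in> R) \<and> x = (\<Sum>k\<in>UNIV. a k *s v k))) \<and>
        (\<forall>a. (\<Sum>k\<in>UNIV. a k *s v k) = 0 \<longrightarrow> (\<forall>k\<in>UNIV. a k = 0))"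
    proof (rule triangular_basis)
      show "finite (UNIV :: 'n set)" by simp
    qed (fact assms)+
    then obtain v :: "'n \<Rightarrow> complex ^ 'n" where
      V: "\<forall>k\<in>UNIV. v k \<in> L \<and> (\<forall>m. m \<notin> UNIV \<longrightarrow> v k $ m = 0)"
        "\<forall>x\<in>L. (\<forall>m. m \<notin> UNIV \<longrightarrow> x $ m = 0) \<longrightarrow> (\<exists>a. (\<forall>k\<in>UNIV. a k \<in> R) \<and> x = (\<Sum>k\<in>UNIV. a k *s v k))"
        "\<forall>a. (\<Sum>k\<in>UNIV. a k *s v k) = 0 \<longrightarrow> (\<forall>k\<in>UNIV. a k = 0)"
      by (elim exE conjE)
    show thesis by (rule that[of v]) (use V in auto)
  qed
  define M where "M z = (\<Sum>k\<in>UNIV. z $ k *s v k)" for z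
  have Madd: "M (x + y) = M x + M y" for x y
    by (simp add: M_def vector_sadd_rdistrib sum.distrib)
  have Mscale: "M (a *s z) = a *s M z" for a z
    by (simp add: M_def vec_eq_iff sum_component sum_distrib_left mult.assoc)
  have linM: "linear M"
  proof (rule linearI)
    fix r :: real and z :: "complex ^ 'n"
    have sc: "r *\<^sub>R u = of_real r *s u" for u :: "complex ^ 'n"
      unfolding vec_eq_iff vector_scaleR_component vector_smult_component
      by (simp add: scaleR_conv_of_real)
    show "M (r *\<^sub>R z) = r *\<^sub>R M z" unfolding sc by (rule Mscale)
  qed (rule Madd)
  have injM: "inj M"
    unfolding linear_injective_0[OF linM]
  proof (intro allI impI)
    fix z assume "M z = 0"
    then have "z $ k = 0" for k using ind[of "\<lambda>k. z $ k"] by (simp add: M_def)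
    then show "z = 0" by (simp add: vec_eq_iff)
  qed
  obtain N where N: "linear N" "\<And>z. N (M z) = z" "\<And>z. M (N z) = z"
    using linear_injective_isomorphism[OF linM injM] by blast
  have Nscale: "N (a *s z) = a *s N z" for a z
    by (metis Mscale N(2,3))
  obtain q0 where q0: "q0 \<in> R" using euclid(3) by blast
  have zero: "0 \<in> L" using L_diff[OF v[of undefined] v[of undefined]] by simp
  have add: "x + y \<in> L" if "x \<in> L" "y \<in> L" for x y
    using L_diff[OF that(1) L_diff[OF zero that(2)]] by simp
  have "M z \<in> L" if "\<And>k. z $ k \<in> R" for z :: "complex ^ 'n"
  proof -
    have "(\<Sum>k\<in>S. z $ k *s v k) \<in> L" if "finite S" for S
      using that by induction (use \<open>\<And>k. z $ k \<in> R\<close> v in \<open>auto intro: add zero L_scale\<close>)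
    then show ?thesis by (simp add: M_def)
  qed
  then have "z \<in> L" if "\<forall>k. N z $ k \<in> R" for z using that N(3)[of z] by metis
  moreover have "\<forall>k. N z $ k \<in> R" if z: "z \<in> L" for z
  proof -
    obtain a where a: "\<forall>k. a k \<in> R" "z = (\<Sum>k\<in>UNIV. a k *s v k)" using rep[OF z] by blast
    then have "z = M (\<chi> k. a k)" by (simp add: M_def)
    then have "N z = (\<chi> k. a k)" using N(2) by simp
    then show ?thesis using a(1) by simp
  qed
  ultimately show ?thesis using that[OF N(1) linM Nscale Mscale N(2,3)] by blast
qed

text \<open>Rounding both coordinates gives squared distance at most 1/2. The weaker bound is the
  one shared with the Eisenstein integers, so that a single constant serves both rings.\<close>

lemma gaussian_euclid: "\<exists>q\<in>quadratic_ring \<i>. norm (z - q) \<le> sqrt 3 / 2"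
proof
  define m n where "m = round (Re z)" and "n = round (Im z)"
  show "of_int m + of_int n * \<i> \<in> quadratic_ring \<i>" by (auto simp: quadratic_ring_def)
  have "\<bar>Re z - m\<bar> \<le> 1/2" "\<bar>Im z - n\<bar> \<le> 1/2"
    unfolding m_def n_def using of_int_round_abs_le by (metis abs_minus_commute)+
  then have "\<bar>Re z - m\<bar>\<^sup>2 \<le> (1/2)\<^sup>2" "\<bar>Im z - n\<bar>\<^sup>2 \<le> (1/2)\<^sup>2" by (intro power_mono; simp)+
  then have "(Re z - m)\<^sup>2 + (Im z - n)\<^sup>2 \<le> 3/4" by (simp add: power2_eq_square)
  then have "sqrt ((Re z - m)\<^sup>2 + (Im z - n)\<^sup>2) \<le> sqrt (3/4)" by (rule real_sqrt_le_mono)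
  then show "norm (z - (of_int m + of_int n * \<i>)) \<le> sqrt 3 / 2" by (simp add: cmod_def real_sqrt_divide)
qed

lemma zeta_3: "zeta 3 = Complex (- 1/2) (sqrt 3 / 2)"
proof -
  have "zeta 3 = cis (2 * pi / 3)" by (simp add: zeta_def cis_conv_exp mult_ac)
  then show ?thesis by (simp add: complex_eq_iff cos_120 sin_120)
qed

text \<open>Round the coordinates \<open>x\<close>, \<open>y\<close> of \<open>z\<close> in the
  basis \<open>1\<close>, \<open>zeta 3\<close>. The norm form \<open>a^2 - a * b + b^2\<close> is
  at most 3/4 when both errors are at most 1/2.\<close>

lemma eisenstein_euclid: "\<exists>q\<in>quadratic_ring (zeta 3). norm (z - q) \<le> sqrt 3 / 2"
proof
  define y where "y = 2 * Im z / sqrt 3"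
  define x where "x = Re z + y / 2"
  define m n where "m = round x" and "n = round y"
  show "of_int m + of_int n * zeta 3 \<in> quadratic_ring (zeta 3)" by (auto simp: quadratic_ring_def)
  define a b where "a = x - m" and "b = y - n"
  have "\<bar>a\<bar> \<le> 1/2" "\<bar>b\<bar> \<le> 1/2"
    unfolding a_def b_def m_def n_def using of_int_round_abs_le by (metis abs_minus_commute)+
  then have "\<bar>a\<bar>\<^sup>2 \<le> (1/2)\<^sup>2" "\<bar>b\<bar>\<^sup>2 \<le> (1/2)\<^sup>2" "\<bar>a\<bar> * \<bar>b\<bar> \<le> 1/2 * (1/2)"
    by (intro power_mono mult_mono; simp)+
  moreover have "- (a * b) \<le> \<bar>a\<bar> * \<bar>b\<bar>" by (simp flip: abs_mult)
  ultimately have ab: "a\<^sup>2 - a * b + b\<^sup>2 \<le> 3/4" by (simp add: power2_eq_square)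
  have re: "Re (z - (of_int m + of_int n * zeta 3)) = a - b / 2"
    by (simp add: zeta_3 a_def b_def x_def field_simps)
  have "Im z = y * sqrt 3 / 2" by (simp add: y_def)
  then have im: "Im (z - (of_int m + of_int n * zeta 3)) = b * sqrt 3 / 2"
    by (simp add: zeta_3 b_def field_simps)
  have "(a - b / 2)\<^sup>2 + (b * sqrt 3 / 2)\<^sup>2 = a\<^sup>2 - a * b + b\<^sup>2"
    by (simp add: power2_eq_square field_simps)
  then have "sqrt ((a - b / 2)\<^sup>2 + (b * sqrt 3 / 2)\<^sup>2) \<le> sqrt (3/4)"
    using ab by simp
  then show "norm (z - (of_int m + of_int n * zeta 3)) \<le> sqrt 3 / 2"
    unfolding cmod_def re im by (simp add: real_sqrt_divide)
qed

section \<open>Quotients of affine space\<close>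

text \<open>Topology and structure sheaf are both induced from affine space along
  \<open>\<pi>\<close>. The quotient by \<open>G\<close> and the model quotient both have this form,
  so they can be compared upstairs.\<close>

definition uniformized :: "'a cspace \<Rightarrow> (complex ^ 'n::finite \<Rightarrow> 'a) \<Rightarrow> bool" where
  "uniformized Y \<pi> \<longleftrightarrow>
     (\<forall>U. openin (ctop Y) U \<longleftrightarrow> U \<subseteq> range \<pi> \<and> open {z. \<pi> z \<in> U}) \<and>
     (\<forall>U f. f \<in> hol Y U \<longleftrightarrow> cdiff_on (\<lambda>z. f (\<pi> z)) {z. \<pi> z \<in> U})"

lemma uniformizedD:
  assumes "uniformized Y \<pi>"
  shows "openin (ctop Y) U \<longleftrightarrow> U \<subseteq> range \<pi> \<and> open {z. \<pi> z \<in> U}"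
    and "f \<in> hol Y U \<longleftrightarrow> cdiff_on (\<lambda>z. f (\<pi> z)) {z. \<pi> z \<in> U}"
  using assms unfolding uniformized_def by auto

lemma uniformized_topspace:
  assumes "uniformized Y \<pi>"
  shows "topspace (ctop Y) = range \<pi>"
proof
  show "topspace (ctop Y) \<subseteq> range \<pi>"
    using uniformizedD(1)[OF assms, of "topspace (ctop Y)"] openin_topspace by blast
  have "openin (ctop Y) (range \<pi>)" unfolding uniformizedD(1)[OF assms] by simp
  then show "range \<pi> \<subseteq> topspace (ctop Y)" by (rule openin_subset)
qed

lemma uniformized_holomorphic_map:
  assumes Y: "uniformized Y \<pi>" and Z: "uniformized Z \<pi>'"
    and A: "\<And>z. (A has_derivative D) (at z)" "\<And>c w. D (c *s w) = c *s D w"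
    and F: "\<And>z. F (\<pi> z) = \<pi>' (A z)"
  shows "holomorphic_map Y Z F"
proof -
  have contA: "continuous_on UNIV A"
    using A(1) by (meson continuous_at_imp_continuous_on has_derivative_continuous)
  have op: "open {z. \<pi>' (A z) \<in> U}" if "openin (ctop Z) U" for U
    using open_vimage[OF _ contA, of "{z. \<pi>' z \<in> U}"] that by (simp add: uniformizedD(1)[OF Z] vimage_def)
  have "f \<circ> F \<in> hol Y (pre Y F U)" if U: "openin (ctop Z) U" "f \<in> hol Z U" for U f
    unfolding uniformizedD(2)[OF Y] o_def F
  proof (rule cdiff_on_compose[OF _ _ A])
    show "cdiff_on (\<lambda>z. f (\<pi>' z)) {z. \<pi>' z \<in> U}" using U(2) by (simp add: uniformizedD(2)[OF Z])
    show "\<And>z. z \<in> {z. \<pi> z \<in> pre Y F U} \<Longrightarrow> A z \<in> {z. \<pi>' z \<in> U}" by (simp add: pre_def F)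
  qed
  moreover have "continuous_map (ctop Y) (ctop Z) F"
    unfolding continuous_map_def
  proof (intro conjI allI impI)
    show "F \<in> topspace (ctop Y) \<rightarrow> topspace (ctop Z)"
      by (auto simp: uniformized_topspace[OF Y] uniformized_topspace[OF Z] F)
    fix U assume "openin (ctop Z) U"
    from op[OF this] show "openin (ctop Y) {x \<in> topspace (ctop Y). F x \<in> U}"
      by (auto simp: uniformizedD(1)[OF Y] uniformized_topspace[OF Y] F)
  qed
  ultimately show ?thesis unfolding holomorphic_map_def by blast
qed

text \<open>An invertible map upstairs with constant complex-linear derivative descends as soon as
  it matches the fibers of the two projections.\<close>

lemma uniformized_biholomorphic:
  assumes Y: "uniformized Y \<pi>" and Z: "uniformized Z \<pi>'"
    and A: "\<And>z. (A has_derivative D) (at z)" "\<And>c w. D (c *s w) = c *s D w"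
    and B: "\<And>z. (B has_derivative D') (at z)" "\<And>c w. D' (c *s w) = c *s D' w"
    and AB: "\<And>z. A (B z) = z" "\<And>z. B (A z) = z"
    and eq: "\<And>z w. \<pi> z = \<pi> w \<longleftrightarrow> \<pi>' (A z) = \<pi>' (A w)"
  shows "biholomorphic Y Z"
proof -
  define F where "F c = \<pi>' (A (SOME z. \<pi> z = c))" for c
  define F' where "F' c = \<pi> (B (SOME z. \<pi>' z = c))" for c
  have F: "F (\<pi> z) = \<pi>' (A z)" for z
  proof -
    have "\<pi> (SOME w. \<pi> w = \<pi> z) = \<pi> z" by (rule someI[of _ z]) simp
    then show ?thesis unfolding F_def by (simp add: eq)
  qed
  have F': "F' (\<pi>' z) = \<pi> (B z)" for z
  proof -
    have "\<pi>' (SOME w. \<pi>' w = \<pi>' z) = \<pi>' z" by (rule someI[of _ z]) simp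
    then show ?thesis unfolding F'_def eq by (simp add: AB)
  qed
  have "holomorphic_map Y Z F" by (rule uniformized_holomorphic_map[OF Y Z A F])
  moreover have "holomorphic_map Z Y F'" by (rule uniformized_holomorphic_map[OF Z Y B F'])
  ultimately show ?thesis unfolding biholomorphic_def
    by (intro exI[of _ F] exI[of _ F'])
      (auto simp: uniformized_topspace[OF Y] uniformized_topspace[OF Z] F F' AB)
qed

lemma uniformized_group_quotient:
  assumes Y: "uniformized Y \<pi>"
  shows "uniformized (group_quotient H Y D) (\<lambda>z. orbit H D (\<pi> z))"
  unfolding uniformized_def
proof (intro conjI allI)
  fix U
  have eq: "{z. \<pi> z \<in> {x \<in> topspace (ctop Y). orbit H D x \<in> U}} = {z. orbit H D (\<pi> z) \<in> U}"
    "orbit H D ` topspace (ctop Y) = range (\<lambda>z. orbit H D (\<pi> z))"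
    "{x \<in> topspace (ctop Y). orbit H D x \<in> U} \<subseteq> range \<pi>"
    by (auto simp: uniformized_topspace[OF Y])
  show "openin (ctop (group_quotient H Y D)) U \<longleftrightarrow>
      U \<subseteq> range (\<lambda>z. orbit H D (\<pi> z)) \<and> open {z. orbit H D (\<pi> z) \<in> U}"
    unfolding group_quotient_def quotient_cspace_def cspace.simps openin_quotient_topology
      uniformizedD(1)[OF Y] eq(1,2) using eq(3) by blast
  fix f
  have "{z. \<pi> z \<in> pre Y (orbit H D) U} = {z. orbit H D (\<pi> z) \<in> U}"
    by (auto simp: pre_def uniformized_topspace[OF Y])
  then show "f \<in> hol (group_quotient H Y D) U \<longleftrightarrow>
      cdiff_on (\<lambda>z. f (orbit H D (\<pi> z))) {z. orbit H D (\<pi> z) \<in> U}"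
    by (simp add: group_quotient_def quotient_cspace_def uniformizedD(2)[OF Y])
qed

lemma (in curve_family) uniformized_curve_product: "uniformized X P"
  by (simp add: uniformized_def openin_curve_product hol_curve_product)

lemma orbit_eq_iff:
  assumes H: "group H" and x: "x \<in> Y" "y \<in> Y"
    and D: "\<And>g x. g \<in> carrier H \<Longrightarrow> x \<in> Y \<Longrightarrow> D g x \<in> Y" "\<And>x. x \<in> Y \<Longrightarrow> D \<one>\<^bsub>H\<^esub> x = x"
      "\<And>g h x. g \<in> carrier H \<Longrightarrow> h \<in> carrier H \<Longrightarrow> x \<in> Y \<Longrightarrow> D (g \<otimes>\<^bsub>H\<^esub> h) x = D g (D h x)"
  shows "orbit H D x = orbit H D y \<longleftrightarrow> (\<exists>g\<in>carrier H. D g x = y)"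
proof
  interpret group H by fact
  have "y \<in> orbit H D y" using D(2)[OF x(2)] by (auto simp: orbit_def intro!: exI[of _ "\<one>\<^bsub>H\<^esub>"])
  moreover assume "orbit H D x = orbit H D y"
  ultimately have "y \<in> orbit H D x" by simp
  then show "\<exists>g\<in>carrier H. D g x = y" by (auto simp: orbit_def)
next
  interpret group H by fact
  have sub: "orbit H D v \<subseteq> orbit H D u" if "u \<in> Y" "g \<in> carrier H" "D g u = v" for u v g
  proof
    fix w assume "w \<in> orbit H D v"
    then obtain h where "h \<in> carrier H" "w = D h v" by (auto simp: orbit_def)
    then have "w = D (h \<otimes>\<^bsub>H\<^esub> g) u" "h \<otimes>\<^bsub>H\<^esub> g \<in> carrier H" using that D(3) by auto
    then show "w \<in> orbit H D u" by (auto simp: orbit_def)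
  qed
  assume "\<exists>g\<in>carrier H. D g x = y"
  then obtain g where g: "g \<in> carrier H" "D g x = y" by blast
  have "D (inv\<^bsub>H\<^esub> g) y = D (inv\<^bsub>H\<^esub> g \<otimes>\<^bsub>H\<^esub> g) x" using D(3)[of "inv\<^bsub>H\<^esub> g" g x] g x by simp
  then have "D (inv\<^bsub>H\<^esub> g) y = x" using g x D(2) by simp
  then show "orbit H D x = orbit H D y"
    using sub[OF x(1) g] sub[OF x(2), of "inv\<^bsub>H\<^esub> g" x] g(1) by auto
qed

section \<open>Roots of unity\<close>

lemma zeta_pow_eq_1: "d > 0 \<Longrightarrow> zeta d ^ k = 1 \<longleftrightarrow> d dvd k"
proof -
  assume d: "d > 0"
  have "zeta d ^ k = exp (2 * of_real pi * \<i> * of_nat k / of_nat d)"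
    by (simp add: zeta_def mult_ac flip: exp_of_nat_mult)
  then show ?thesis using d complex_root_unity_eq_1[of d k] by simp
qed

lemma zeta_pow_self [simp]: "d > 0 \<Longrightarrow> zeta d ^ d = 1"
  by (simp add: zeta_pow_eq_1)

lemma root_of_unity_zeta:
  assumes "d > 0" "z ^ d = 1"
  obtains k where "k < d" "z = zeta d ^ k"
proof -
  have "z \<in> {z. z ^ d = 1}" using assms(2) by simp
  then obtain k where k: "k < d" "z = exp (2 * of_real pi * \<i> * of_nat k / of_nat d)"
    using complex_roots_unity[of d] assms(1) by auto
  then have "z = zeta d ^ k" by (simp add: zeta_def mult_ac flip: exp_of_nat_mult)
  then show ?thesis using that k(1) by blast
qed

text \<open>The second hypothesis on \<open>w\<close> makes it a primitive \<open>d\<close>-th root,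
  and 3, 4, 6 are exactly the orders with two primitive roots, inverse to each other.\<close>

lemma primitive_root_cases:
  assumes d: "d \<in> {3, 4, 6}" and w: "w ^ d = 1" "\<And>m. w ^ m = 1 \<Longrightarrow> zeta d ^ m = 1"
  shows "w = zeta d \<or> w * zeta d = 1"
proof -
  have d0: "d > 0" using d by auto
  obtain k where k: "k < d" "w = zeta d ^ k" using root_of_unity_zeta[OF d0 w(1)] .
  have wm: "d dvd k * m \<Longrightarrow> d dvd m" for m
    using w(2)[of m] zeta_pow_eq_1[OF d0] by (simp add: k(2) flip: power_mult)
  have "k \<in> {0, 1, 2, 3, 4, 5}" using d k(1) by auto
  \<comment> \<open>The exponents 1, 2, 3 suffice to expose every non-primitive \<open>k\<close>: 1
    for \<open>k = 0\<close>, 2 or 3 for a \<open>k\<close> sharing a factor with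
    \<open>d\<close>.\<close>
  then have "k = 1 \<or> k + 1 = d" using d k(1) wm[of 1] wm[of 2] wm[of 3] by auto
  then show ?thesis
  proof
    assume "k + 1 = d"
    then have "w * zeta d = zeta d ^ d" using k(2) by (metis Suc_eq_plus1 power_Suc2)
    then show ?thesis using d0 by simp
  qed (simp add: k(2))
qed

lemma zeta_4: "zeta 4 = \<i>"
proof -
  have "zeta 4 = cis (pi / 2)" by (simp add: zeta_def cis_conv_exp mult_ac)
  then show ?thesis by simp
qed

lemma zeta_6: "zeta 6 = zeta 3 + 1"
proof -
  have "zeta 6 = cis (pi / 3)" by (simp add: zeta_def cis_conv_exp mult_ac)
  then show ?thesis by (simp add: zeta_3 complex_eq_iff cos_60 sin_60)
qed

lemma zeta_3_quadratic: "(zeta 3)\<^sup>2 = - zeta 3 - 1"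
  by (simp add: zeta_3 complex_eq_iff power2_eq_square)

lemma quadratic_ring_mult_closed:
  assumes w: "w\<^sup>2 \<in> quadratic_ring w" and uv: "u \<in> quadratic_ring w" "v \<in> quadratic_ring w"
  shows "u * v \<in> quadratic_ring w"
proof -
  obtain m n where u: "u = of_int m + of_int n * w" using uv by (auto simp: quadratic_ring_def)
  obtain p q where v: "v = of_int p + of_int q * w" using uv by (auto simp: quadratic_ring_def)
  obtain r s where w2: "w * w = of_int r + of_int s * w" using w by (auto simp: quadratic_ring_def power2_eq_square)
  have "u * v = of_int m * of_int p + (of_int m * of_int q + of_int n * of_int p) * w + of_int n * of_int q * (w * w)"
    by (simp add: u v algebra_simps)
  also have "\<dots> = of_int (m * p + n * q * r) + of_int (m * q + n * p + n * q * s) * w"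
    unfolding w2 by (simp add: algebra_simps)
  finally show "u * v \<in> quadratic_ring w" unfolding quadratic_ring_def by blast
qed

lemma quadratic_ring_int: "of_int m + of_int n * w \<in> quadratic_ring w"
  unfolding quadratic_ring_def by blast

lemma complex_lattice_quadratic_ring:
  assumes "Im w \<noteq> 0"
  shows "complex_lattice (quadratic_ring w)"
  unfolding complex_lattice_def
proof (intro exI conjI)
  have "w \<notin> span {1}"
  proof
    assume "w \<in> span {1}"
    then obtain r where "w = r *\<^sub>R 1" by (auto simp: span_singleton)
    then show False using assms by simp
  qed
  then show "independent {1, w}"
    using assms by (subst insert_commute) (simp add: independent_insert)
  show "1 \<noteq> w" using assms by auto
  show "quadratic_ring w = {of_int m * 1 + of_int n * w | m n. True}" by (simp add: quadratic_ring_def)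
qed

text \<open>Treats the three values of \<open>d\<close> alike: the generator \<open>w\<close> of the
  ring is a power of \<open>zeta d\<close>, so a group stable under \<open>zeta d\<close> is a
  module over the ring. For \<open>d = 6\<close> that power is the square.\<close>

lemma quadratic_ring_data:
  assumes "d \<in> {3, 6} \<and> \<Gamma> = quadratic_ring (zeta 3) \<or> d = 4 \<and> \<Gamma> = quadratic_ring \<i>"
  obtains w k where "\<Gamma> = quadratic_ring w" "Im w \<noteq> 0" "w = zeta d ^ k" "w\<^sup>2 \<in> \<Gamma>" "zeta d \<in> \<Gamma>"
    "\<And>z. \<exists>q\<in>\<Gamma>. norm (z - q) \<le> sqrt 3 / 2"
proof -
  have im3: "Im (zeta 3) \<noteq> 0" by (simp add: zeta_3)
  have "(zeta 3)\<^sup>2 = of_int (- 1) + of_int (- 1) * zeta 3" by (simp add: zeta_3_quadratic)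
  then have sq3: "(zeta 3)\<^sup>2 \<in> quadratic_ring (zeta 3)" using quadratic_ring_int by metis
  have z3: "zeta 3 \<in> quadratic_ring (zeta 3)" using quadratic_ring_int[of 0 1 "zeta 3"] by simp
  have z6: "zeta 6 \<in> quadratic_ring (zeta 3)" using quadratic_ring_int[of 1 1 "zeta 3"] by (simp add: zeta_6 add.commute)
  have z62: "zeta 3 = zeta 6 ^ 2"
    unfolding zeta_6 using zeta_3_quadratic by (simp add: power2_eq_square algebra_simps)
  have sq4: "\<i>\<^sup>2 \<in> quadratic_ring \<i>" using quadratic_ring_int[of "-1" 0 \<i>] by simp
  have z4: "\<i> \<in> quadratic_ring \<i>" using quadratic_ring_int[of 0 1 \<i>] by simp
  from assms consider "d = 3" "\<Gamma> = quadratic_ring (zeta 3)" | "d = 6" "\<Gamma> = quadratic_ring (zeta 3)"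
    | "d = 4" "\<Gamma> = quadratic_ring \<i>" by blast
  then show ?thesis
  proof cases
    case 1
    show ?thesis by (rule that[of "zeta 3" 1]) (use 1 im3 sq3 z3 eisenstein_euclid in simp_all)
  next
    case 2
    show ?thesis by (rule that[of "zeta 3" 2]) (use 2 im3 sq3 z6 z62 eisenstein_euclid in simp_all)
  next
    case 3
    show ?thesis by (rule that[of \<i> 1]) (use 3 sq4 z4 gaussian_euclid in \<open>simp_all add: zeta_4\<close>)
  qed
qed

lemma (in curve_lattice) mult_image_coset:
  assumes "\<And>l. l \<in> \<Lambda> \<Longrightarrow> c * l \<in> \<Lambda>" "\<And>l. l \<in> \<Lambda> \<Longrightarrow> c' * l \<in> \<Lambda>" "c * c' = 1"
  shows "(*) c ` coset \<Lambda> z = coset \<Lambda> (c * z)"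
proof
  show "(*) c ` coset \<Lambda> z \<subseteq> coset \<Lambda> (c * z)" using assms(1) by (auto simp: coset_def distrib_left)
  show "coset \<Lambda> (c * z) \<subseteq> (*) c ` coset \<Lambda> z"
  proof
    fix x assume "x \<in> coset \<Lambda> (c * z)"
    then obtain l where l: "l \<in> \<Lambda>" "x = c * z + l" by (auto simp: coset_def)
    have "x = c * (z + c' * l)"
      unfolding l(2) distrib_left mult.assoc[symmetric] assms(3) by simp
    then show "x \<in> (*) c ` coset \<Lambda> z" using assms(2)[OF l(1)] by (auto simp: coset_def)
  qed
qed

lemma X_quotient_orbit_eq:
  fixes u v :: "complex ^ 'n::finite"
  assumes d: "d > 0" and lat: "complex_lattice \<Gamma>" and z: "\<And>l. l \<in> \<Gamma> \<Longrightarrow> zeta d * l \<in> \<Gamma>"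
  shows "orbit (integer_mod_group d) (mult_action d \<Gamma>) (coset_map (\<lambda>_. \<Gamma>) u)
      = orbit (integer_mod_group d) (mult_action d \<Gamma>) (coset_map (\<lambda>_. \<Gamma>) v)
    \<longleftrightarrow> (\<exists>k. \<forall>j. v $ j - zeta d ^ k * u $ j \<in> \<Gamma>)"
proof -
  interpret Y: curve_family "\<lambda>_::'n. \<Gamma>" by unfold_locales (rule lat)
  let ?Z = "integer_mod_group d"
  have zk: "zeta d ^ k * l \<in> \<Gamma>" if "l \<in> \<Gamma>" for k l
    by (induction k) (use that z in \<open>auto simp: mult.assoc\<close>)
  have act: "mult_action d \<Gamma> k (Y.P u) = Y.P (zeta d ^ nat k *s u)" for k and u :: "complex ^ 'n"
  proof -
    \<comment> \<open>The inverse is written as a nonnegative power because stability of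
      \<open>\<Gamma>\<close> is known for such powers.\<close>
    have inv: "zeta d ^ nat k * zeta d ^ (d * nat k - nat k) = 1"
    proof -
      have "nat k \<le> d * nat k" using d by simp
      then have "zeta d ^ nat k * zeta d ^ (d * nat k - nat k) = zeta d ^ (d * nat k)" by (simp flip: power_add)
      then show ?thesis using d by (simp add: power_mult)
    qed
    have "mult_action d \<Gamma> k (Y.P u) = (\<lambda>j. (*) (zeta d ^ nat k) ` Y.P u j)"
      by (simp add: mult_action_def Y.topspace_curve_product)
    also have "\<dots> = Y.P (zeta d ^ nat k *s u)"
      by (simp add: coset_map_def Y.E.mult_image_coset[OF zk zk inv])
    finally show ?thesis .
  qed
  have carrier: "carrier ?Z = {0..<int d}" using d by (simp add: carrier_integer_mod_group)
  have zmod: "zeta d ^ (k mod d) = zeta d ^ k" for k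
  proof -
    have "zeta d ^ k = zeta d ^ (d * (k div d) + k mod d)" by simp
    also have "\<dots> = zeta d ^ (k mod d)" unfolding power_add power_mult using d by simp
    finally show ?thesis ..
  qed
  have "orbit ?Z (mult_action d \<Gamma>) (Y.P u) = orbit ?Z (mult_action d \<Gamma>) (Y.P v)
    \<longleftrightarrow> (\<exists>g\<in>carrier ?Z. mult_action d \<Gamma> g (Y.P u) = Y.P v)"
  proof (rule orbit_eq_iff[where Y = "range Y.P"])
    fix g h x assume gh: "g \<in> carrier ?Z" "h \<in> carrier ?Z" and "x \<in> range Y.P"
    then obtain u where x: "x = Y.P u" by blast
    have "nat ((g + h) mod int d) = (nat g + nat h) mod d"
      using gh carrier by (simp add: nat_mod_distrib nat_add_distrib)
    then show "mult_action d \<Gamma> (g \<otimes>\<^bsub>?Z\<^esub> h) x = mult_action d \<Gamma> g (mult_action d \<Gamma> h x)"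
      by (simp add: x act zmod power_add vector_smult_assoc)
  qed (auto simp: act)
  also have "\<dots> \<longleftrightarrow> (\<exists>g\<in>carrier ?Z. \<forall>j. v $ j - zeta d ^ nat g * u $ j \<in> \<Gamma>)"
  proof (rule bex_cong[OF refl])
    fix g
    show "mult_action d \<Gamma> g (Y.P u) = Y.P v \<longleftrightarrow> (\<forall>j. v $ j - zeta d ^ nat g * u $ j \<in> \<Gamma>)"
      unfolding act by (subst eq_commute) (simp add: Y.coset_map_eq_iff)
  qed
  also have "\<dots> \<longleftrightarrow> (\<exists>k. \<forall>j. v $ j - zeta d ^ k * u $ j \<in> \<Gamma>)"
  proof
    assume "\<exists>k. \<forall>j. v $ j - zeta d ^ k * u $ j \<in> \<Gamma>"
    then obtain k where "\<forall>j. v $ j - zeta d ^ k * u $ j \<in> \<Gamma>" by blast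
    then show "\<exists>g\<in>carrier ?Z. \<forall>j. v $ j - zeta d ^ nat g * u $ j \<in> \<Gamma>"
      using d carrier by (intro bexI[of _ "int (k mod d)"]) (auto simp: zmod)
  qed blast
  finally show ?thesis .
qed

section \<open>The quotient in linear coordinates, and the consequence of rigidity\<close>

context curve_family
begin

lemma quotient_biholomorphic:
  fixes G :: "('g, 'c) monoid_scheme" and D :: "'g \<Rightarrow> ('n \<Rightarrow> complex set) \<Rightarrow> ('n \<Rightarrow> complex set)"
  assumes aff: "\<And>j. affine_group G (\<Lambda> j) \<sigma> (\<beta> j)"
    and D: "\<And>g z. g \<in> carrier G \<Longrightarrow> D g (P z) = P (\<chi> j. \<sigma> g * z $ j + \<beta> j g)"
    and img: "\<sigma> ` carrier G = {z. z ^ d = 1}"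
    and \<Gamma>: "d \<in> {3, 6} \<and> \<Gamma> = quadratic_ring (zeta 3) \<or> d = 4 \<and> \<Gamma> = quadratic_ring \<i>"
  shows "biholomorphic (group_quotient G X D) (X_quotient d \<Gamma> :: ('n \<Rightarrow> complex set) set cspace)"
proof -
  interpret A: affine_group G "\<Lambda> j" \<sigma> "\<beta> j" for j by (rule aff)
  obtain w kw where w: "\<Gamma> = quadratic_ring w" "Im w \<noteq> 0" "w = zeta d ^ kw" "w\<^sup>2 \<in> \<Gamma>" "zeta d \<in> \<Gamma>"
    and euclid: "\<And>z. \<exists>q\<in>\<Gamma>. norm (z - q) \<le> sqrt 3 / 2"
    using quadratic_ring_data[OF \<Gamma>] by metis
  have lat: "complex_lattice \<Gamma>" unfolding w(1) by (rule complex_lattice_quadratic_ring[OF w(2)])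
  interpret Y: curve_family "\<lambda>_::'n. \<Gamma>" by unfold_locales (rule lat)
  have d: "d > 0" "d \<noteq> 1" using \<Gamma> by auto
  have z1: "zeta d \<noteq> 1" using zeta_pow_eq_1[OF d(1), of 1] d(2) by simp
  have "zeta d \<in> \<sigma> ` carrier G" using img d by simp
  then obtain g0 where g0: "g0 \<in> carrier G" "\<sigma> g0 = zeta d" by auto
  let ?T = "{t \<in> carrier G. \<sigma> t = 1}"
  \<comment> \<open>All translations of affine space that lift elements of \<open>?T\<close>: one
    group element must serve all coordinates, each modulo its own lattice. The product lattice is
    contained in \<open>L\<close>.\<close>
  define L where "L = {b :: complex ^ 'n. \<exists>t\<in>?T. \<forall>j. b $ j - \<beta> j t \<in> \<Lambda> j}"
  have L_diff: "b - b' \<in> L" if "b \<in> L" "b' \<in> L" for b b'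
  proof -
    from that obtain t t' where t: "t \<in> ?T" "\<And>j. b $ j - \<beta> j t \<in> \<Lambda> j"
      and t': "t' \<in> ?T" "\<And>j. b' $ j - \<beta> j t' \<in> \<Lambda> j" by (auto simp: L_def)
    have i: "inv\<^bsub>G\<^esub> t' \<in> carrier G" "t \<otimes>\<^bsub>G\<^esub> inv\<^bsub>G\<^esub> t' \<in> ?T"
      using t(1) t'(1) by (auto simp: A.chi_mult A.chi_inv)
    have "(b - b') $ j - \<beta> j (t \<otimes>\<^bsub>G\<^esub> inv\<^bsub>G\<^esub> t') \<in> \<Lambda> j" for j
    proof -
      have "\<beta> j \<one>\<^bsub>G\<^esub> - (\<beta> j t' + \<beta> j (inv\<^bsub>G\<^esub> t')) \<in> \<Lambda> j"
        using A.beta_translation_mult[OF t'(1) i(1), of j] t'(1) by simp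
      from E.diff_mem[OF this A.beta_one]
      have 1: "- (\<beta> j t' + \<beta> j (inv\<^bsub>G\<^esub> t')) \<in> \<Lambda> j" by simp
      have 2: "\<beta> j (t \<otimes>\<^bsub>G\<^esub> inv\<^bsub>G\<^esub> t') - (\<beta> j t + \<beta> j (inv\<^bsub>G\<^esub> t')) \<in> \<Lambda> j"
        by (rule A.beta_translation_mult[OF t(1) i(1)])
      have "(b $ j - \<beta> j t) - (b' $ j - \<beta> j t')
          - (\<beta> j (t \<otimes>\<^bsub>G\<^esub> inv\<^bsub>G\<^esub> t') - (\<beta> j t + \<beta> j (inv\<^bsub>G\<^esub> t'))) + - (\<beta> j t' + \<beta> j (inv\<^bsub>G\<^esub> t')) \<in> \<Lambda> j"
        by (intro E.add_mem E.diff_mem t t' 1 2)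
      then show ?thesis by (simp add: algebra_simps)
    qed
    then show ?thesis using i(2) unfolding L_def by blast
  qed
  have one_T: "\<one>\<^bsub>G\<^esub> \<in> ?T" by (simp add: A.chi_one)
  have L_lattice: "b \<in> L" if "\<And>j. b $ j \<in> \<Lambda> j" for b :: "complex ^ 'n"
    unfolding L_def mem_Collect_eq using that by (intro bexI[OF _ one_T] allI E.diff_mem A.beta_one)
  have L_zero: "0 \<in> L" by (rule L_lattice) simp
  have L_add: "b + b' \<in> L" if "b \<in> L" "b' \<in> L" for b b'
    using L_diff[OF that(1) L_diff[OF L_zero that(2)]] by simp
  have L_zeta: "zeta d *s b \<in> L" if "b \<in> L" for b
  proof -
    from that obtain t where t: "t \<in> ?T" "\<And>j. b $ j - \<beta> j t \<in> \<Lambda> j" by (auto simp: L_def)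
    have "(zeta d *s b) $ j - \<beta> j (g0 \<otimes>\<^bsub>G\<^esub> t \<otimes>\<^bsub>G\<^esub> inv\<^bsub>G\<^esub> g0) \<in> \<Lambda> j" for j
    proof -
      \<comment> \<open>Multiplication by \<open>zeta d\<close> on \<open>L\<close> is conjugation
        by \<open>g0\<close> on translations.\<close>
      have "\<sigma> g0 * (b $ j - \<beta> j t) - (\<beta> j (g0 \<otimes>\<^bsub>G\<^esub> t \<otimes>\<^bsub>G\<^esub> inv\<^bsub>G\<^esub> g0) - \<sigma> g0 * \<beta> j t) \<in> \<Lambda> j"
        by (intro E.diff_mem A.chi_lattice A.beta_conj g0 t)
      then show ?thesis by (simp add: g0(2) algebra_simps)
    qed
    then show ?thesis using A.conj_translation[OF t(1) g0(1)] unfolding L_def by blast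
  qed
  have L_zeta_pow: "zeta d ^ k *s b \<in> L" if "b \<in> L" for k b
  proof (induction k)
    case (Suc k)
    have "zeta d ^ Suc k *s b = zeta d *s (zeta d ^ k *s b)" by (simp add: vector_smult_assoc)
    then show ?case using L_zeta[OF Suc] by simp
  qed (use that in simp)
  have L_nat: "of_nat m *s b \<in> L" if "b \<in> L" for m b
    by (induction m) (use that L_zero L_add in \<open>auto simp: vector_sadd_rdistrib\<close>)
  have L_int: "of_int m *s b \<in> L" if "b \<in> L" for m b
  proof (cases m)
    case (neg n)
    have "of_int m *s b = 0 - of_nat (Suc n) *s b" by (simp add: neg vec_eq_iff algebra_simps)
    then show ?thesis using L_diff[OF L_zero L_nat[OF that, of "Suc n"]] by simp
  qed (use L_nat[OF that] in simp)
  have L_scale: "q *s b \<in> L" if q: "q \<in> \<Gamma>" and b: "b \<in> L" for q b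
  proof -
    obtain m n where "q = of_int m + of_int n * w" using q w(1) by (auto simp: quadratic_ring_def)
    then have "q *s b = of_int m *s b + of_int n *s (zeta d ^ kw *s b)"
      by (simp add: w(3) vector_sadd_rdistrib vector_smult_assoc)
    then show ?thesis using L_add[OF L_int[OF b] L_int[OF L_zeta_pow[OF b]]] by simp
  qed
  have "\<forall>j. \<exists>e>0. \<forall>l\<in>\<Lambda> j. norm l < e \<longrightarrow> l = 0" using E.discrete by metis
  then obtain e where e: "\<And>j. e j > 0" "\<And>j l. l \<in> \<Lambda> j \<Longrightarrow> norm l < e j \<Longrightarrow> l = 0" by metis
  \<comment> \<open>Multiplying a vector of \<open>L\<close> by \<open>order G\<close> brings it
    into the product lattice, because its group element has order dividing \<open>order G\<close>;
    hence the denominator.\<close>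
  define e0 where "e0 = Min (range e) / real (order G)"
  have e0: "e0 > 0" using e(1) A.order_pos by (auto simp: e0_def)
  have L_discrete: "e0 \<le> norm (v $ k)" if v: "v \<in> L" "v $ k \<noteq> 0" for v :: "complex ^ 'n" and k
  proof -
    from v(1) obtain t where t: "t \<in> ?T" "v $ k - \<beta> k t \<in> \<Lambda> k" by (auto simp: L_def)
    have 1: "\<beta> k \<one>\<^bsub>G\<^esub> - of_nat (order G) * \<beta> k t \<in> \<Lambda> k"
      using A.beta_translation_pow[OF t(1), of k "order G"] t(1) A.pow_order_eq_1 by simp
    have "of_int (int (order G)) * (v $ k - \<beta> k t) + (\<beta> k \<one>\<^bsub>G\<^esub> - (\<beta> k \<one>\<^bsub>G\<^esub> - of_nat (order G) * \<beta> k t)) \<in> \<Lambda> k"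
      by (intro E.add_mem E.diff_mem E.of_int_mult_mem A.beta_one t 1)
    then have "of_nat (order G) * v $ k \<in> \<Lambda> k" by (simp add: algebra_simps)
    moreover have "of_nat (order G) * v $ k \<noteq> 0" using v(2) A.order_pos by simp
    ultimately have "\<not> norm (of_nat (order G) * v $ k) < e k" using e(2) by blast
    then have "e k \<le> real (order G) * norm (v $ k)" by (simp add: norm_mult)
    moreover have "Min (range e) \<le> e k" by simp
    ultimately have "Min (range e) \<le> real (order G) * norm (v $ k)" by linarith
    then show ?thesis using A.order_pos by (simp add: e0_def field_simps)
  qed
  have L_full: "\<exists>v\<in>L. v $ k \<noteq> 0 \<and> (\<forall>m. m \<noteq> k \<longrightarrow> v $ m = 0)" for k
  proof -
    obtain l where l: "l \<in> \<Lambda> k" "l \<noteq> 0" using E.nonzero_member by blast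
    have "axis k l \<in> L" by (rule L_lattice) (use l in \<open>auto simp: axis_def\<close>)
    then show ?thesis using l(2) by (intro bexI[of _ "axis k l"]) (auto simp: axis_def)
  qed
  obtain N M :: "complex ^ 'n \<Rightarrow> complex ^ 'n" where N: "linear N" "\<And>a z. N (a *s z) = a *s N z"
    and M: "linear M" "\<And>a z. M (a *s z) = a *s M z"
    and NM: "\<And>z. N (M z) = z" "\<And>z. M (N z) = z" and NL: "\<And>z. z \<in> L \<longleftrightarrow> (\<forall>k. N z $ k \<in> \<Gamma>)"
  proof (rule module_lattice_basis[of L \<Gamma> "sqrt 3 / 2" e0])
    show "u - v \<in> L" if "u \<in> L" "v \<in> L" for u v using that by (rule L_diff)
    show "q *s v \<in> L" if "q \<in> \<Gamma>" "v \<in> L" for q v using that by (rule L_scale)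
    show "0 < sqrt 3 / 2" by simp
    have "sqrt 3 < sqrt (2\<^sup>2)" by (subst real_sqrt_less_iff) simp
    then show "sqrt 3 / 2 < (1::real)" by simp
    show "\<exists>q\<in>\<Gamma>. norm (z - q) \<le> sqrt 3 / 2" for z by (rule euclid)
    show "e0 > 0" by (rule e0)
    show "e0 \<le> norm (v $ k)" if "v \<in> L" "v $ k \<noteq> 0" for v :: "complex ^ 'n" and k
      using that by (rule L_discrete)
    show "\<exists>v\<in>L. v $ k \<noteq> 0 \<and> (\<forall>m. m \<noteq> k \<longrightarrow> v $ m = 0)" for k by (rule L_full)
    fix N M :: "complex ^ 'n \<Rightarrow> complex ^ 'n"
    assume "linear N" "linear M" "\<And>a z. N (a *s z) = a *s N z" "\<And>a z. M (a *s z) = a *s M z"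
      "\<And>z. N (M z) = z" "\<And>z. M (N z) = z" "\<And>z. z \<in> L \<longleftrightarrow> (\<forall>k. N z $ k \<in> \<Gamma>)"
    then show thesis by (intro that[of N M])
  qed
  \<comment> \<open>The fixed point of the affine lift of \<open>g0\<close>; it will be the new
    origin, around which \<open>g0\<close> is the scalar \<open>zeta d\<close>.\<close>
  define p :: "complex ^ 'n" where "p = (\<chi> j. \<beta> j g0 / (1 - zeta d))"
  define \<pi> where "\<pi> z = orbit G D (P z)" for z
  define \<pi>' where "\<pi>' u = orbit (integer_mod_group d) (mult_action d \<Gamma>) (coset_map (\<lambda>_. \<Gamma>) u)" for u :: "complex ^ 'n"
  \<comment> \<open>Both sides say, in coordinate \<open>j\<close>, that
    \<open>t \<otimes> g0^k\<close> sends \<open>z\<close> to \<open>z'\<close>; the left side is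
    centred at \<open>p\<close>, where only the translation \<open>t\<close> is left besides the
    scalar.\<close>
  have identity: "(z' - p - zeta d ^ k *s (z - p)) $ j - \<beta> j t \<in> \<Lambda> j
      \<longleftrightarrow> zeta d ^ k * z $ j + \<beta> j (t \<otimes>\<^bsub>G\<^esub> g0 [^]\<^bsub>G\<^esub> k) - z' $ j \<in> \<Lambda> j"
    if t: "t \<in> ?T" for t k z z' j
  proof -
    let ?h = "g0 [^]\<^bsub>G\<^esub> k"
    have "\<beta> j (t \<otimes>\<^bsub>G\<^esub> ?h) - (\<beta> j t + \<beta> j ?h) \<in> \<Lambda> j"
      by (rule A.beta_translation_mult[OF t]) (use g0 in simp)
    moreover have "\<beta> j ?h - (1 - zeta d ^ k) * p $ j \<in> \<Lambda> j"
      using A.beta_pow[OF g0(1), of j k] z1 g0(2) by (simp add: p_def)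
    ultimately have s: "(\<beta> j (t \<otimes>\<^bsub>G\<^esub> ?h) - (\<beta> j t + \<beta> j ?h)) + (\<beta> j ?h - (1 - zeta d ^ k) * p $ j) \<in> \<Lambda> j"
      by (rule E.add_mem)
    have "(z' - p - zeta d ^ k *s (z - p)) $ j - \<beta> j t =
      - (zeta d ^ k * z $ j + \<beta> j (t \<otimes>\<^bsub>G\<^esub> ?h) - z' $ j)
      + ((\<beta> j (t \<otimes>\<^bsub>G\<^esub> ?h) - (\<beta> j t + \<beta> j ?h)) + (\<beta> j ?h - (1 - zeta d ^ k) * p $ j))"
      by (simp add: algebra_simps)
    then show ?thesis using E.add_mem_iff[OF s] E.minus_mem_iff by metis
  qed
  have orbit_iff: "\<pi> z = \<pi> z' \<longleftrightarrow> (\<exists>k. z' - p - zeta d ^ k *s (z - p) \<in> L)" for z z'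
  proof -
    have "\<pi> z = \<pi> z' \<longleftrightarrow> (\<exists>g\<in>carrier G. D g (P z) = P z')"
      unfolding \<pi>_def
    proof (rule orbit_eq_iff[where Y = "range P"])
      show "group G" by (rule A.is_group)
      fix x assume "x \<in> range P"
      then obtain z where x: "x = P z" by blast
      show "D \<one>\<^bsub>G\<^esub> x = x" by (simp add: x D A.chi_one coset_map_eq_iff A.beta_one)
      fix g h assume gh: "g \<in> carrier G" "h \<in> carrier G"
      show "D g x \<in> range P" using D[OF gh(1)] x by simp
      have "\<sigma> (g \<otimes>\<^bsub>G\<^esub> h) * z $ j + \<beta> j (g \<otimes>\<^bsub>G\<^esub> h) - (\<sigma> g * (\<sigma> h * z $ j + \<beta> j h) + \<beta> j g) \<in> \<Lambda> j" for j
        using A.beta_mult[OF gh, of j] A.chi_mult[OF gh] by (simp add: algebra_simps)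
      then show "D (g \<otimes>\<^bsub>G\<^esub> h) x = D g (D h x)" using gh by (simp add: x D coset_map_eq_iff)
    qed auto
    also have "\<dots> \<longleftrightarrow> (\<exists>g\<in>carrier G. \<forall>j. \<sigma> g * z $ j + \<beta> j g - z' $ j \<in> \<Lambda> j)"
      by (rule bex_cong) (auto simp: D coset_map_eq_iff)
    also have "\<dots> \<longleftrightarrow> (\<exists>k. z' - p - zeta d ^ k *s (z - p) \<in> L)"
    proof
      assume "\<exists>g\<in>carrier G. \<forall>j. \<sigma> g * z $ j + \<beta> j g - z' $ j \<in> \<Lambda> j"
      then obtain g where g: "g \<in> carrier G" "\<And>j. \<sigma> g * z $ j + \<beta> j g - z' $ j \<in> \<Lambda> j" by blast
      have "\<sigma> g ^ d = 1" using img g(1) by blast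
      then obtain k where k: "\<sigma> g = zeta d ^ k" using root_of_unity_zeta[OF d(1)] by metis
      \<comment> \<open>Dividing \<open>g\<close> by the power of \<open>g0\<close> with the same
        multiplier leaves a translation, so every element has the form covered by
        \<open>identity\<close>.\<close>
      let ?h = "g0 [^]\<^bsub>G\<^esub> k"
      let ?t = "g \<otimes>\<^bsub>G\<^esub> inv\<^bsub>G\<^esub> ?h"
      have h: "?h \<in> carrier G" "\<sigma> ?h = zeta d ^ k" using g0 by (auto simp: A.chi_pow)
      have t: "?t \<in> ?T" "?t \<otimes>\<^bsub>G\<^esub> ?h = g"
        using g(1) h k A.chi_nonzero[OF h(1)] by (auto simp: A.chi_mult A.chi_inv A.m_assoc)
      have "(z' - p - zeta d ^ k *s (z - p)) $ j - \<beta> j ?t \<in> \<Lambda> j" for j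
        unfolding identity[OF t(1)] t(2) using g(2)[of j] k by simp
      then show "\<exists>k. z' - p - zeta d ^ k *s (z - p) \<in> L" using t(1) unfolding L_def by blast
    next
      assume "\<exists>k. z' - p - zeta d ^ k *s (z - p) \<in> L"
      then obtain k t where t: "t \<in> ?T" "\<And>j. (z' - p - zeta d ^ k *s (z - p)) $ j - \<beta> j t \<in> \<Lambda> j"
        unfolding L_def by blast
      have "\<sigma> (t \<otimes>\<^bsub>G\<^esub> g0 [^]\<^bsub>G\<^esub> k) = zeta d ^ k" using t(1) g0 by (simp add: A.chi_mult A.chi_pow)
      then have "\<sigma> (t \<otimes>\<^bsub>G\<^esub> g0 [^]\<^bsub>G\<^esub> k) * z $ j + \<beta> j (t \<otimes>\<^bsub>G\<^esub> g0 [^]\<^bsub>G\<^esub> k) - z' $ j \<in> \<Lambda> j" for j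
        using t(2)[of j] unfolding identity[OF t(1)] by simp
      then show "\<exists>g\<in>carrier G. \<forall>j. \<sigma> g * z $ j + \<beta> j g - z' $ j \<in> \<Lambda> j"
        using t(1) g0(1) by (intro bexI[of _ "t \<otimes>\<^bsub>G\<^esub> g0 [^]\<^bsub>G\<^esub> k"]) auto
    qed
    finally show ?thesis .
  qed
  have zeta_\<Gamma>: "zeta d * l \<in> \<Gamma>" if "l \<in> \<Gamma>" for l
    using quadratic_ring_mult_closed[of w "zeta d" l] w that by simp
  have orbit_iff': "\<pi>' u = \<pi>' v \<longleftrightarrow> (\<exists>k. \<forall>j. v $ j - zeta d ^ k * u $ j \<in> \<Gamma>)" for u v
    unfolding \<pi>'_def by (rule X_quotient_orbit_eq[OF d(1) lat zeta_\<Gamma>])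
  \<comment> \<open>After centring at \<open>p\<close> and applying \<open>N\<close>, both orbit
    relations read: equal up to a power of \<open>zeta d\<close> and a vector with coordinates in
    \<open>\<Gamma>\<close>.\<close>
  have eq: "\<pi> z = \<pi> z' \<longleftrightarrow> \<pi>' (N (z - p)) = \<pi>' (N (z' - p))" for z z'
    unfolding orbit_iff orbit_iff' NL
    by (simp add: linear_diff[OF N(1)] N(2) right_diff_distrib)
  show ?thesis
  proof (rule uniformized_biholomorphic[where \<pi> = \<pi> and \<pi>' = \<pi>' and A = "\<lambda>z. N (z - p)" and D = N
        and B = "\<lambda>u. M u + p" and D' = M])
    show "uniformized (group_quotient G X D) \<pi>"
      unfolding \<pi>_def by (rule uniformized_group_quotient[OF uniformized_curve_product])
    show "uniformized (X_quotient d \<Gamma>) \<pi>'"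
      unfolding \<pi>'_def X_quotient_def by (rule uniformized_group_quotient[OF Y.uniformized_curve_product])
    show "((\<lambda>z. N (z - p)) has_derivative N) (at z)" for z
      using has_derivative_diff[OF linear_imp_has_derivative[OF N(1)] has_derivative_const[of "N p"]]
      by (simp add: linear_diff[OF N(1)])
    show "((\<lambda>u. M u + p) has_derivative M) (at u)" for u
      using has_derivative_add[OF linear_imp_has_derivative[OF M(1)] has_derivative_const[of p]] by simp
  qed (use N(2) M(2) NM eq in simp_all)
qed

text \<open>Multipliers have modulus 1, so a trivial product means that \<open>\<rho> j\<close> is
  the conjugate of \<open>\<rho> i\<close>, exactly the condition under which
  \<open>conj_cocycle i j\<close> has an invariant class. The indices may coincide.\<close>

lemma rigid_nontrivial_products:
  fixes G :: "('g, 'c) monoid_scheme" and D :: "'g \<Rightarrow> ('n \<Rightarrow> complex set) \<Rightarrow> ('n \<Rightarrow> complex set)"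
  assumes aff: "\<And>j. affine_group G (\<Lambda> j) (\<rho> j) (\<beta> j)"
    and D: "\<And>g z. g \<in> carrier G \<Longrightarrow> D g (P z) = P (\<chi> j. \<rho> j g * z $ j + \<beta> j g)"
    and rigid: "rigid_action G X D"
  shows "\<exists>g\<in>carrier G. \<rho> i g * \<rho> j g \<noteq> 1"
proof (rule ccontr)
  assume "\<not> ?thesis"
  then have triv: "\<And>g. g \<in> carrier G \<Longrightarrow> \<rho> i g * \<rho> j g = 1" by blast
  interpret A: affine_group G "\<Lambda> k" "\<rho> k" "\<beta> k" for k by (rule aff)
  have hol: "holomorphic_map X X (D g)" if g: "g \<in> carrier G" for g
  proof (rule uniformized_holomorphic_map[OF uniformized_curve_product uniformized_curve_product])
    show "D g (P z) = P (\<chi> j. \<rho> j g * z $ j + \<beta> j g)" for z by (rule D[OF g])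
    have lin: "bounded_linear (\<lambda>w :: complex ^ 'n. \<chi> j. \<rho> j g * w $ j)"
      by (rule linear_conv_bounded_linear[THEN iffD1], rule linearI) (simp_all add: vec_eq_iff algebra_simps)
    have "(\<lambda>z :: complex ^ 'n. \<chi> j. \<rho> j g * z $ j + \<beta> j g) = (\<lambda>z. (\<chi> j. \<rho> j g * z $ j) + (\<chi> j. \<beta> j g))"
      by (simp add: fun_eq_iff vec_eq_iff)
    then show "((\<lambda>z :: complex ^ 'n. \<chi> j. \<rho> j g * z $ j + \<beta> j g) has_derivative (\<lambda>w. \<chi> j. \<rho> j g * w $ j)) (at z)" for z
      using has_derivative_add[OF bounded_linear_imp_has_derivative[OF lin] has_derivative_const] by simp
  qed (simp add: vec_eq_iff)
  have comp: "D g (D h x) = x"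
    if g: "g \<in> carrier G" "h \<in> carrier G" "g \<otimes>\<^bsub>G\<^esub> h = \<one>\<^bsub>G\<^esub>" and x: "x \<in> topspace (ctop X)" for g h x
  proof -
    obtain z where z: "x = P z" using x unfolding topspace_curve_product by blast
    have "\<rho> k g * (\<rho> k h * z $ k + \<beta> k h) + \<beta> k g - z $ k \<in> \<Lambda> k" for k
    proof -
      from E.diff_mem[OF A.beta_one A.beta_mult[OF g(1,2), of k, unfolded g(3)]]
      have "\<rho> k g * \<beta> k h + \<beta> k g \<in> \<Lambda> k" by simp
      moreover have "\<rho> k g * \<rho> k h = 1" using A.chi_mult[OF g(1,2), of k] A.chi_one g(3) by simp
      then have "\<rho> k g * (\<rho> k h * z $ k + \<beta> k h) + \<beta> k g - z $ k = \<rho> k g * \<beta> k h + \<beta> k g"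
        by (simp add: distrib_left flip: mult.assoc)
      ultimately show ?thesis by (simp only:)
    qed
    then show ?thesis by (simp add: z D g coset_map_eq_iff)
  qed
  have aut: "sheaf_automorphism X (D g) (D (inv\<^bsub>G\<^esub> g))" if g: "g \<in> carrier G" for g
    by unfold_locales (use g in \<open>auto intro: hol comp\<close>)
  have "(conj_cocycle i j, ({topspace (ctop X)}, \<lambda>_ _ _ _. 0)) \<in> cohomologous X"
  proof (rule S.rigid_action_imp_trivial[OF rigid _ conj_cocycle_mem])
    fix g assume g: "g \<in> carrier G"
    show "\<exists>h. sheaf_automorphism X (D g) h" using aut[OF g] by blast
    have "\<rho> i g * cnj (\<rho> i g) = 1" using A.norm_chi[OF g] by (simp flip: complex_norm_square)
    then have "\<rho> j g = cnj (\<rho> i g)"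
      using triv[OF g] A.chi_nonzero[OF g, of i] by (metis mult_left_cancel)
    then show "(conj_cocycle i j, push_cocycle X (D g) (conj_cocycle i j)) \<in> cohomologous X"
      using A.chi_nonzero[OF g] A.chi_lattice[OF g] by (intro conj_cocycle_push[OF aut[OF g] D[OF g]])
  qed
  then show False by (rule not_coboundary)
qed

end

theorem theorem1p5:
  fixes G :: "('g, 'c) monoid_scheme"
    and \<Lambda> :: "'n::finite \<Rightarrow> complex set"
    and \<phi> :: "'n \<Rightarrow> 'g \<Rightarrow> complex set \<Rightarrow> complex set"
  assumes "group G" and "finite (carrier G)" and "\<not> exceptional G"
    and "\<And>j. complex_lattice (\<Lambda> j)"
    and "\<And>j. faithful_holomorphic_action G (elliptic_curve (\<Lambda> j)) (\<phi> j)"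
    and "rigid_action G (curve_product \<Lambda>) (diagonal_action \<Lambda> \<phi>)"
  shows "\<exists>d \<Gamma>. (d \<in> {3, 6} \<and> \<Gamma> = quadratic_ring (zeta 3) \<or> d = 4 \<and> \<Gamma> = quadratic_ring \<i>) \<and>
    biholomorphic
      (group_quotient G (curve_product \<Lambda>) (diagonal_action \<Lambda> \<phi>))
      (X_quotient d \<Gamma> :: ('n \<Rightarrow> complex set) set cspace)"
proof -
  interpret curve_family \<Lambda> by unfold_locales (rule assms(4))
  have "\<forall>j. \<exists>\<rho> \<beta>. affine_group G (\<Lambda> j) \<rho> \<beta> \<and>
      (\<forall>g\<in>carrier G. \<forall>z. \<phi> j g (coset (\<Lambda> j) z) = coset (\<Lambda> j) (\<rho> g * z + \<beta> g))"
    using faithful_action_affine[OF assms(1,2,4,5)] by metis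
  then obtain \<rho> \<beta> where aff: "\<And>j. affine_group G (\<Lambda> j) (\<rho> j) (\<beta> j)"
    and lift: "\<And>j g z. g \<in> carrier G \<Longrightarrow> \<phi> j g (coset (\<Lambda> j) z) = coset (\<Lambda> j) (\<rho> j g * z + \<beta> j g)"
    by metis
  interpret A: affine_group G "\<Lambda> j" "\<rho> j" "\<beta> j" for j by (rule aff)
  let ?D = "diagonal_action \<Lambda> \<phi>"
  have D: "?D g (P z) = P (\<chi> j. \<rho> j g * z $ j + \<beta> j g)" if "g \<in> carrier G" for g z
    using that by (simp add: diagonal_action_def topspace_curve_product) (simp add: coset_map_def lift)
  have nontriv: "\<exists>g\<in>carrier G. \<rho> i g * \<rho> j g \<noteq> 1" for i j
    by (rule rigid_nontrivial_products[OF aff D assms(6)])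
  have "\<forall>j. \<exists>d\<in>{3, 4, 6}. \<rho> j ` carrier G = {z. z ^ d = 1}"
  proof
    fix j
    \<comment> \<open>The case of equal indices: some square of a multiplier is nontrivial, as
      \<open>chi_image\<close> requires.\<close>
    obtain g where "g \<in> carrier G" "\<rho> j g * \<rho> j g \<noteq> 1" using nontriv by blast
    then show "\<exists>d\<in>{3, 4, 6}. \<rho> j ` carrier G = {z. z ^ d = 1}"
      by (intro A.chi_image) (auto simp: power2_eq_square)
  qed
  then obtain dd where dd: "\<And>j. dd j \<in> {3, 4, 6}" "\<And>j. \<rho> j ` carrier G = {z. z ^ dd j = 1}" by metis
  have T: "{g \<in> carrier G. \<rho> i g = 1} = {g \<in> carrier G. \<rho> j g = 1}" for i j
    by (rule translation_set_eq[OF aff aff dd(2,1) dd(2,1) assms(3)])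
  \<comment> \<open>An arbitrary reference factor, to whose character all others are
    compared.\<close>
  define c :: 'n where "c = undefined"
  define d where "d = dd c"
  have d: "d \<in> {3, 4, 6}" "d > 0" using dd(1)[of c] by (auto simp: d_def)
  have img: "\<rho> c ` carrier G = {z. z ^ d = 1}" using dd(2) by (simp add: d_def)
  have "zeta d \<in> \<rho> c ` carrier G" unfolding img using d by simp
  then obtain g0 where g0: "g0 \<in> carrier G" "\<rho> c g0 = zeta d" by auto
  have same: "\<rho> j g = \<rho> c g" if g: "g \<in> carrier G" for j g
  proof -
    have T1: "\<rho> j h = 1 \<longleftrightarrow> \<rho> c h = 1" if "h \<in> carrier G" for h using T[of j c] that by blast
    \<comment> \<open>Equal kernels give \<open>\<rho> j g0\<close> the same order as
      \<open>zeta d\<close>.\<close>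
    have pow: "\<rho> j g0 ^ m = 1 \<longleftrightarrow> zeta d ^ m = 1" for m
      using T1[of "g0 [^]\<^bsub>G\<^esub> m"] g0 by (simp add: A.chi_pow)
    \<comment> \<open>Modulo the common kernel the group is generated by \<open>g0\<close>, so a
      character is determined by its value there.\<close>
    have power: "\<exists>k. \<rho> c h = zeta d ^ k \<and> \<rho> j h = \<rho> j g0 ^ k" if h: "h \<in> carrier G" for h
    proof -
      have "\<rho> c h ^ d = 1" using img h by blast
      then obtain k where k: "\<rho> c h = zeta d ^ k" using root_of_unity_zeta[OF d(2)] by metis
      let ?t = "h \<otimes>\<^bsub>G\<^esub> inv\<^bsub>G\<^esub> (g0 [^]\<^bsub>G\<^esub> k)"
      have cc: "g0 [^]\<^bsub>G\<^esub> k \<in> carrier G" "?t \<in> carrier G" using g0 h by auto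
      have "\<rho> c ?t = 1"
        using k g0 h cc A.chi_nonzero[OF cc(1), of c] by (simp add: A.chi_mult A.chi_inv A.chi_pow)
      then have "\<rho> j ?t = 1" using T1 cc by blast
      then have "\<rho> j h * inverse (\<rho> j g0 ^ k) = 1" using g0 h cc by (simp add: A.chi_mult A.chi_inv A.chi_pow)
      then have "\<rho> j h = \<rho> j g0 ^ k" using A.chi_nonzero[OF g0(1), of j] by (simp add: field_simps)
      then show ?thesis using k by blast
    qed
    have "\<rho> j g0 = zeta d \<or> \<rho> j g0 * zeta d = 1"
      by (rule primitive_root_cases[OF d(1)]) (use pow d(2) in auto)
    \<comment> \<open>The inverse root would make \<open>\<rho> j * \<rho> c\<close> trivial on the
      whole group, against rigidity.\<close>
    moreover have "\<rho> j g0 * zeta d \<noteq> 1"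
    proof
      assume "\<rho> j g0 * zeta d = 1"
      then have "\<rho> j h * \<rho> c h = 1" if "h \<in> carrier G" for h
        using power[OF that] by (auto simp flip: power_mult_distrib)
      then show False using nontriv[of j c] by blast
    qed
    ultimately show ?thesis using power[OF g] by auto
  qed
  \<comment> \<open>The characters agree on the carrier only, so the axioms are transferred one by
    one to the common multiplier.\<close>
  have aff': "affine_group G (\<Lambda> j) (\<rho> c) (\<beta> j)" for j
  proof
    show "finite (carrier G)" by (rule assms(2))
    show "\<rho> c \<one>\<^bsub>G\<^esub> = 1" by (rule A.chi_one)
    fix g assume g: "g \<in> carrier G"
    show "\<rho> c g * l \<in> \<Lambda> j" if "l \<in> \<Lambda> j" for l using A.chi_lattice[OF g that] same[OF g, of j] by simp
    show "g = \<one>\<^bsub>G\<^esub>" if "\<rho> c g = 1" "\<beta> j g \<in> \<Lambda> j" using A.faithful[OF g _ that(2)] same[OF g, of j] that(1) by simp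
    fix h assume h: "h \<in> carrier G"
    show "\<rho> c (g \<otimes>\<^bsub>G\<^esub> h) = \<rho> c g * \<rho> c h" by (rule A.chi_mult[OF g h])
    show "\<beta> j (g \<otimes>\<^bsub>G\<^esub> h) - (\<rho> c g * \<beta> j h + \<beta> j g) \<in> \<Lambda> j"
      using A.beta_mult[OF g h, of j] same[OF g, of j] by simp
  qed
  have D': "?D g (P z) = P (\<chi> j. \<rho> c g * z $ j + \<beta> j g)" if "g \<in> carrier G" for g z
  proof -
    have "\<rho> j g * z $ j + \<beta> j g = \<rho> c g * z $ j + \<beta> j g" for j
      by (simp only: same[OF that, of j])
    then show ?thesis unfolding D[OF that] by (simp only:)
  qed
  from d(1) consider "d \<in> {3, 6}" | "d = 4" by auto
  then show ?thesis
  proof cases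
    case 1
    then show ?thesis
      using quotient_biholomorphic[OF aff' D' img] by (intro exI[of _ d] exI[of _ "quadratic_ring (zeta 3)"]) blast
  next
    case 2
    then show ?thesis
      using quotient_biholomorphic[OF aff' D' img] by (intro exI[of _ d] exI[of _ "quadratic_ring \<i>"]) blast
  qed
qed

end
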